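(* Let $n\ge3$. There exists a constant $\varepsilon>0$, depending only on $n$, such that the following holds. Let $V\in\mathcal{KS}_n$ satisfy $$\limsup_{r\to0}\|\mathbf{1}_{B(z,r)}V\|_{\mathcal{KS}_n}\le\varepsilon\qquad\text{for all } z\in\mathbb{R}^n.$$ Then for every $a\in\mathbb{R}^n$ there exists $\delta>0$ (depending only on $n$, $V$ and $a$) such that, whenever $u\in W^{2,2}(\mathbb{R}^n)$ is a nontrivial (i.e. not almost everywhere zero) solution of $|\Delta u(x)|\le|V(x)u(x)|$ for a.e. $x\in\mathbb{R}^n$ whose support is contained in a ball $B(a,r)$, $r>0$, the Lebesgue measure of the ball satisfies $|B(a,r)|\ge\delta$.
   Context: $W^{m,p}(\mathbb{R}^n)$ is the Sobolev space of (complex-valued) functions whose derivatives up to order $m$ belong to $L^p(\mathbb{R}^n)$. $B(x,r)$ is the open ball of radius $r$ centered at $x$, and $\mathbf{1}_A$ is the characteristic function of $A$. For $n\ge3$ and $V$ (complex-valued) locally integrable on $\mathbb{R}^n$, the Kerman-Sawyer norm is $$\|V\|_{\mathcal{KS}_n}=\sup_{Q}\Big(\int_Q|V(x)|\,dx\Big)^{-1}\int_Q\int_Q\frac{|V(x)V(y)|}{|x-y|^{n-2}}\,dx\,dy,$$ where the supremum is over all dyadic cubes $Q$ in $\mathbb{R}^n$ (cubes with $\int_Q|V|=0$ contribute $0$). The Kerman-Sawyer class $\mathcal{KS}_n$ is the set of $V$ with $\|V\|_{\mathcal{KS}_n}<\infty$. *)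

theory Defs
  imports "HOL-Analysis.Analysis"
begin

definition locally_integrable :: "(real^'n \<Rightarrow> complex) \<Rightarrow> bool" where
  "locally_integrable f \<longleftrightarrow> (\<forall>K. compact K \<longrightarrow> f absolutely_integrable_on K)"

definition partial_deriv :: "'n \<Rightarrow> (real^'n \<Rightarrow> complex) \<Rightarrow> real^'n \<Rightarrow> complex" where
  "partial_deriv i f x = frechet_derivative f (at x) (axis i 1)"

text \<open>A multi-index of order \<open>k\<close> is encoded as a list of \<open>k\<close> coordinate directions. Several lists
  encode the same multi-index; on smooth functions they give the same derivative.\<close>

definition partial_derivs :: "'n list \<Rightarrow> (real^'n \<Rightarrow> complex) \<Rightarrow> real^'n \<Rightarrow> complex" where
  "partial_derivs is f = foldr partial_deriv is f"

definition smooth :: "(real^'n \<Rightarrow> complex) \<Rightarrow> bool" where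
  "smooth f \<longleftrightarrow> (\<forall>is. partial_derivs is f differentiable_on UNIV)"

definition test_function :: "(real^'n \<Rightarrow> complex) \<Rightarrow> bool" where
  "test_function \<phi> \<longleftrightarrow> smooth \<phi> \<and> compact (closure {x. \<phi> x \<noteq> 0})"

definition has_weak_deriv ::
    "(real^'n \<Rightarrow> complex) \<Rightarrow> 'n list \<Rightarrow> (real^'n \<Rightarrow> complex) \<Rightarrow> bool" where
  "has_weak_deriv u is g \<longleftrightarrow> locally_integrable u \<and> locally_integrable g \<and>
     (\<forall>\<phi>. test_function \<phi> \<longrightarrow>
        (LINT x|lebesgue. u x * partial_derivs is \<phi> x) =
        (-1) ^ length is * (LINT x|lebesgue. g x * \<phi> x))"

text \<open>A representative of the weak derivative, which is unique up to null sets
  (unspecified if there is no weak derivative).\<close>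

definition weak_deriv :: "'n list \<Rightarrow> (real^'n \<Rightarrow> complex) \<Rightarrow> real^'n \<Rightarrow> complex" where
  "weak_deriv is u = (SOME g. has_weak_deriv u is g)"

definition laplacian :: "(real^'n \<Rightarrow> complex) \<Rightarrow> real^'n \<Rightarrow> complex" where
  "laplacian u x = (\<Sum>i\<in>UNIV. weak_deriv [i, i] u x)"

text \<open>\<open>L\<^sup>p\<close> and \<open>W\<^sup>m\<^sup>,\<^sup>p\<close> for finite exponents \<open>p \<ge> 1\<close>, as sets of functions
  rather than of almost-everywhere classes.\<close>

definition Lp_space :: "real \<Rightarrow> (real^'n \<Rightarrow> complex) set" where
  "Lp_space p = {f \<in> borel_measurable lebesgue. integrable lebesgue (\<lambda>x. norm (f x) powr p)}"

definition sobolev :: "nat \<Rightarrow> real \<Rightarrow> (real^'n \<Rightarrow> complex) set" where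
  "sobolev m p = {u \<in> Lp_space p. \<forall>is. length is \<le> m \<longrightarrow> (\<exists>g\<in>Lp_space p. has_weak_deriv u is g)}"

text \<open>Support of a function defined up to null sets: the complement of the largest open set
  on which it vanishes almost everywhere.\<close>

definition ess_support :: "(real^'n \<Rightarrow> complex) \<Rightarrow> (real^'n) set" where
  "ess_support u = - \<Union>{U. open U \<and> (AE x in lebesgue. x \<in> U \<longrightarrow> u x = 0)}"

definition dyadic_cube :: "int \<Rightarrow> int^'n \<Rightarrow> (real^'n) set" where
  "dyadic_cube k m =
     {x. \<forall>i. 2 powi k * of_int (m $ i) \<le> x $ i \<and> x $ i < 2 powi k * (of_int (m $ i) + 1)}"

definition dyadic_cubes :: "(real^'n) set set" where
  "dyadic_cubes = {dyadic_cube k m | k m. True}"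

text \<open>The quotient is taken in \<^typ>\<open>ennreal\<close>, where \<open>0 / 0 = 0\<close>; hence cubes on which \<open>V\<close> vanishes
  almost everywhere contribute \<open>0\<close>. The value of the kernel on the null set \<open>x = y\<close> is
  irrelevant.\<close>

definition kerman_sawyer_norm :: "(real^'n \<Rightarrow> complex) \<Rightarrow> ennreal" where
  "kerman_sawyer_norm V =
     (SUP Q\<in>dyadic_cubes.
        (\<integral>\<^sup>+x\<in>Q. (\<integral>\<^sup>+y\<in>Q. ennreal (norm (V x * V y) / norm (x - y) ^ (CARD('n) - 2)) \<partial>lebesgue) \<partial>lebesgue)
        / (\<integral>\<^sup>+x\<in>Q. ennreal (norm (V x)) \<partial>lebesgue))"

definition kerman_sawyer_class :: "(real^'n \<Rightarrow> complex) set" where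
  "kerman_sawyer_class = {V. locally_integrable V \<and> kerman_sawyer_norm V < \<infinity>}"

end

theory Submission
  imports Defs
begin

text \<open>Put \<open>h = |\<Delta>u|\<close>, \<open>W = 1\<^bsub>B(a,r0)\<^esub> |V|\<close> and \<open>I h(x) = \<integral> h(y) |x - y|^(2-n) dy\<close>. Testing the equation against
  cut-off translates of \<open>(|z|^2 + \<epsilon>^2)^(1-n/2)\<close>, whose negative Laplacian is an approximate identity of
  mass \<open>\<kappa> > 0\<close>, gives \<open>\<kappa> |u| \<le> I h\<close> almost everywhere. Let \<open>D\<close> be the sum over all dyadic cubes \<open>Q\<close> of
  \<open>\<ell>(Q)^(2-n) (\<integral>\<^sub>Q h)^2\<close>. Decomposing the kernel over pairs of neighbouring cubes and using
  \<open>2 a b \<le> a^2 + b^2\<close> gives \<open>\<integral> h I h \<le> C D\<close>, so one dyadic grid suffices. Conversely the Kerman-Sawyer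
  norm of \<open>W\<close> bounds the Carleson constant of the sequence \<open>\<ell>(Q)^(2-n) (\<integral>\<^sub>Q W)^2\<close>, and since \<open>h \<le> W |u|\<close>,
  Carleson embedding with respect to the measure \<open>W dx\<close> gives \<open>D \<le> C' \<parallel>W\<parallel> \<integral> h |u|\<close>, where the right-hand
  side is finite because \<open>u\<close> and \<open>\<Delta>u\<close> are square integrable. Altogether
  \<open>\<kappa> D \<le> C C' \<parallel>W\<parallel> D < \<infinity>\<close>, so a small norm forces \<open>D = 0\<close>, hence \<open>h = 0\<close> and \<open>u = 0\<close>.\<close>

subsection \<open>Explicit test functions\<close>

text \<open>\<open>has_weak_deriv\<close> tests only against smooth compactly supported functions,
  while the Newtonian kernel is singular and extends to infinity. Regularising it by epsilon^2 keeps
  the Laplacian explicit, and the cut-off is harmless because it equals 1 on the ball outside which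
  u vanishes. Only the inequality with I h is extracted, with the right-hand side independent of
  epsilon, so no limit is taken inside the potential. The same inequality closes the argument: h = 0
  makes I h vanish identically, hence u as well. The Carleson condition comes from counting. In the
  sum over the subcubes of Q, a pair of points x, y receives the weight \<ell>(R)^(2-n) from each R
  containing both. As n \<ge> 3, these weights form a geometric series whose largest term belongs to
  the smallest common cube and is at most n^(n-2) |x - y|^(2-n). Integrating gives the double
  integral in the norm of W, up to the factor 2 n^(n-2).\<close>

definition flat :: "real poly \<Rightarrow> real \<Rightarrow> real" where
  "flat p t = (if t > 0 then poly p (1 / t) * exp (- (1 / t)) else 0)"

text \<open>The free power \<open>k\<close> carries the induction over \<open>pCons\<close>: the
  factor x is absorbed into it. The case k = 1 gives the right-hand difference quotient of
  \<open>flat p\<close> at 0.\<close>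

lemma tendsto_power_poly_exp_minus:
  "((\<lambda>x::real. x ^ k * poly p x * exp (- x)) \<longlongrightarrow> 0) at_top"
proof (induction p arbitrary: k rule: pCons_induct)
  case 0
  then show ?case by simp
next
  case (pCons a p)
  have "((\<lambda>x::real. a * (x ^ k / exp x) + x ^ Suc k * poly p x * exp (- x)) \<longlongrightarrow> a * 0 + 0) at_top"
    by (intro tendsto_intros tendsto_power_div_exp_0 pCons.IH)
  moreover have "a * (x ^ k / exp x) + x ^ Suc k * poly p x * exp (- x)
      = x ^ k * poly (pCons a p) x * exp (- x)" for x :: real
    by (simp add: exp_minus field_simps)
  ultimately show ?case by simp
qed

text \<open>The polynomial variable stands for 1 / t, so the chain rule contributes 1 / t^2, that is
  the factor \<open>[:0, 0, 1:]\<close>, and p - p' comes from the product rule with exp (- 1 / t).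
  The family is therefore closed under differentiation; at t = 0 the exponential decay beats every
  polynomial in 1 / t.\<close>

lemma DERIV_flat: "(flat p has_real_derivative flat ([:0, 0, 1:] * (p - pderiv p)) t) (at t)"
proof -
  consider "t < 0" | "t > 0" | "t = 0" by linarith
  then show ?thesis
  proof cases
    case 1
    have "((\<lambda>_. 0) has_real_derivative 0) (at t)" by simp
    then have "(flat p has_real_derivative 0) (at t)"
      by (rule has_field_derivative_transform_within_open[where S="{..<0}"])
        (use 1 in \<open>auto simp: flat_def\<close>)
    then show ?thesis using 1 by (simp add: flat_def)
  next
    case 2
    have "((\<lambda>t. poly p (1 / t) * exp (- (1 / t))) has_real_derivative
        flat ([:0, 0, 1:] * (p - pderiv p)) t) (at t)"
      using 2
      by (auto intro!: derivative_eq_intros DERIV_chain2[OF poly_DERIV]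
          simp: flat_def field_simps power2_eq_square)
    then show ?thesis
      by (rule has_field_derivative_transform_within_open[where S="{0<..}"])
        (use 2 in \<open>auto simp: flat_def\<close>)
  next
    case 3
    have "((\<lambda>h. flat p h / h) \<longlongrightarrow> 0) (at_right 0)"
    proof -
      have "((\<lambda>h. (1 / h) ^ 1 * poly p (1 / h) * exp (- (1 / h))) \<longlongrightarrow> 0) (at_right (0::real))"
        by (rule filterlim_compose[OF tendsto_power_poly_exp_minus])
          (use filterlim_inverse_at_top_right in \<open>simp add: inverse_eq_divide\<close>)
      then show ?thesis
        by (rule Lim_transform_eventually)
          (auto simp: eventually_at_filter flat_def field_simps)
    qed
    moreover have "((\<lambda>h. flat p h / h) \<longlongrightarrow> 0) (at_left 0)"
      by (rule Lim_transform_eventually[OF tendsto_const])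
        (auto simp: eventually_at_filter flat_def)
    ultimately have "((\<lambda>h. flat p h / h) \<longlongrightarrow> 0) (at 0)"
      by (simp add: filterlim_at_split)
    then show ?thesis
      by (simp add: 3 DERIV_def flat_def)
  qed
qed

text \<open>An algebra of explicit functions that is closed under partial derivatives, hence consists
  of smooth functions.\<close>

inductive_set elementary :: "(real^'n \<Rightarrow> complex) set" where
  flat: "(\<lambda>y. of_real (flat p (c * ((y - b) \<bullet> (y - b)) + d))) \<in> elementary"
| powr: "e > 0 \<Longrightarrow> (\<lambda>y. of_real (((y - b) \<bullet> (y - b) + e) powr q)) \<in> elementary"
| coord: "(\<lambda>y. of_real ((y - b) $ i)) \<in> elementary"
| const: "(\<lambda>_. z) \<in> elementary"
| add: "f \<in> elementary \<Longrightarrow> g \<in> elementary \<Longrightarrow> (\<lambda>y. f y + g y) \<in> elementary"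
| mult: "f \<in> elementary \<Longrightarrow> g \<in> elementary \<Longrightarrow> (\<lambda>y. f y * g y) \<in> elementary"
| inverse: "f \<in> elementary \<Longrightarrow> (\<And>y. f y \<noteq> 0) \<Longrightarrow> (\<lambda>y. inverse (f y)) \<in> elementary"

lemma partial_deriv_eqI:
  assumes "(f has_derivative f') (at x)"
  shows "partial_deriv i f x = f' (axis i 1)"
  using frechet_derivative_at[OF assms] by (simp add: partial_deriv_def)

lemma has_derivative_radial:
  fixes b :: "real^'n"
  assumes "(G has_real_derivative D) (at ((y - b) \<bullet> (y - b)))"
  shows "((\<lambda>y. complex_of_real (G ((y - b) \<bullet> (y - b)))) has_derivative
    (\<lambda>v. of_real (D * (2 * ((y - b) \<bullet> v))))) (at y)"
proof -
  have "((\<lambda>y. (y - b) \<bullet> (y - b)) has_derivative (\<lambda>v. 2 * ((y - b) \<bullet> v))) (at y)"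
    by (auto intro!: derivative_eq_intros simp: inner_commute algebra_simps)
  then have "((\<lambda>y. G ((y - b) \<bullet> (y - b))) has_derivative (\<lambda>v. D * (2 * ((y - b) \<bullet> v)))) (at y)"
    using assms has_derivative_compose[of "\<lambda>y. (y - b) \<bullet> (y - b)" _ y UNIV G "(*) D"]
    by (simp add: has_field_derivative_def)
  then show ?thesis by (rule has_derivative_of_real)
qed

lemma partial_deriv_radial:
  fixes b :: "real^'n"
  assumes "(G has_real_derivative D) (at ((y - b) \<bullet> (y - b)))"
  shows "partial_deriv i (\<lambda>y. complex_of_real (G ((y - b) \<bullet> (y - b)))) y = of_real (2 * D * (y - b) $ i)"
  by (subst partial_deriv_eqI[OF has_derivative_radial[OF assms]])
    (simp add: inner_axis)

lemma DERIV_shift_powr: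
  assumes "e > 0" "t \<ge> 0"
  shows "((\<lambda>t. (t + e) powr q) has_real_derivative q * (t + e) powr (q - 1)) (at t)"
  using assms by (auto intro!: derivative_eq_intros simp: powr_diff field_simps)

text \<open>Differentiability and closure are proved together because the sum, product and inverse
  rules need the derivatives of the parts. A function of |y - b|^2 differentiates to another one
  times a coordinate of y - b, which is why the generators are radial in the squared distance and
  why \<open>coord\<close> is among them.\<close>

lemma elementary_deriv:
  fixes f :: "real^'n \<Rightarrow> complex"
  assumes "f \<in> elementary"
  shows "(\<forall>y. f differentiable at y) \<and> (\<forall>i. partial_deriv i f \<in> elementary)"
  using assms
proof induction
  case (flat p c b d)
  have D: "((\<lambda>t. flat p (c * t + d)) has_real_derivative
      c * flat ([:0, 0, 1:] * (p - pderiv p)) (c * t + d)) (at t)" for t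
    by (rule DERIV_chain2[OF DERIV_flat, THEN DERIV_cong]) (auto intro!: derivative_eq_intros)
  have "partial_deriv i (\<lambda>y. of_real (flat p (c * ((y - b) \<bullet> (y - b)) + d))) =
      (\<lambda>y. (of_real (2 * c) * of_real (flat ([:0, 0, 1:] * (p - pderiv p)) (c * ((y - b) \<bullet> (y - b)) + d)))
        * of_real ((y - b) $ i))" for i
    by (rule ext, subst partial_deriv_radial[where G="\<lambda>t. flat p (c * t + d)", OF D])
       (simp add: algebra_simps)
  moreover have "\<dots> i \<in> elementary" for i
    by (intro elementary.intros)
  moreover have "(\<lambda>y. complex_of_real (flat p (c * ((y - b) \<bullet> (y - b)) + d))) differentiable at y" for y
    by (rule differentiableI[OF has_derivative_radial[where G="\<lambda>t. flat p (c * t + d)", OF D]])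
  ultimately show ?case by (simp only: simp_thms)
next
  case (powr e b q)
  note D = DERIV_shift_powr[OF \<open>e > 0\<close> inner_ge_zero]
  have "partial_deriv i (\<lambda>y. of_real (((y - b) \<bullet> (y - b) + e) powr q)) =
      (\<lambda>y. (of_real (2 * q) * of_real (((y - b) \<bullet> (y - b) + e) powr (q - 1))) * of_real ((y - b) $ i))" for i
    by (rule ext, subst partial_deriv_radial[where G="\<lambda>t. (t + e) powr q", OF D])
       (simp add: algebra_simps)
  moreover have "\<dots> i \<in> elementary" for i
    by (intro elementary.intros \<open>e > 0\<close>)
  moreover have "(\<lambda>y. complex_of_real (((y - b) \<bullet> (y - b) + e) powr q)) differentiable at y" for y
    by (rule differentiableI[OF has_derivative_radial[where G="\<lambda>t. (t + e) powr q", OF D]])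
  ultimately show ?case by (simp only: simp_thms)
next
  case (coord b i)
  have D: "((\<lambda>y. complex_of_real ((y - b) $ i)) has_derivative (\<lambda>v. of_real (v $ i))) (at y)" for y
    by (rule has_derivative_of_real)
      (auto intro!: derivative_eq_intros bounded_linear.has_derivative[OF bounded_linear_vec_nth])
  have "partial_deriv j (\<lambda>y. complex_of_real ((y - b) $ i)) = (\<lambda>y. of_real (axis j 1 $ i))" for j
    by (rule ext, subst partial_deriv_eqI[OF D]) simp
  then show ?case using D by (auto simp: differentiable_def intro: elementary.const)
next
  case (const z)
  have "partial_deriv j (\<lambda>y. z) = (\<lambda>y. 0)" for j :: 'n
    by (rule ext, subst partial_deriv_eqI[OF has_derivative_const]) simp
  then show ?case by (auto intro: elementary.const)
next
  case (add f g)
  have D: "(f has_derivative frechet_derivative f (at y)) (at y)"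
    "(g has_derivative frechet_derivative g (at y)) (at y)" for y
    using add.IH frechet_derivative_works by blast+
  have "partial_deriv j (\<lambda>y. f y + g y) = (\<lambda>y. partial_deriv j f y + partial_deriv j g y)" for j
    by (rule ext, subst partial_deriv_eqI[OF has_derivative_add[OF D]])
      (simp add: partial_deriv_def)
  then show ?case using add.IH by (auto intro!: elementary.add)
next
  case (mult f g)
  have D: "(f has_derivative frechet_derivative f (at y)) (at y)"
    "(g has_derivative frechet_derivative g (at y)) (at y)" for y
    using mult.IH frechet_derivative_works by blast+
  have "partial_deriv j (\<lambda>y. f y * g y) = (\<lambda>y. f y * partial_deriv j g y + partial_deriv j f y * g y)" for j
    by (rule ext, subst partial_deriv_eqI[OF has_derivative_mult[OF D]])
      (simp add: partial_deriv_def)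
  then show ?case using mult by (auto intro!: elementary.add elementary.mult)
next
  case (inverse f)
  have D: "(f has_derivative frechet_derivative f (at y)) (at y)" for y
    using inverse.IH frechet_derivative_works by blast
  have "partial_deriv j (\<lambda>y. inverse (f y)) = (\<lambda>y. (-1) * ((inverse (f y) * partial_deriv j f y) * inverse (f y)))" for j
    by (rule ext, subst partial_deriv_eqI[OF Deriv.has_derivative_inverse[OF inverse.hyps(2) D]])
      (simp add: partial_deriv_def)
  moreover have "\<dots> j \<in> elementary" for j
    using inverse by (intro elementary.inverse elementary.mult elementary.const) auto
  moreover have "(\<lambda>y. inverse (f y)) differentiable at y" for y
    by (rule differentiableI[OF Deriv.has_derivative_inverse[OF inverse.hyps(2) D]])
  ultimately show ?case by (simp only: simp_thms)
qed

lemma elementary_partial_derivs: "f \<in> elementary \<Longrightarrow> partial_derivs is f \<in> elementary"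
  by (induction "is") (auto simp: partial_derivs_def elementary_deriv)

lemma smooth_elementary: "f \<in> elementary \<Longrightarrow> smooth f"
  using elementary_partial_derivs elementary_deriv
  by (auto simp: smooth_def differentiable_on_def intro: differentiable_at_withinI)

lemma continuous_elementary: "f \<in> elementary \<Longrightarrow> continuous_on S f"
  using elementary_deriv 
  by (metis continuous_at_imp_continuous_on differentiable_imp_continuous_within)

section \<open>Smooth cut-off functions, with \<open>R\<close> in the role of a squared
  radius\<close>

definition cutoff :: "real^'n \<Rightarrow> real \<Rightarrow> real^'n \<Rightarrow> real" where
  "cutoff b R y = flat 1 (2 * R - (y - b) \<bullet> (y - b)) /
     (flat 1 (2 * R - (y - b) \<bullet> (y - b)) + flat 1 ((y - b) \<bullet> (y - b) - R))"

lemma flat_one: "flat 1 t \<ge> 0" "t > 0 \<Longrightarrow> flat 1 t > 0" "t \<le> 0 \<Longrightarrow> flat 1 t = 0"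
  by (auto simp: flat_def)

text \<open>Always s < 2 R or s > R, so the two bumps never vanish together. The quotient in
  \<open>cutoff\<close> can thus be formed with the constructor \<open>inverse\<close>, which
  demands a nowhere vanishing function.\<close>

lemma cutoff_denom: "R > 0 \<Longrightarrow> flat 1 (2 * R - s) + flat 1 (s - R) > 0"
  by (cases "s < 2 * R") (simp_all add: add_pos_nonneg add_nonneg_pos flat_one)

lemma cutoff_elementary:
  assumes "R > 0"
  shows "(\<lambda>y. complex_of_real (cutoff b R y)) \<in> elementary"
proof -
  have 1: "(\<lambda>y. complex_of_real (flat 1 (2 * R - (y - b) \<bullet> (y - b)))) \<in> elementary"
    using elementary.flat[of 1 "-1" b "2 * R"] by simp
  have 2: "(\<lambda>y. complex_of_real (flat 1 ((y - b) \<bullet> (y - b) - R))) \<in> elementary"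
    using elementary.flat[of 1 1 b "-R"] by simp
  have "(\<lambda>y. complex_of_real (flat 1 (2 * R - (y - b) \<bullet> (y - b))) *
     inverse (complex_of_real (flat 1 (2 * R - (y - b) \<bullet> (y - b))) 
        + complex_of_real (flat 1 ((y - b) \<bullet> (y - b) - R)))) \<in> elementary"
    by (intro elementary.mult elementary.inverse elementary.add 1 2)
      (metis cutoff_denom[OF assms] less_irrefl of_real_add of_real_eq_0_iff)
  then show ?thesis by (simp add: cutoff_def divide_inverse)
qed

lemma cutoff_eq_1: "R > 0 \<Longrightarrow> (y - b) \<bullet> (y - b) \<le> R \<Longrightarrow> cutoff b R y = 1"
  using cutoff_denom[of R "(y - b) \<bullet> (y - b)"] flat_one(2)[of "2 * R - (y - b) \<bullet> (y - b)"]
  by (simp add: cutoff_def flat_one(3))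

lemma cutoff_eq_0: "(y - b) \<bullet> (y - b) \<ge> 2 * R \<Longrightarrow> cutoff b R y = 0"
  by (simp add: cutoff_def flat_one)

lemma cutoff_bounds: "0 \<le> cutoff b R y" "cutoff b R y \<le> 1"
proof -
  have "a / (a + b) \<le> 1" if "a \<ge> 0" "b \<ge> 0" for a b :: real
  proof (cases "a + b = 0")
    case False
    then have "a + b > 0" using that by linarith
    then show ?thesis using that by simp
  qed simp
  then show "cutoff b R y \<le> 1" by (simp add: cutoff_def flat_one)
  show "0 \<le> cutoff b R y" by (auto simp: cutoff_def flat_one intro!: divide_nonneg_nonneg add_nonneg_nonneg)
qed

lemma test_function_cutoff_mult:
  assumes "R > 0" "f \<in> elementary"
  shows "test_function (\<lambda>y. complex_of_real (cutoff b R y) * f y)"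
proof -
  have "{x. complex_of_real (cutoff b R x) * f x \<noteq> 0} \<subseteq> cball b (sqrt (2 * R))"
  proof
    fix y assume "y \<in> {x. complex_of_real (cutoff b R x) * f x \<noteq> 0}"
    then have "(y - b) \<bullet> (y - b) < 2 * R" using cutoff_eq_0[of R y b] by force
    then have "norm (y - b) \<le> sqrt (2 * R)"
      by (simp add: norm_eq_sqrt_inner)
    then show "y \<in> cball b (sqrt (2 * R))" by (simp add: dist_norm norm_minus_commute)
  qed
  then have "bounded {x. complex_of_real (cutoff b R x) * f x \<noteq> 0}"
    using bounded_cball bounded_subset by blast
  then show ?thesis
    using smooth_elementary[OF elementary.mult[OF cutoff_elementary assms(2)]] assms(1)
    by (simp add: test_function_def)
qed

text \<open>Differentiability is not assumed: both functions have the same derivatives at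
  \<open>x\<close>, if any, so the choice operator behind \<open>frechet_derivative\<close> returns
  the same value for both.\<close>

lemma partial_deriv_cong_open:
  assumes "open U" "x \<in> U" "\<And>y. y \<in> U \<Longrightarrow> f y = g y"
  shows "partial_deriv i f x = partial_deriv i g x"
proof -
  have "(f has_derivative f') (at x) \<longleftrightarrow> (g has_derivative f') (at x)" for f'
    using assms has_derivative_transform_within_open[of f f' x UNIV U g]
      has_derivative_transform_within_open[of g f' x UNIV U f] by auto
  then show ?thesis by (simp add: partial_deriv_def frechet_derivative_def)
qed

lemma partial_derivs_cong_open:
  assumes "open U" "x \<in> U" "\<And>y. y \<in> U \<Longrightarrow> f y = g y"
  shows "partial_derivs is f x = partial_derivs is g x"
  using assms(2)
proof (induction "is" arbitrary: x)
  case Nil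
  then show ?case using assms(3) by (simp add: partial_derivs_def)
next
  case (Cons i "is")
  then show ?case using partial_deriv_cong_open[OF assms(1) Cons.prems, of "partial_derivs is f" "partial_derivs is g" i]
    by (simp add: partial_derivs_def)
qed

section \<open>The regularised Newtonian kernel and its Laplacian\<close>

definition mollified_newton :: "real \<Rightarrow> real^'n \<Rightarrow> real^'n \<Rightarrow> real" where
  "mollified_newton e x y = ((y - x) \<bullet> (y - x) + e) powr (1 - CARD('n) / 2)"

text \<open>Minus the Laplacian of \<open>mollified_newton e x\<close> in the second variable, see
  \<open>laplacian_mollified_newton\<close>. The parameter \<open>e\<close> is a squared length; at
  e = epsilon^2 this is a dilate of one fixed profile.\<close>

definition newton_mollifier :: "real \<Rightarrow> real^'n \<Rightarrow> real^'n \<Rightarrow> real" where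
  "newton_mollifier e x y =
     real CARD('n) * (real CARD('n) - 2) * e * ((y - x) \<bullet> (y - x) + e) powr (- 1 - CARD('n) / 2)"

lemma elementary_mollified_newton:
  "e > 0 \<Longrightarrow> (\<lambda>y. complex_of_real (mollified_newton e x y)) \<in> elementary"
  unfolding mollified_newton_def by (rule elementary.powr)

lemma elementary_newton_mollifier:
  assumes "e > 0" shows "(\<lambda>y. complex_of_real (newton_mollifier e x y)) \<in> elementary"
  unfolding newton_mollifier_def of_real_mult
  by (intro elementary.mult elementary.const elementary.powr assms)

text \<open>For s = |y - x|^2 the Laplacian of (s + e)^q is 2 q (s + e)^(q - 2) ((2 (q - 1) + n) s +
  n e). The exponent q = 1 - n / 2 is the one that cancels the term in s, leaving a single sign and
  the fast decay |y - x|^(-n - 2).\<close>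

lemma laplacian_mollified_newton:
  fixes x :: "real^'n"
  assumes e: "e > 0"
  shows "(\<Sum>i\<in>UNIV. partial_derivs [i, i] (\<lambda>y. complex_of_real (mollified_newton e x y)) y)
    = - of_real (newton_mollifier e x y)"
proof -
  define q where "q = 1 - real CARD('n) / 2"
  define s where "s = (y - x) \<bullet> (y - x)"
  have s: "s \<ge> 0" by (simp add: s_def)
  have 1: "partial_deriv i (\<lambda>y. complex_of_real (mollified_newton e x y))
      = (\<lambda>y. of_real (2 * q * (((y - x) \<bullet> (y - x) + e) powr (q - 1))) * of_real ((y - x) $ i))" for i
    unfolding mollified_newton_def q_def[symmetric]
    by (rule ext, subst partial_deriv_radial[where G="\<lambda>t. (t + e) powr q", OF DERIV_shift_powr[OF e inner_ge_zero]])
       (simp add: algebra_simps)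
  have D1: "((\<lambda>y. complex_of_real (2 * q * (((y - x) \<bullet> (y - x) + e) powr (q - 1)))) has_derivative
    (\<lambda>v. of_real ((2 * q * ((q - 1) * (s + e) powr (q - 1 - 1))) * (2 * ((y - x) \<bullet> v))))) (at y)"
    unfolding s_def
    by (rule has_derivative_radial[where G="\<lambda>t. 2 * q * (t + e) powr (q - 1)"])
      (rule DERIV_cmult DERIV_shift_powr e inner_ge_zero)+
  have D2: "((\<lambda>y. complex_of_real ((y - x) $ i)) has_derivative (\<lambda>v. of_real (v $ i))) (at y)" for i
    by (rule has_derivative_of_real)
      (auto intro!: derivative_eq_intros bounded_linear.has_derivative[OF bounded_linear_vec_nth])
  have "partial_derivs [i, i] (\<lambda>y. complex_of_real (mollified_newton e x y)) y
     = of_real (4 * q * (q - 1) * (s + e) powr (q - 2) * ((y - x) $ i * (y - x) $ i)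
        + 2 * q * (s + e) powr (q - 1))" for i
  proof -
    have [simp]: "(y - x) \<bullet> axis i 1 = (y - x) $ i" by (simp add: inner_axis)
    show ?thesis
    unfolding partial_derivs_def foldr.simps o_def id_def 1
    by (subst partial_deriv_eqI[OF has_derivative_mult[OF D1 D2]])
      (simp add: s_def[symmetric] distrib_left distrib_right left_diff_distrib right_diff_distrib
        mult.commute mult.left_commute del: vector_minus_component)
  qed
  then have "(\<Sum>i\<in>UNIV. partial_derivs [i, i] (\<lambda>y. complex_of_real (mollified_newton e x y)) y)
     = of_real (\<Sum>i\<in>UNIV. 4 * q * (q - 1) * (s + e) powr (q - 2) * ((y - x) $ i * (y - x) $ i)
        + 2 * q * (s + e) powr (q - 1))" by simp
  also have "(\<Sum>i\<in>UNIV. 4 * q * (q - 1) * (s + e) powr (q - 2) * ((y - x) $ i * (y - x) $ i)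
        + 2 * q * (s + e) powr (q - 1))
      = 4 * q * (q - 1) * (s + e) powr (q - 2) * s + real CARD('n) * (2 * q * (s + e) powr (q - 1))"
    by (simp add: sum.distrib sum_distrib_left[symmetric] s_def inner_vec_def)
  also have "(s + e) powr (q - 1) = (s + e) powr (q - 2) * (s + e)"
    using powr_add[of "s + e" "q - 2" 1] s e by simp
  also have "4 * q * (q - 1) * (s + e) powr (q - 2) * s
        + real CARD('n) * (2 * q * ((s + e) powr (q - 2) * (s + e)))
      = 2 * q * (s + e) powr (q - 2) * ((2 * (q - 1) + CARD('n)) * s + CARD('n) * e)"
    by (simp add: algebra_simps)
  also have "2 * (q - 1) + CARD('n) = 0" by (simp add: q_def)
  also have "q - 2 = - 1 - CARD('n) / 2" by (simp add: q_def)
  finally have "(\<Sum>i\<in>UNIV. partial_derivs [i, i] (\<lambda>y. complex_of_real (mollified_newton e x y)) y)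
    = of_real (2 * q * (s + e) powr (- 1 - real CARD('n) / 2) * (0 * s + real CARD('n) * e))" .
  also have "2 * q * (s + e) powr (- 1 - real CARD('n) / 2) * (0 * s + real CARD('n) * e) = - newton_mollifier e x y"
    unfolding newton_mollifier_def s_def[symmetric] by (simp add: q_def algebra_simps)
  finally show ?thesis by simp
qed

subsection \<open>Carleson embedding on the dyadic tree\<close>

text \<open>The children of the cube with index \<open>m\<close> at level \<open>k\<close> are the
  cubes \<open>2 * m + d\<close> at level \<open>k - 1\<close>, with \<open>d\<close> in this
  set.\<close>

definition offsets :: "(int^'n) set" where
  "offsets = {d. \<forall>i. d $ i \<in> {0, 1}}"

lemma finite_vec_range:
  assumes "finite S"
  shows "finite {d :: 'a^'n. \<forall>i. d $ i \<in> S}"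
proof (rule finite_subset)
  show "{d :: 'a^'n. \<forall>i. d $ i \<in> S} \<subseteq> vec_lambda ` (PiE UNIV (\<lambda>_. S))"
    by (auto simp: image_def intro!: bexI[where x="vec_nth _"])
  show "finite (vec_lambda ` (PiE UNIV (\<lambda>_. S)) :: ('a^'n) set)"
    using assms by (intro finite_imageI finite_PiE) auto
qed

lemma finite_offsets [simp]: "finite (offsets :: (int^'n) set)"
  unfolding offsets_def by (rule finite_vec_range) simp

lemma countable_int_vec [simp]: "countable (A :: (int^'n) set)"
proof -
  have "countable (vec_lambda ` (PiE UNIV (\<lambda>_. UNIV)) :: (int^'n) set)"
    by (intro countable_image countable_PiE) auto
  moreover have "(vec_lambda ` (PiE UNIV (\<lambda>_. UNIV)) :: (int^'n) set) = UNIV"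
    by (auto simp: image_def PiE_UNIV_domain intro: exI[where x="vec_nth _"])
  ultimately show ?thesis using countable_subset by auto
qed

text \<open>Cauchy-Schwarz in Engel form. Since \<open>x / 0 = 0\<close>, an index with
  \<open>b i = 0\<close> drops out of the quotient sum, and the second assumption removes it from
  the left-hand side too.\<close>

lemma sum_power2_div_ge:
  fixes a b :: "'i \<Rightarrow> real"
  assumes "\<And>i. i \<in> I \<Longrightarrow> b i \<ge> 0" "\<And>i. i \<in> I \<Longrightarrow> b i = 0 \<Longrightarrow> a i = 0"
  shows "(\<Sum>i\<in>I. a i)\<^sup>2 \<le> (\<Sum>i\<in>I. (a i)\<^sup>2 / b i) * (\<Sum>i\<in>I. b i)"
proof -
  have "(\<Sum>i\<in>I. (a i / sqrt (b i)) * sqrt (b i))\<^sup>2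
      \<le> (\<Sum>i\<in>I. (a i / sqrt (b i))\<^sup>2) * (\<Sum>i\<in>I. (sqrt (b i))\<^sup>2)"
    by (rule Cauchy_Schwarz_ineq_sum)
  moreover have "(\<Sum>i\<in>I. (a i / sqrt (b i)) * sqrt (b i)) = (\<Sum>i\<in>I. a i)"
    by (rule sum.cong) (use assms in auto)
  moreover have "(\<Sum>i\<in>I. (a i / sqrt (b i))\<^sup>2) = (\<Sum>i\<in>I. (a i)\<^sup>2 / b i)"
    by (rule sum.cong) (use assms in \<open>auto simp: power_divide\<close>)
  moreover have "(\<Sum>i\<in>I. (sqrt (b i))\<^sup>2) = (\<Sum>i\<in>I. b i)"
    by (rule sum.cong) (use assms in auto)
  ultimately show ?thesis by simp
qed

text \<open>Runs over \<open>N\<close> generations, the first being the cube itself. The truncation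
  allows induction and keeps the values real; the bounds proved later are uniform in
  \<open>N\<close>.\<close>

primrec tree_sum :: "(int \<Rightarrow> real) \<Rightarrow> (int \<Rightarrow> int^'n \<Rightarrow> real) \<Rightarrow> nat \<Rightarrow> int \<Rightarrow> int^'n \<Rightarrow> real" where
  "tree_sum w X 0 k m = 0"
| "tree_sum w X (Suc N) k m =
     w k * (X k m)\<^sup>2 + (\<Sum>d\<in>offsets. tree_sum w X N (k - 1) (2 * m + d))"

definition tree_additive :: "(int \<Rightarrow> int^'n \<Rightarrow> real) \<Rightarrow> bool" where
  "tree_additive X \<longleftrightarrow> (\<forall>k m. X k m \<ge> 0 \<and> X k m = (\<Sum>d\<in>offsets. X (k - 1) (2 * m + d)))"

lemma tree_additiveD:
  assumes "tree_additive X"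
  shows "X k m \<ge> 0" "X k m = (\<Sum>d\<in>offsets. X (k - 1) (2 * m + d))"
  using assms unfolding tree_additive_def by blast+

lemma tree_sum_nonneg: "(\<And>k. w k \<ge> 0) \<Longrightarrow> tree_sum w X N k m \<ge> 0"
  by (induction N arbitrary: k m) (auto intro!: add_nonneg_nonneg sum_nonneg)

text \<open>The induction invariant is the Bellman function \<open>F - X^2 / (M + S / A)\<close>, which is superadditive along the
  tree by the Cauchy-Schwarz inequality and gains \<open>w X^2 / (4 A)\<close> at each cube because \<open>S \<le> A M\<close>.\<close>

lemma carleson_embedding:
  assumes w: "\<And>k. w k \<ge> 0" and X: "tree_additive X" and M: "tree_additive M" and F: "tree_additive F"
    and XMF: "\<And>k m. (X k m)\<^sup>2 \<le> M k m * F k m"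
    and A: "A > 0" and S: "\<And>N k m. tree_sum w M N k m \<le> A * M k m"
  shows "tree_sum w X N k m \<le> 4 * A * F k m"
proof -
  have M0: "M k m \<ge> 0" and F0: "F k m \<ge> 0" for k m
    by (intro tree_additiveD M F)+
  have S0: "tree_sum w M N k m \<ge> 0" for N k m by (rule tree_sum_nonneg[OF w])
  have "tree_sum w X N k m / (4 * A) + (X k m)\<^sup>2 / (M k m + tree_sum w M N k m / A) \<le> F k m"
    for N k m
  proof (induction N arbitrary: k m)
    case 0
    show ?case using XMF[of k m] M0[of k m] F0[of k m]
      by (cases "M k m = 0") (auto simp: field_simps)
  next
    case (Suc N)
    define c where "c d = 2 * m + d" for d
    define b where "b d = M (k - 1) (c d) + tree_sum w M N (k - 1) (c d) / A" for d
    define Y where "Y = (\<Sum>d\<in>offsets. b d)"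
    have b0: "b d \<ge> 0" for d using M0 S0 A by (simp add: b_def)
    have sumX: "X k m = (\<Sum>d\<in>offsets. X (k - 1) (c d))"
      and sumM: "M k m = (\<Sum>d\<in>offsets. M (k - 1) (c d))"
      and sumF: "F k m = (\<Sum>d\<in>offsets. F (k - 1) (c d))"
      unfolding c_def by (intro tree_additiveD X M F)+
    have engel: "(X k m)\<^sup>2 \<le> (\<Sum>d\<in>offsets. (X (k - 1) (c d))\<^sup>2 / b d) * Y"
      unfolding Y_def sumX
    proof (rule sum_power2_div_ge)
      fix d assume "b d = 0"
      moreover have "tree_sum w M N (k - 1) (c d) / A \<ge> 0" using S0 A by simp
      ultimately have "M (k - 1) (c d) = 0"
        using M0[of "k - 1" "c d"] unfolding b_def by linarith
      then show "X (k - 1) (c d) = 0" using XMF[of "k - 1" "c d"] by simp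
    qed (rule b0)
    have Yeq: "M k m + tree_sum w M (Suc N) k m / A = Y + w k * (M k m)\<^sup>2 / A"
      by (simp add: Y_def b_def sum.distrib sumM[symmetric] c_def[symmetric] add_divide_distrib sum_divide_distrib)
    \<comment> \<open>Assumption \<open>S\<close> says that the tree sum divided by \<open>A\<close>
      is at most M, so the denominators of the invariant stay between M and 2 M. The 4 in the
      conclusion is the square of this 2.\<close>
    have up: "Y + w k * (M k m)\<^sup>2 / A \<le> 2 * M k m"
      unfolding Yeq[symmetric] using S[of "Suc N" k m] A by (simp add: field_simps)
    have key: "w k * (X k m)\<^sup>2 / (4 * A) + (X k m)\<^sup>2 / (M k m + tree_sum w M (Suc N) k m / A)
        \<le> (\<Sum>d\<in>offsets. (X (k - 1) (c d))\<^sup>2 / b d)" (is "_ \<le> ?E")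
    proof (cases "X k m = 0")
      case True
      then show ?thesis using b0 by (simp add: sum_nonneg)
    next
      case False
      have "X k m ^ 2 > 0" using False by simp
      then have Mp: "M k m > 0" 
        using XMF[of k m] M0[of k m] by (cases "M k m = 0") auto
      have "Y \<ge> M k m"
        unfolding Y_def b_def sumM using S0 A by (intro sum_mono) simp
      then have Yp: "Y > 0" using Mp by simp
      define a where "a = w k * (M k m)\<^sup>2 / A"
      have a0: "a \<ge> 0" using w A by (simp add: a_def)
      \<comment> \<open>Adding the cube's own term \<open>a\<close> to the denominator lowers the
        quotient by a / (Y (Y + a)) times X^2; this drop pays for w X^2 / (4 A).\<close>
      have "w k / (4 * A) = a / (2 * M k m * (2 * M k m))"
        using Mp A by (simp add: a_def field_simps power2_eq_square)
      also have "\<dots> \<le> a / (Y * (Y + a))"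
        using up a0 Yp Mp by (intro divide_left_mono mult_mono) (auto simp: a_def[symmetric])
      also have "\<dots> = 1 / Y - 1 / (Y + a)"
        using Yp a0 by (simp add: field_simps)
      finally have "(X k m)\<^sup>2 * (w k / (4 * A)) \<le> (X k m)\<^sup>2 * (1 / Y - 1 / (Y + a))"
        by (intro mult_left_mono) auto
      moreover have "(X k m)\<^sup>2 * (1 / Y) \<le> ?E"
        using engel Yp by (simp add: field_simps)
      ultimately show ?thesis
        unfolding Yeq a_def[symmetric] by (simp add: algebra_simps)
    qed
    have "(\<Sum>d\<in>offsets. tree_sum w X N (k - 1) (c d) / (4 * A)) + ?E \<le> F k m"
      unfolding sumF sum.distrib[symmetric] using Suc.IH by (intro sum_mono) (simp add: b_def)
    then show ?case using key
      by (simp add: c_def[symmetric] add_divide_distrib sum_divide_distrib)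
  qed
  moreover have "(X k m)\<^sup>2 / (M k m + tree_sum w M N k m / A) \<ge> 0"
    using M0 S0 A by simp
  ultimately have "tree_sum w X N k m / (4 * A) \<le> F k m" 
    by (smt (verit, best))
  then show ?thesis using A by (simp add: field_simps)
qed

text \<open>Abstract passage from energies to Carleson sums. \<open>J\<close> models a double
  integral over a cube, and \<open>step\<close> says that pairs in different children contribute at
  least the weight of the parent times the product of their masses. The 2 bounds the geometric
  series of weights over the ancestors, since \<open>w\<close> at least doubles from each level to
  the next finer one.\<close>

lemma tree_sum_le_energy:
  assumes w: "\<And>k. 2 * w k \<le> w (k - 1)"
    and w0: "\<And>k. w k \<ge> 0"
    and low: "\<And>k m. w k * (M k m)\<^sup>2 \<le> J k m"
    and step: "\<And>k m. (\<Sum>d\<in>offsets. J (k - 1) (2 * m + d)) + 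
       w k * ((M k m)\<^sup>2 - (\<Sum>d\<in>offsets. (M (k - 1) (2 * m + d))\<^sup>2)) \<le> J k m"
  shows "tree_sum w M N k m \<le> 2 * J k m"
proof -
  \<comment> \<open>The extra term \<open>w M^2\<close> absorbs the diagonal at the next level, as \<open>2 w\<close> is at most the weight there.\<close>
  have "tree_sum w M N k m + w k * (M k m)\<^sup>2 \<le> 2 * J k m" for N k m
  proof (induction N arbitrary: k m)
    case 0
    have "0 \<le> w k * (M k m)\<^sup>2" by (simp add: w0)
    then show ?case using low[of k m] by simp
  next
    case (Suc N)
    let ?c = "\<lambda>d. 2 * m + d"
    have "2 * w k * (M (k - 1) (?c d))\<^sup>2 + tree_sum w M N (k - 1) (?c d) \<le> 2 * J (k - 1) (?c d)" for d
      using Suc.IH[of "k - 1" "?c d"] mult_right_mono[OF w[of k] zero_le_power2[of "M (k - 1) (?c d)"]]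
      by linarith
    then have "(\<Sum>d\<in>offsets. 2 * w k * (M (k - 1) (?c d))\<^sup>2 + tree_sum w M N (k - 1) (?c d))
        \<le> (\<Sum>d\<in>offsets. 2 * J (k - 1) (?c d))"
      by (rule sum_mono)
    then have "2 * w k * (\<Sum>d\<in>offsets. (M (k - 1) (?c d))\<^sup>2) + (\<Sum>d\<in>offsets. tree_sum w M N (k - 1) (?c d))
        \<le> 2 * (\<Sum>d\<in>offsets. J (k - 1) (?c d))"
      by (simp add: sum.distrib sum_distrib_left)
    then show ?case using step[where k=k and m=m] by (simp add: algebra_simps)
  qed
  then show ?thesis using mult_nonneg_nonneg[OF w0[of k] zero_le_power2[of "M k m"]]
    by (smt (verit, best))
qed

section \<open>From single trees to the sum over all dyadic cubes\<close>

lemma nn_integral_offsets: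
  fixes f :: "int^'n \<Rightarrow> ennreal"
  shows "(\<integral>\<^sup>+m. (\<Sum>d\<in>offsets. f (2 * m + d)) \<partial>count_space UNIV) = (\<integral>\<^sup>+m. f m \<partial>count_space UNIV)"
proof -
  have inj: "inj (\<lambda>m :: int^'n. 2 * m + d)" for d
    by (rule injI) (simp add: vec_eq_iff)
  have "(\<integral>\<^sup>+m. (\<Sum>d\<in>offsets. f (2 * m + d)) \<partial>count_space UNIV)
      = (\<Sum>d\<in>offsets. \<integral>\<^sup>+m. f (2 * m + d) \<partial>count_space UNIV)"
    by (rule nn_integral_sum) simp
  also have "\<dots> = (\<Sum>d\<in>offsets. \<integral>\<^sup>+m. f m * indicator (range (\<lambda>m. 2 * m + d)) m \<partial>count_space UNIV)"
    by (intro sum.cong refl, subst nn_integral_bij_count_space[OF inj_on_imp_bij_betw[OF inj]])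
       (simp add: nn_integral_count_space_indicator)
  also have "\<dots> = (\<integral>\<^sup>+m. (\<Sum>d\<in>offsets. f m * indicator (range (\<lambda>m. 2 * m + d)) m) \<partial>count_space UNIV)"
    by (rule nn_integral_sum[symmetric]) simp
  also have "\<dots> = (\<integral>\<^sup>+m. f m \<partial>count_space UNIV)"
  proof (intro nn_integral_cong)
    fix m :: "int^'n"
    \<comment> \<open>An index has the form 2 m' + d for exactly one offset d, its coordinatewise
      parity.\<close>
    have "(\<Sum>d\<in>offsets. indicator (range (\<lambda>m. 2 * m + d)) m)
        = (\<Sum>d\<in>{\<chi> i. m $ i mod 2}. 1 :: ennreal)"
    proof (rule sum.mono_neutral_cong_right)
      show "{\<chi> i. m $ i mod 2} \<subseteq> offsets"
        by (auto simp: offsets_def)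
      show "\<forall>d\<in>offsets - {\<chi> i. m $ i mod 2}. indicator (range (\<lambda>m. 2 * m + d)) m = (0 :: ennreal)"
      proof
        fix d assume d: "d \<in> offsets - {\<chi> i. m $ i mod 2}"
        have "m \<noteq> 2 * m' + d" for m'
        proof
          assume m: "m = 2 * m' + d"
          have "d $ i = m $ i mod 2" for i
            using d by (auto simp: m offsets_def  dest!: spec[of _ i])
          then show False using d by (simp add: vec_eq_iff)
        qed
        then show "indicator (range (\<lambda>m. 2 * m + d)) m = (0 :: ennreal)" by (auto simp: indicator_def)
      qed
      fix d assume "d \<in> {\<chi> i. m $ i mod 2}"
      then have "m = (\<lambda>m. 2 * m + d) (\<chi> i. m $ i div 2)"
        by (simp add: vec_eq_iff )
      then show "indicator (range (\<lambda>m. 2 * m + d)) m = (1 :: ennreal)"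
        by (metis indicator_simps(1) rangeI)
    qed simp
    then show "(\<Sum>d\<in>offsets. f m * indicator (range (\<lambda>m. 2 * m + d)) m) = f m"
      by (simp add: sum_distrib_left[symmetric])
  qed
  finally show ?thesis .
qed

text \<open>The trees rooted at the cubes of level \<open>k\<close> contain each cube of the levels
  k, ..., k - N + 1 exactly once.\<close>

lemma nn_integral_tree_sum:
  fixes X :: "int \<Rightarrow> int^'n \<Rightarrow> real"
  assumes w: "\<And>k. w k \<ge> 0"
  shows "(\<integral>\<^sup>+m. ennreal (tree_sum w X N k m) \<partial>count_space UNIV)
    = (\<Sum>j<N. \<integral>\<^sup>+m. ennreal (w (k - int j) * (X (k - int j) m)\<^sup>2) \<partial>count_space UNIV)"
proof (induction N arbitrary: k)
  case 0
  then show ?case by simp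
next
  case (Suc N)
  have "(\<integral>\<^sup>+m. ennreal (tree_sum w X (Suc N) k m) \<partial>count_space UNIV)
    = (\<integral>\<^sup>+m. ennreal (w k * (X k m)\<^sup>2) + (\<Sum>d\<in>offsets. ennreal (tree_sum w X N (k - 1) (2 * m + d))) \<partial>count_space UNIV)"
    by (intro nn_integral_cong) (simp add: sum_ennreal tree_sum_nonneg w sum_nonneg ennreal_plus)
  also have "\<dots> = (\<integral>\<^sup>+m. ennreal (w k * (X k m)\<^sup>2) \<partial>count_space UNIV) +
     (\<integral>\<^sup>+m. (\<Sum>d\<in>offsets. ennreal (tree_sum w X N (k - 1) (2 * m + d))) \<partial>count_space UNIV)"
    by (rule nn_integral_add) auto
  also have "(\<integral>\<^sup>+m. (\<Sum>d\<in>offsets. ennreal (tree_sum w X N (k - 1) (2 * m + d))) \<partial>count_space UNIV)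
     = (\<Sum>j<N. \<integral>\<^sup>+m. ennreal (w (k - 1 - int j) * (X (k - 1 - int j) m)\<^sup>2) \<partial>count_space UNIV)"
    unfolding nn_integral_offsets[where f="\<lambda>m. ennreal (tree_sum w X N (k - 1) m)"] by (rule Suc.IH)
  finally show ?case
    by (subst sum.lessThan_Suc_shift) (simp add: diff_diff_eq)
qed

text \<open>Trees of depth 2 N + 1 rooted at level N fill exactly the levels from -N to N, and N is
  sent to infinity. The bound survives because the total of \<open>F\<close> is controlled by the
  same \<open>G\<close> on every level.\<close>

lemma tree_energy_le:
  fixes X F :: "int \<Rightarrow> int^'n \<Rightarrow> real"
  assumes w: "\<And>k. w k \<ge> 0" and B: "B \<ge> 0"
    and T: "\<And>N k m. tree_sum w X N k m \<le> B * F k m"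
    and F: "\<And>k. (\<integral>\<^sup>+m. ennreal (F k m) \<partial>count_space UNIV) \<le> G"
  shows "(\<integral>\<^sup>+k. \<integral>\<^sup>+m. ennreal (w k * (X k m)\<^sup>2) \<partial>count_space UNIV \<partial>count_space UNIV) \<le> ennreal B * G"
proof -
  define D where "D k = (\<integral>\<^sup>+m. ennreal (w k * (X k m)\<^sup>2) \<partial>count_space UNIV)" for k
  have fin: "(\<Sum>k\<in>{- int N..int N}. D k) \<le> ennreal B * G" for N
  proof -
    have "(\<Sum>k\<in>{- int N..int N}. D k) = (\<Sum>j<2 * N + 1. D (int N - int j))"
      by (rule sum.reindex_bij_witness[where i="\<lambda>j. int N - int j" and j="\<lambda>k. nat (int N - k)"]) auto
    also have "\<dots> = (\<integral>\<^sup>+m. ennreal (tree_sum w X (2 * N + 1) (int N) m) \<partial>count_space UNIV)"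
      unfolding nn_integral_tree_sum[OF w] D_def by simp
    also have "\<dots> \<le> (\<integral>\<^sup>+m. ennreal B * ennreal (F (int N) m) \<partial>count_space UNIV)"
      using B by (intro nn_integral_mono) (simp only: ennreal_mult'[symmetric] ennreal_leI T)
    also have "\<dots> \<le> ennreal B * G"
      by (subst nn_integral_cmult) (auto intro!: mult_left_mono F)
    finally show ?thesis .
  qed
  have "(\<integral>\<^sup>+k. D k \<partial>count_space UNIV) = (\<integral>\<^sup>+k. (SUP N. D k * indicator {- int N..int N} k) \<partial>count_space UNIV)"
  proof (intro nn_integral_cong antisym)
    fix k
    have "D k = D k * indicator {- int (nat \<bar>k\<bar>)..int (nat \<bar>k\<bar>)} k"
    proof -
      have "k \<in> {- int (nat \<bar>k\<bar>)..int (nat \<bar>k\<bar>)}" by auto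
      then show ?thesis by (simp del: atLeastAtMost_iff)
    qed
    also have "\<dots> \<le> (SUP N. D k * indicator {- int N..int N} k)" by (rule SUP_upper) simp
    finally show "D k \<le> (SUP N. D k * indicator {- int N..int N} k)" .
    show "(SUP N. D k * indicator {- int N..int N} k) \<le> D k"
      by (rule SUP_least) (simp split: split_indicator)
  qed
  also have "\<dots> = (SUP N. \<integral>\<^sup>+k. D k * indicator {- int N..int N} k \<partial>count_space UNIV)"
    by (rule nn_integral_monotone_convergence_SUP)
      (auto simp: incseq_def le_fun_def split: split_indicator)
  also have "\<dots> \<le> ennreal B * G"
    by (rule SUP_least) (simp add: nn_integral_count_space_indicator[symmetric] nn_integral_count_space_finite fin)
  finally show ?thesis by (simp add: D_def)
qed

subsection \<open>Dyadic cubes and the testing condition\<close>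

text \<open>Half-open cubes of one level partition the space. Describing membership by an equation
  for the index turns nesting of cubes into integer division by 2.\<close>

definition cube_index :: "int \<Rightarrow> real^'n \<Rightarrow> int^'n" where
  "cube_index k x = (\<chi> i. \<lfloor>x $ i / 2 powi k\<rfloor>)"

lemma dyadic_cube_conv_index: "x \<in> dyadic_cube k m \<longleftrightarrow> cube_index k x = m"
proof -
  have "2 powi k * real_of_int a \<le> t \<and> t < 2 powi k * (real_of_int a + 1) \<longleftrightarrow> \<lfloor>t / 2 powi k\<rfloor> = a" for a t
    by (simp add: floor_eq_iff field_simps)
  then show ?thesis
    by (auto simp: dyadic_cube_def cube_index_def vec_eq_iff)
qed

lemma measurable_dyadic_cube [measurable]: "dyadic_cube k m \<in> sets borel"
proof -
  have "{x. \<forall>i. 2 powi k * real_of_int (m $ i) \<le> x $ i \<and> x $ i < 2 powi k * (real_of_int (m $ i) + 1)}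
     = (\<Inter>i. {x \<in> space borel. 2 powi k * real_of_int (m $ i) \<le> x $ i \<and> x $ i < 2 powi k * (real_of_int (m $ i) + 1)})"
    by auto
  also have "\<dots> \<in> sets borel"
    by (intro sets.finite_INT) (auto intro!: sets.sets_Collect borel_measurable_le borel_measurable_less)
  finally show ?thesis by (simp add: dyadic_cube_def)
qed

lemma cube_index_half: "cube_index k x $ i = cube_index (k - 1) x $ i div 2"
proof -
  have "x $ i / 2 powi k = (x $ i / 2 powi (k - 1)) / real_of_int 2"
    by (simp add: power_int_diff)
  then show ?thesis
    unfolding cube_index_def vec_lambda_beta by (metis floor_divide_real_eq_div zero_le_numeral)
qed

lemma indicator_dyadic_cube_split:
  "indicator (dyadic_cube k m) x
     = (\<Sum>d\<in>offsets. indicator (dyadic_cube (k - 1) (2 * m + d)) x :: ennreal)"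
proof -
  define j where "j = cube_index (k - 1) x"
  have "(\<Sum>d\<in>offsets. indicator (dyadic_cube (k - 1) (2 * m + d)) x :: ennreal)
     = (\<Sum>d\<in>offsets. if d = j - 2 * m then 1 else 0)"
    by (intro sum.cong refl) (auto simp: indicator_def dyadic_cube_conv_index j_def)
  also have "\<dots> = (if j - 2 * m \<in> offsets then 1 else 0)"
    by simp
  also have "j - 2 * m \<in> offsets \<longleftrightarrow> cube_index k x = m"
  proof -
    have "j $ i - 2 * m $ i \<in> {0, 1} \<longleftrightarrow> j $ i div 2 = m $ i" for i by auto
    then show ?thesis
      by (simp add: offsets_def vec_eq_iff cube_index_half[of k] j_def[symmetric])
  qed
  finally show ?thesis by (simp add: indicator_def dyadic_cube_conv_index)
qed

lemma nn_integral_indicator_dyadic_cube: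
  "(\<integral>\<^sup>+m. f m * indicator (dyadic_cube k m) x \<partial>count_space UNIV) = f (cube_index k x)"
proof -
  have "(\<integral>\<^sup>+m. f m * indicator (dyadic_cube k m) x \<partial>count_space UNIV)
    = (\<integral>\<^sup>+m. f m * indicator {cube_index k x} m \<partial>count_space UNIV)"
    by (intro nn_integral_cong) (auto simp: indicator_def dyadic_cube_conv_index)
  then show ?thesis
    by (simp add: nn_integral_count_space_indicator[symmetric] nn_integral_count_space_finite)
qed

text \<open>Bounding the norm by the sum of the coordinates costs n where the diameter has the
  square root of n. This n is the source of the factor \<open>CARD('n) ^ p\<close> in the later
  constants.\<close>

lemma norm_diff_le_dyadic_cube:
  fixes x y :: "real^'n"
  assumes "x \<in> dyadic_cube k m" "y \<in> dyadic_cube k m"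
  shows "norm (x - y) \<le> real CARD('n) * 2 powi k"
proof -
  have "\<bar>(x - y) $ i\<bar> \<le> 2 powi k" for i
  proof -
    have "2 powi k * real_of_int (m $ i) \<le> x $ i" "x $ i < 2 powi k * (real_of_int (m $ i) + 1)"
      "2 powi k * real_of_int (m $ i) \<le> y $ i" "y $ i < 2 powi k * (real_of_int (m $ i) + 1)"
      using assms by (auto simp: dyadic_cube_def)
    then show ?thesis by (simp add: algebra_simps abs_le_iff)
  qed
  then have "(\<Sum>i\<in>UNIV. \<bar>(x - y) $ i\<bar>) \<le> of_nat CARD('n) * 2 powi k"
    by (intro sum_bounded_above)
  then show ?thesis using norm_le_l1_cart[of "x - y"] by linarith
qed

definition cube_mass :: "(real^'n \<Rightarrow> real) \<Rightarrow> int \<Rightarrow> int^'n \<Rightarrow> real" where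
  "cube_mass h k m = enn2real (\<integral>\<^sup>+x\<in>dyadic_cube k m. ennreal (h x) \<partial>lebesgue)"

text \<open>Finiteness on every cube makes the real number \<open>cube_mass\<close> faithful, since
  \<open>enn2real\<close> would turn an infinite integral into 0.\<close>

definition finite_on_cubes :: "(real^'n \<Rightarrow> real) \<Rightarrow> bool" where
  "finite_on_cubes h \<longleftrightarrow> h \<in> borel_measurable lebesgue \<and> (\<forall>x. h x \<ge> 0) \<and>
     (\<forall>k m. (\<integral>\<^sup>+x\<in>dyadic_cube k m. ennreal (h x) \<partial>lebesgue) < \<infinity>)"

lemma finite_on_cubesD:
  assumes "finite_on_cubes h"
  shows "h \<in> borel_measurable lebesgue" "h x \<ge> 0"
    "(\<integral>\<^sup>+x\<in>dyadic_cube k m. ennreal (h x) \<partial>lebesgue) < \<infinity>"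
    "ennreal (cube_mass h k m) = (\<integral>\<^sup>+x\<in>dyadic_cube k m. ennreal (h x) \<partial>lebesgue)"
  using assms by (auto simp: finite_on_cubes_def cube_mass_def)

lemma dyadic_cube_lebesgue [measurable]: "dyadic_cube k m \<in> sets lebesgue"
  using measurable_dyadic_cube by simp

lemma cube_mass_nonneg: "cube_mass h k m \<ge> 0"
  by (simp add: cube_mass_def)

lemma nn_integral_dyadic_cube_split:
  assumes [measurable]: "f \<in> borel_measurable lebesgue"
  shows "(\<integral>\<^sup>+x\<in>dyadic_cube k m. f x \<partial>lebesgue)
     = (\<Sum>d\<in>offsets. \<integral>\<^sup>+x\<in>dyadic_cube (k - 1) (2 * m + d). f x \<partial>lebesgue)"
  unfolding indicator_dyadic_cube_split[of k m] sum_distrib_left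
  by (rule nn_integral_sum) simp

lemma tree_additive_cube_mass:
  assumes h: "finite_on_cubes h"
  shows "tree_additive (cube_mass h)"
  unfolding tree_additive_def
proof (intro allI conjI)
  fix k m
  note [measurable] = finite_on_cubesD(1)[OF h]
  have "ennreal (cube_mass h k m) = (\<Sum>d\<in>offsets. ennreal (cube_mass h (k - 1) (2 * m + d)))"
    unfolding finite_on_cubesD(4)[OF h] by (rule nn_integral_dyadic_cube_split) simp
  then show "cube_mass h k m = (\<Sum>d\<in>offsets. cube_mass h (k - 1) (2 * m + d))"
    by (subst (asm) sum_ennreal) (auto simp: cube_mass_nonneg sum_nonneg)
qed (rule cube_mass_nonneg)

lemma nn_integral_cube_mass:
  assumes h: "finite_on_cubes h"
  shows "(\<integral>\<^sup>+m. ennreal (cube_mass h k m) \<partial>count_space UNIV) = (\<integral>\<^sup>+x. ennreal (h x) \<partial>lebesgue)"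
proof -
  note [measurable] = finite_on_cubesD(1)[OF h]
  have "(\<integral>\<^sup>+m. ennreal (cube_mass h k m) \<partial>count_space UNIV)
    = (\<integral>\<^sup>+x. \<integral>\<^sup>+m. ennreal (h x) * indicator (dyadic_cube k m) x \<partial>count_space UNIV \<partial>lebesgue)"
    unfolding finite_on_cubesD(4)[OF h]
    by (rule nn_integral_count_space_nn_integral[symmetric]) auto
  then show ?thesis by (simp add: nn_integral_indicator_dyadic_cube)
qed

definition cube_weight :: "nat \<Rightarrow> int \<Rightarrow> real" where
  "cube_weight p k = 1 / (2 powi k) ^ p"

lemma cube_weight_pos: "cube_weight p k > 0"
  by (simp add: cube_weight_def)

text \<open>Here the dimension enters: p = n - 2 is at least 1 for n \<ge> 3, and this makes the
  weights over a chain of ancestors a geometric series.\<close>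

lemma cube_weight_double:
  assumes "p \<ge> 1"
  shows "2 * cube_weight p k \<le> cube_weight p (k - 1)"
proof -
  have "cube_weight p (k - 1) = 2 ^ p * cube_weight p k"
    by (simp add: cube_weight_def power_int_diff power_divide)
  moreover have "(2::real) \<le> 2 ^ p" using assms self_le_power[of "2::real" p] by simp
  ultimately show ?thesis using cube_weight_pos[of p k] by (simp add: mult_right_mono)
qed

section \<open>Sigma-finiteness and product measurability for the completed Lebesgue measure\<close>

lemma sigma_finite_lebesgue: "sigma_finite_measure (lebesgue :: 'a::euclidean_space measure)"
proof
  obtain A :: "'a set set" where A: "countable A" "A \<subseteq> sets lborel" "\<Union> A = space lborel"
    "\<forall>a\<in>A. emeasure lborel a \<noteq> \<infinity>"
    using lborel.sigma_finite_countable by blast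
  then show "\<exists>A. countable A \<and> A \<subseteq> sets lebesgue \<and> \<Union> A = space (lebesgue :: 'a measure)
    \<and> (\<forall>a\<in>A. emeasure lebesgue a \<noteq> \<infinity>)"
    by (intro exI[of _ A]) (auto simp: subset_eq)
qed

interpretation lebesgue: sigma_finite_measure "lebesgue :: 'a::euclidean_space measure"
  by (rule sigma_finite_lebesgue)

interpretation lebesgue_pair: pair_sigma_finite "lebesgue :: 'a::euclidean_space measure"
  "lebesgue :: 'b::euclidean_space measure" ..

lemma measurable_ident_lebesgue_borel [measurable]: "(\<lambda>x. x) \<in> lebesgue \<rightarrow>\<^sub>M borel"
  by (rule measurable_completion) simp

lemma measurable_fst_lebesgue [measurable]: "fst \<in> lebesgue \<Otimes>\<^sub>M M \<rightarrow>\<^sub>M borel"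
  using measurable_compose[OF measurable_fst measurable_ident_lebesgue_borel] by simp

lemma measurable_snd_lebesgue [measurable]: "snd \<in> M \<Otimes>\<^sub>M lebesgue \<rightarrow>\<^sub>M borel"
  using measurable_compose[OF measurable_snd measurable_ident_lebesgue_borel] by simp

text \<open>For p \<ge> 1 the quotient |x - y|^(-p) has the value 0 at x = y, by
  \<open>a / 0 = 0\<close>, so kernel estimates are proved off the diagonal. This lemma discards the
  exceptional point from each inner integral.\<close>

lemma AE_lebesgue_neq: "AE y in lebesgue. y \<noteq> (x :: 'a::euclidean_space)"
  using AE_lborel_singleton[of x] by (simp add: AE_completion)

section \<open>From the testing condition to the Carleson condition\<close>

definition pair_energy :: "nat \<Rightarrow> (real^'n \<Rightarrow> real) \<Rightarrow> (real^'n) set \<Rightarrow> (real^'n) set \<Rightarrow> ennreal" where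
  "pair_energy p W A B =
     (\<integral>\<^sup>+x\<in>A. (\<integral>\<^sup>+y\<in>B. ennreal (W x * W y / norm (x - y) ^ p) \<partial>lebesgue) \<partial>lebesgue)"

lemma pair_energy_lower:
  assumes [measurable]: "W \<in> borel_measurable lebesgue" "A \<in> sets lebesgue" "B \<in> sets lebesgue"
    and W: "\<And>x. W x \<ge> 0" and R: "R > 0" "\<And>x y. x \<in> A \<Longrightarrow> y \<in> B \<Longrightarrow> norm (x - y) \<le> R"
  shows "ennreal (1 / R ^ p) * ((\<integral>\<^sup>+x\<in>A. ennreal (W x) \<partial>lebesgue) * (\<integral>\<^sup>+x\<in>B. ennreal (W x) \<partial>lebesgue))
    \<le> pair_energy p W A B"
proof -
  define b where "b = (\<integral>\<^sup>+x\<in>B. ennreal (W x) \<partial>lebesgue)"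
  have "ennreal (1 / R ^ p) * ((\<integral>\<^sup>+x\<in>A. ennreal (W x) \<partial>lebesgue) * b)
    = (\<integral>\<^sup>+x\<in>A. ennreal (1 / R ^ p) * ennreal (W x) * b \<partial>lebesgue)"
    by (simp add: nn_integral_cmult nn_integral_multc ac_simps flip: nn_integral_cmult nn_integral_multc)
  also have "\<dots> \<le> pair_energy p W A B"
    unfolding pair_energy_def
  proof (intro nn_integral_mono)
    fix x :: "real^'a"
    show "ennreal (1 / R ^ p) * ennreal (W x) * b * indicator A x
      \<le> (\<integral>\<^sup>+y\<in>B. ennreal (W x * W y / norm (x - y) ^ p) \<partial>lebesgue) * indicator A x"
    proof (cases "x \<in> A")
      case True
      have "ennreal (1 / R ^ p) * ennreal (W x) * b
        = (\<integral>\<^sup>+y\<in>B. ennreal (1 / R ^ p) * ennreal (W x) * ennreal (W y) \<partial>lebesgue)"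
        unfolding b_def by (subst nn_integral_cmult[symmetric]) (auto simp: ac_simps)
      also have "\<dots> \<le> (\<integral>\<^sup>+y\<in>B. ennreal (W x * W y / norm (x - y) ^ p) \<partial>lebesgue)"
      proof (rule nn_integral_mono_AE, use AE_lebesgue_neq[of x] in eventually_elim)
        fix y assume "y \<noteq> x"
        then have "y \<in> B \<Longrightarrow> W x * W y * (1 / R ^ p) \<le> W x * W y * (1 / norm (x - y) ^ p)"
          using R(2)[OF True, of y] W by (intro mult_left_mono divide_left_mono power_mono) (auto simp: R(1))
        then show "ennreal (1 / R ^ p) * ennreal (W x) * ennreal (W y) * indicator B y
          \<le> ennreal (W x * W y / norm (x - y) ^ p) * indicator B y"
          using W R(1) by (auto simp: indicator_def ennreal_mult''[symmetric] ac_simps intro!: ennreal_leI)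
      qed
      finally show ?thesis using True by simp
    qed simp
  qed
  finally show ?thesis by (simp add: b_def)
qed

lemma pair_energy_split:
  assumes [measurable]: "W \<in> borel_measurable lebesgue"
  shows "pair_energy p W (dyadic_cube k m) (dyadic_cube k m)
    = (\<Sum>d\<in>offsets. \<Sum>d'\<in>offsets.
        pair_energy p W (dyadic_cube (k - 1) (2 * m + d)) (dyadic_cube (k - 1) (2 * m + d')))"
proof -
  have "pair_energy p W (dyadic_cube k m) (dyadic_cube k m)
     = (\<Sum>d\<in>offsets. \<integral>\<^sup>+x\<in>dyadic_cube (k - 1) (2 * m + d).
         (\<integral>\<^sup>+y\<in>dyadic_cube k m. ennreal (W x * W y / norm (x - y) ^ p) \<partial>lebesgue) \<partial>lebesgue)"
    unfolding pair_energy_def by (rule nn_integral_dyadic_cube_split) simp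
  also have "\<dots> = (\<Sum>d\<in>offsets. \<integral>\<^sup>+x\<in>dyadic_cube (k - 1) (2 * m + d).
         (\<Sum>d'\<in>offsets. (\<integral>\<^sup>+y\<in>dyadic_cube (k - 1) (2 * m + d'). ennreal (W x * W y / norm (x - y) ^ p) \<partial>lebesgue)) \<partial>lebesgue)"
    by (intro sum.cong refl nn_integral_cong arg_cong2[where f="(*)"] nn_integral_dyadic_cube_split) simp
  also have "\<dots> = (\<Sum>d\<in>offsets. \<Sum>d'\<in>offsets.
        pair_energy p W (dyadic_cube (k - 1) (2 * m + d)) (dyadic_cube (k - 1) (2 * m + d')))"
    unfolding pair_energy_def sum_distrib_right by (intro sum.cong refl nn_integral_sum) simp
  finally show ?thesis .
qed

text \<open>\<open>tree_sum_le_energy\<close> is applied to n^p times the energy of a cube; n^p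
  compensates for the bound n \<ell> on distances in a cube of side \<ell>. When the energy is split
  over pairs of children, equal pairs give the energies of the children and unequal pairs the
  remaining term of \<open>step\<close>.\<close>

lemma tree_sum_cube_mass_le:
  fixes W :: "real^'n \<Rightarrow> real"
  assumes W: "finite_on_cubes W" and p: "p \<ge> 1" and B: "B \<ge> 0"
    and E: "\<And>k m. pair_energy p W (dyadic_cube k m) (dyadic_cube k m) \<le> ennreal (B * cube_mass W k m)"
  shows "tree_sum (cube_weight p) (cube_mass W) N k m \<le> 2 * real CARD('n) ^ p * B * cube_mass W k m"
proof -
  note [measurable] = finite_on_cubesD(1)[OF W]
  define n where "n = real CARD('n)"
  have n: "n > 0" by (simp add: n_def)
  define e where "e k m d d' = pair_energy p W (dyadic_cube (k - 1) (2 * m + d)) (dyadic_cube (k - 1) (2 * m + d'))"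
    for k and m d d' :: "int^'n"
  define J where "J k m = n ^ p * enn2real (pair_energy p W (dyadic_cube k m) (dyadic_cube k m))" for k m
  have fin: "pair_energy p W (dyadic_cube k m) (dyadic_cube k m) < \<infinity>" for k m
    using E[of k m] by (simp add: le_less_trans)
  \<comment> \<open>Used for a cube paired with itself and for pairs of children. In both cases
    distances are controlled by the ambient cube (k, m), whose weight therefore appears on the
    left.\<close>
  have lower: "cube_weight p k * (cube_mass W k' a * cube_mass W k' b)
      \<le> n ^ p * enn2real (pair_energy p W (dyadic_cube k' a) (dyadic_cube k' b))"
    if sub: "dyadic_cube k' a \<subseteq> dyadic_cube k m" "dyadic_cube k' b \<subseteq> dyadic_cube k m"
      and fin': "pair_energy p W (dyadic_cube k' a) (dyadic_cube k' b) < \<infinity>" for k k' m a b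
  proof -
    have "ennreal (1 / (n * 2 powi k) ^ p * (cube_mass W k' a * cube_mass W k' b))
      = ennreal (1 / (n * 2 powi k) ^ p) * (ennreal (cube_mass W k' a) * ennreal (cube_mass W k' b))"
      using n by (simp add: ennreal_mult[symmetric] cube_mass_nonneg)
    also have "\<dots> \<le> pair_energy p W (dyadic_cube k' a) (dyadic_cube k' b)"
      unfolding finite_on_cubesD(4)[OF W]
      using n sub norm_diff_le_dyadic_cube[of _ k m]
      by (intro pair_energy_lower) (auto simp: finite_on_cubesD(2)[OF W] n_def)
    also have "\<dots> = ennreal (enn2real (pair_energy p W (dyadic_cube k' a) (dyadic_cube k' b)))"
      using fin' by simp
    finally have "1 / (n * 2 powi k) ^ p * (cube_mass W k' a * cube_mass W k' b)
        \<le> enn2real (pair_energy p W (dyadic_cube k' a) (dyadic_cube k' b))"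
      by (simp add: ennreal_le_iff)
    then show ?thesis using n by (simp add: cube_weight_def power_mult_distrib field_simps)
  qed
  have split: "pair_energy p W (dyadic_cube k m) (dyadic_cube k m) = (\<Sum>d\<in>offsets. \<Sum>d'\<in>offsets. e k m d d')" for k m
    unfolding e_def by (rule pair_energy_split) simp
  have efin: "e k m d d' < \<infinity>" if "d \<in> offsets" "d' \<in> offsets" for k m d d'
  proof -
    have "e k m d d' \<le> (\<Sum>d'\<in>offsets. e k m d d')"
      by (rule member_le_sum) (use that in auto)
    also have "\<dots> \<le> (\<Sum>d\<in>offsets. \<Sum>d'\<in>offsets. e k m d d')"
      by (rule member_le_sum[where f="\<lambda>d. \<Sum>d'\<in>offsets. e k m d d'"]) (use that in auto)
    finally show ?thesis using fin[of k m] by (simp add: split[symmetric])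
  qed
  have sub: "dyadic_cube (k - 1) (2 * m + d) \<subseteq> dyadic_cube k m" if d: "d \<in> offsets" for k and m d :: "int^'n"
  proof
    fix x assume x: "x \<in> dyadic_cube (k - 1) (2 * m + d)"
    have "(1::ennreal) \<le> (\<Sum>d\<in>offsets. indicator (dyadic_cube (k - 1) (2 * m + d)) x)"
      using member_le_sum[of d offsets "\<lambda>d. indicator (dyadic_cube (k - 1) (2 * m + d)) x :: ennreal"] d x by simp
    then show "x \<in> dyadic_cube k m"
      unfolding indicator_dyadic_cube_split[symmetric] by (cases "x \<in> dyadic_cube k m") simp_all
  qed
  have "tree_sum (cube_weight p) (cube_mass W) N k m \<le> 2 * J k m"
  proof (rule tree_sum_le_energy)
    show "2 * cube_weight p k \<le> cube_weight p (k - 1)" for k by (rule cube_weight_double[OF p])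
    show "0 \<le> cube_weight p k" for k using cube_weight_pos[of p k] by simp
    show "cube_weight p k * (cube_mass W k m)\<^sup>2 \<le> J k m" for k m
      using lower[of k m k m m] fin by (simp add: J_def power2_eq_square)
    fix k m
    let ?M = "\<lambda>d. cube_mass W (k - 1) (2 * m + d)"
    let ?e = "\<lambda>d d'. enn2real (e k m d d')"
    let ?w = "cube_weight p k"
    have Jeq: "J k m = (\<Sum>d\<in>offsets. \<Sum>d'\<in>offsets. n ^ p * ?e d d')"
    proof -
      have "(\<Sum>d'\<in>offsets. e k m d d') < top" if "d \<in> offsets" for d
        using efin[OF that] by simp
      then have "enn2real (\<Sum>d\<in>offsets. \<Sum>d'\<in>offsets. e k m d d') = (\<Sum>d\<in>offsets. enn2real (\<Sum>d'\<in>offsets. e k m d d'))"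
        by (subst enn2real_sum) (auto simp: o_def)
      also have "\<dots> = (\<Sum>d\<in>offsets. \<Sum>d'\<in>offsets. ?e d d')"
        using efin by (intro sum.cong refl, subst enn2real_sum) (auto simp: o_def)
      finally have "enn2real (\<Sum>d\<in>offsets. \<Sum>d'\<in>offsets. e k m d d') = (\<Sum>d\<in>offsets. \<Sum>d'\<in>offsets. ?e d d')" .
      then show ?thesis by (simp add: J_def split sum_distrib_left)
    qed
    have M: "cube_mass W k m = (\<Sum>d\<in>offsets. ?M d)"
      using tree_additiveD(2)[OF tree_additive_cube_mass[OF W]] .
    \<comment> \<open>Writing one factor of M^2 as the sum over the children distributes the whole
      expression over \<open>d\<close>, and later over \<open>d'\<close>. The comparison is then
      termwise, with equality for d' = d.\<close>
    have "(\<Sum>d\<in>offsets. J (k - 1) (2 * m + d)) + ?w * ((cube_mass W k m)\<^sup>2 - (\<Sum>d\<in>offsets. (?M d)\<^sup>2))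
      = (\<Sum>d\<in>offsets. n ^ p * ?e d d + ?w * ?M d * cube_mass W k m - ?w * (?M d)\<^sup>2)"
    proof -
      have "(\<Sum>d\<in>offsets. ?w * ?M d * cube_mass W k m) = ?w * (\<Sum>d\<in>offsets. ?M d) * cube_mass W k m"
        by (simp only: sum_distrib_left sum_distrib_right)
      then have "(\<Sum>d\<in>offsets. ?w * ?M d * cube_mass W k m) = ?w * (cube_mass W k m)\<^sup>2"
        by (simp only: M[symmetric] power2_eq_square mult.assoc)
      then show ?thesis
        by (simp add: sum.distrib sum_subtractf J_def e_def sum_distrib_left right_diff_distrib)
    qed
    also have "\<dots> \<le> J k m"
      unfolding Jeq
    proof (rule sum_mono)
      fix d assume d: "d \<in> (offsets :: (int^'n) set)"
      have "n ^ p * ?e d d + ?w * ?M d * cube_mass W k m - ?w * (?M d)\<^sup>2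
        = (\<Sum>d'\<in>offsets. ?w * ?M d * ?M d' + (if d' = d then n ^ p * ?e d d - ?w * (?M d)\<^sup>2 else 0))"
      proof -
        have "(\<Sum>d'\<in>offsets. ?w * ?M d * ?M d') = ?w * ?M d * cube_mass W k m"
          by (subst M) (simp only: sum_distrib_left)
        then show ?thesis using d by (simp add: sum.distrib)
      qed
      also have "\<dots> \<le> (\<Sum>d'\<in>offsets. n ^ p * ?e d d')"
      proof (rule sum_mono)
        fix d' assume d': "d' \<in> (offsets :: (int^'n) set)"
        have "?w * (?M d * ?M d') \<le> n ^ p * ?e d d'"
          using lower[OF sub[OF d] sub[OF d'], of k m] efin[OF d d', of k m] unfolding e_def .
        then show "?w * ?M d * ?M d' + (if d' = d then n ^ p * ?e d d - ?w * (?M d)\<^sup>2 else 0) \<le> n ^ p * ?e d d'"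
          by (auto simp: power2_eq_square ac_simps)
      qed
      finally show "n ^ p * ?e d d + ?w * ?M d * cube_mass W k m - ?w * (?M d)\<^sup>2
        \<le> (\<Sum>d'\<in>offsets. n ^ p * ?e d d')" .
    qed
    finally show "(\<Sum>d\<in>offsets. J (k - 1) (2 * m + d)) +
      ?w * ((cube_mass W k m)\<^sup>2 - (\<Sum>d\<in>offsets. (?M d)\<^sup>2)) \<le> J k m" .
  qed
  also have "J k m \<le> n ^ p * (B * cube_mass W k m)"
    unfolding J_def using n E[of k m] B
    by (intro mult_left_mono enn2real_leI) (auto simp: cube_mass_nonneg)
  finally show ?thesis by (simp add: n_def)
qed

subsection \<open>Energy of the Newtonian kernel\<close>

text \<open>The cube itself and the adjacent ones of the same size. Two close points can be
  separated by the grid at all small scales, but at a scale not below their distance they always lie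
  in such a pair.\<close>

definition neighbours :: "(int^'n) set" where
  "neighbours = {d. \<forall>i. d $ i \<in> {-1, 0, 1}}"

lemma finite_neighbours [simp]: "finite (neighbours :: (int^'n) set)"
  unfolding neighbours_def by (rule finite_vec_range) simp

definition newton_potential :: "(real^'n \<Rightarrow> real) \<Rightarrow> real^'n \<Rightarrow> ennreal" where
  "newton_potential h x = (\<integral>\<^sup>+y. ennreal (h y / norm (x - y) ^ (CARD('n) - 2)) \<partial>lebesgue)"

definition dyadic_energy :: "nat \<Rightarrow> (real^'n \<Rightarrow> real) \<Rightarrow> ennreal" where
  "dyadic_energy p h =
     (\<integral>\<^sup>+k. \<integral>\<^sup>+m. ennreal (cube_weight p k * (cube_mass h k m)\<^sup>2) \<partial>count_space UNIV \<partial>count_space UNIV)"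

lemma dyadic_scale:
  fixes t :: real
  assumes "t > 0"
  obtains k where "2 powi k / 2 < t" "t \<le> 2 powi k"
proof
  let ?k = "\<lceil>log 2 t\<rceil>"
  have *: "(2::real) powi ?k = 2 powr of_int ?k" by (simp add: powr_real_of_int')
  have "(2::real) powr (of_int ?k - 1) < 2 powr (log 2 t)"
    by (rule powr_less_mono) (linarith, simp)
  then show "2 powi ?k / 2 < t" using assms by (simp add: * powr_diff)
  have "(2::real) powr (log 2 t) \<le> 2 powr of_int ?k" by (rule powr_mono) simp_all
  then show "t \<le> 2 powi ?k" using assms by (simp add: *)
qed

lemma cube_index_neighbour:
  fixes x y :: "real^'n"
  assumes "norm (x - y) \<le> 2 powi k"
  shows "cube_index k y - cube_index k x \<in> neighbours"
proof -
  have "\<lfloor>y $ i / 2 powi k\<rfloor> - \<lfloor>x $ i / 2 powi k\<rfloor> \<in> {-1, 0, 1}" for i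
  proof -
    have "\<bar>x $ i - y $ i\<bar> \<le> 2 powi k"
      using component_le_norm_cart[of "x - y" i] assms by simp
    then have "\<bar>(x $ i - y $ i) / 2 powi k\<bar> \<le> 1" by (simp add: abs_divide)
    then have "\<bar>x $ i / 2 powi k - y $ i / 2 powi k\<bar> \<le> 1" by (simp add: diff_divide_distrib)
    then show ?thesis by simp linarith
  qed
  then show ?thesis by (simp add: neighbours_def cube_index_def)
qed

text \<open>Only the scale with 2^(k - 1) < |x - y| \<le> 2^k is kept in the sum. There x and y lie
  in equal or adjacent cubes, and |x - y|^(-p) exceeds the weight 2^(-k p) by at most the factor
  2^p.\<close>

lemma newton_kernel_le:
  fixes x y :: "real^'n"
  assumes "x \<noteq> y"
  shows "ennreal (1 / norm (x - y) ^ p) \<le> 2 ^ p * (\<integral>\<^sup>+k. \<integral>\<^sup>+m. (\<Sum>d\<in>neighbours. ennreal (cube_weight p k) *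
    (indicator (dyadic_cube k m) x * indicator (dyadic_cube k (m + d)) y)) \<partial>count_space UNIV \<partial>count_space UNIV)"
proof -
  obtain k where k: "2 powi k / 2 < norm (x - y)" "norm (x - y) \<le> 2 powi k"
    using dyadic_scale[of "norm (x - y)"] assms by auto
  define m where "m = cube_index k x"
  define d where "d = cube_index k y - m"
  have d: "d \<in> neighbours" using cube_index_neighbour[OF k(2)] by (simp add: d_def m_def)
  let ?f = "\<lambda>k m d. ennreal (cube_weight p k) * (indicator (dyadic_cube k m) x * indicator (dyadic_cube k (m + d)) y)"
  have "1 / norm (x - y) ^ p \<le> 1 / (2 powi k / 2) ^ p"
    using k(1) assms by (intro divide_left_mono power_mono) auto
  also have "\<dots> = 2 ^ p * cube_weight p k" by (simp add: cube_weight_def power_divide)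
  finally have "1 / norm (x - y) ^ p \<le> 2 ^ p * cube_weight p k" .
  then have "ennreal (1 / norm (x - y) ^ p) \<le> 2 ^ p * ennreal (cube_weight p k)"
  proof -
    have "(2::ennreal) ^ p = ennreal (2 ^ p)" by (simp flip: ennreal_power)
    then show ?thesis
      using ennreal_leI[OF \<open>1 / norm (x - y) ^ p \<le> 2 ^ p * cube_weight p k\<close>] cube_weight_pos[of p k]
      by (simp add: ennreal_mult)
  qed
  also have "ennreal (cube_weight p k) = ?f k m d"
  proof -
    have "x \<in> dyadic_cube k m" "y \<in> dyadic_cube k (m + d)"
      by (auto simp: dyadic_cube_conv_index m_def d_def)
    then show ?thesis by simp
  qed
  also have "?f k m d \<le> (\<Sum>d\<in>neighbours. ?f k m d)"
    by (rule member_le_sum) (use d in auto)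
  also have "\<dots> \<le> (\<integral>\<^sup>+m. (\<Sum>d\<in>neighbours. ?f k m d) \<partial>count_space UNIV)"
    by (rule nn_integral_ge_point) simp
  also have "\<dots> \<le> (\<integral>\<^sup>+k. \<integral>\<^sup>+m. (\<Sum>d\<in>neighbours. ?f k m d) \<partial>count_space UNIV \<partial>count_space UNIV)"
    by (rule nn_integral_ge_point[where p="\<lambda>k. \<integral>\<^sup>+m. (\<Sum>d\<in>neighbours. ?f k m d) \<partial>count_space UNIV"]) simp
  finally show ?thesis by (simp add: mult_left_mono)
qed

lemma newton_potential_measurable [measurable]:
  assumes [measurable]: "h \<in> borel_measurable lebesgue"
  shows "newton_potential h \<in> borel_measurable lebesgue"
  unfolding newton_potential_def[abs_def] by measurable

lemma borel_measurable_nn_integral_count_space: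
  fixes f :: "'a \<Rightarrow> 'i \<Rightarrow> ennreal"
  assumes "countable (UNIV :: 'i set)" "\<And>i. (\<lambda>x. f x i) \<in> borel_measurable M"
  shows "(\<lambda>x. \<integral>\<^sup>+i. f x i \<partial>count_space UNIV) \<in> borel_measurable M"
proof -
  interpret C: sigma_finite_measure "count_space (UNIV :: 'i set)"
    by (rule sigma_finite_measure_count_space_countable) (rule assms)
  have "(\<lambda>(i, x). f x i) \<in> borel_measurable (count_space UNIV \<Otimes>\<^sub>M M)"
    by (rule measurable_pair_measure_countable1[OF assms(1)]) (simp add: assms(2))
  then have "(\<lambda>(x, i). f x i) \<in> borel_measurable (M \<Otimes>\<^sub>M count_space UNIV)"
    by (subst measurable_pair_swap_iff) (simp add: split_def)
  then show ?thesis by (intro C.borel_measurable_nn_integral) simp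
qed

text \<open>Tonelli for one space variable against the sums over level, cube and neighbour. It
  serves first the variable y, with \<open>c\<close> holding the weight and the indicator at x, and
  then x, with \<open>c\<close> holding the weight and the mass of the neighbouring cube.\<close>

lemma nn_integral_swap_cubes:
  fixes c :: "int \<Rightarrow> int^'n \<Rightarrow> int^'n \<Rightarrow> ennreal"
  assumes [measurable]: "g \<in> borel_measurable lebesgue" "\<And>k m d. Q k m d \<in> sets lebesgue"
  shows "(\<lambda>x. \<integral>\<^sup>+k. \<integral>\<^sup>+m. (\<Sum>d\<in>D. c k m d * (g x * indicator (Q k m d) x))
      \<partial>count_space UNIV \<partial>count_space UNIV) \<in> borel_measurable lebesgue" (is ?meas)
    and "(\<integral>\<^sup>+x. (\<integral>\<^sup>+k. \<integral>\<^sup>+m. (\<Sum>d\<in>D. c k m d * (g x * indicator (Q k m d) x))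
      \<partial>count_space UNIV \<partial>count_space UNIV) \<partial>lebesgue)
    = (\<integral>\<^sup>+k. \<integral>\<^sup>+m. (\<Sum>d\<in>D. c k m d * (\<integral>\<^sup>+x\<in>Q k m d. g x \<partial>lebesgue)) \<partial>count_space UNIV \<partial>count_space UNIV)"
proof -
  have m1: "(\<lambda>x. \<Sum>d\<in>D. c k m d * (g x * indicator (Q k m d) x)) \<in> borel_measurable lebesgue" for k m
    by measurable
  have m2: "(\<lambda>x. \<integral>\<^sup>+m. (\<Sum>d\<in>D. c k m d * (g x * indicator (Q k m d) x)) \<partial>count_space UNIV) \<in> borel_measurable lebesgue" for k
    by (rule borel_measurable_nn_integral_count_space) (simp, rule m1)
  show ?meas
    by (rule borel_measurable_nn_integral_count_space) (simp, rule m2)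
  have "(\<integral>\<^sup>+x. (\<integral>\<^sup>+k. \<integral>\<^sup>+m. (\<Sum>d\<in>D. c k m d * (g x * indicator (Q k m d) x))
      \<partial>count_space UNIV \<partial>count_space UNIV) \<partial>lebesgue)
    = (\<integral>\<^sup>+k. \<integral>\<^sup>+x. \<integral>\<^sup>+m. (\<Sum>d\<in>D. c k m d * (g x * indicator (Q k m d) x))
      \<partial>count_space UNIV \<partial>lebesgue \<partial>count_space UNIV)"
    by (rule nn_integral_count_space_nn_integral) (simp, rule m2)
  also have "\<dots> = (\<integral>\<^sup>+k. \<integral>\<^sup>+m. \<integral>\<^sup>+x. (\<Sum>d\<in>D. c k m d * (g x * indicator (Q k m d) x))
      \<partial>lebesgue \<partial>count_space UNIV \<partial>count_space UNIV)"
    by (intro nn_integral_cong nn_integral_count_space_nn_integral) (simp, rule m1)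
  also have "\<dots> = (\<integral>\<^sup>+k. \<integral>\<^sup>+m. (\<Sum>d\<in>D. \<integral>\<^sup>+x. c k m d * (g x * indicator (Q k m d) x) \<partial>lebesgue)
      \<partial>count_space UNIV \<partial>count_space UNIV)"
    by (intro nn_integral_cong nn_integral_sum) measurable
  also have "\<dots> = (\<integral>\<^sup>+k. \<integral>\<^sup>+m. (\<Sum>d\<in>D. c k m d * (\<integral>\<^sup>+x\<in>Q k m d. g x \<partial>lebesgue)) \<partial>count_space UNIV \<partial>count_space UNIV)"
    by (intro nn_integral_cong sum.cong refl nn_integral_cmult) measurable
  finally show "(\<integral>\<^sup>+x. (\<integral>\<^sup>+k. \<integral>\<^sup>+m. (\<Sum>d\<in>D. c k m d * (g x * indicator (Q k m d) x))
      \<partial>count_space UNIV \<partial>count_space UNIV) \<partial>lebesgue)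
    = (\<integral>\<^sup>+k. \<integral>\<^sup>+m. (\<Sum>d\<in>D. c k m d * (\<integral>\<^sup>+x\<in>Q k m d. g x \<partial>lebesgue)) \<partial>count_space UNIV \<partial>count_space UNIV)" .
qed

lemma energy_le_dyadic_energy:
  fixes h :: "real^'n \<Rightarrow> real"
  assumes h: "finite_on_cubes h"
  shows "(\<integral>\<^sup>+x. ennreal (h x) * newton_potential h x \<partial>lebesgue)
    \<le> ennreal (2 ^ (CARD('n) - 2) * (2 * real (card (neighbours :: (int^'n) set)))) * dyadic_energy (CARD('n) - 2) h"
proof -
  define p where "p = CARD('n) - 2"
  note [measurable] = finite_on_cubesD(1)[OF h]
  let ?X = "cube_mass h"
  let ?cs = "count_space UNIV"
  have pot: "newton_potential h x \<le> 2 ^ p * (\<integral>\<^sup>+k. \<integral>\<^sup>+m. (\<Sum>d\<in>neighbours. ennreal (cube_weight p k) *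
      indicator (dyadic_cube k m) x * ennreal (?X k (m + d))) \<partial>count_space (UNIV :: (int^'n) set) \<partial>count_space UNIV)"
    (is "_ \<le> 2 ^ p * ?R x") for x
  proof -
    have "newton_potential h x \<le> (\<integral>\<^sup>+y. 2 ^ p * (\<integral>\<^sup>+k. \<integral>\<^sup>+m. (\<Sum>d\<in>neighbours. ennreal (cube_weight p k) *
        indicator (dyadic_cube k m) x * (ennreal (h y) * indicator (dyadic_cube k (m + d)) y)) \<partial>?cs \<partial>?cs) \<partial>lebesgue)"
      unfolding newton_potential_def p_def[symmetric]
    proof (rule nn_integral_mono_AE, use AE_lebesgue_neq[of x] in eventually_elim)
      fix y assume y: "y \<noteq> x"
      have "ennreal (h y / norm (x - y) ^ p) = ennreal (h y) * ennreal (1 / norm (x - y) ^ p)"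
        using finite_on_cubesD(2)[OF h] by (simp add: ennreal_mult'[symmetric])
      also have "\<dots> \<le> ennreal (h y) * (2 ^ p * (\<integral>\<^sup>+k. \<integral>\<^sup>+m. (\<Sum>d\<in>neighbours. ennreal (cube_weight p k) *
          (indicator (dyadic_cube k m) x * indicator (dyadic_cube k (m + d)) y)) \<partial>?cs \<partial>?cs))"
        using newton_kernel_le[of x y p] y by (intro mult_left_mono) auto
      also have "\<dots> = 2 ^ p * (\<integral>\<^sup>+k. \<integral>\<^sup>+m. ennreal (h y) * (\<Sum>d\<in>neighbours. ennreal (cube_weight p k) *
          (indicator (dyadic_cube k m) x * indicator (dyadic_cube k (m + d)) y)) \<partial>?cs \<partial>?cs)"
        by (simp add: nn_integral_cmult mult.left_commute)
      finally show "ennreal (h y / norm (x - y) ^ p) \<le> 2 ^ p * (\<integral>\<^sup>+k. \<integral>\<^sup>+m. (\<Sum>d\<in>neighbours. ennreal (cube_weight p k) *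
        indicator (dyadic_cube k m) x * (ennreal (h y) * indicator (dyadic_cube k (m + d)) y)) \<partial>?cs \<partial>?cs)"
        by (simp add: sum_distrib_left ac_simps)
    qed
    also have "\<dots> = 2 ^ p * (\<integral>\<^sup>+y. (\<integral>\<^sup>+k. \<integral>\<^sup>+m. (\<Sum>d\<in>neighbours. ennreal (cube_weight p k) *
        indicator (dyadic_cube k m) x * (ennreal (h y) * indicator (dyadic_cube k (m + d)) y)) \<partial>?cs \<partial>?cs) \<partial>lebesgue)"
      by (rule nn_integral_cmult, rule nn_integral_swap_cubes(1)) auto
    also have "\<dots> = 2 ^ p * ?R x"
      unfolding finite_on_cubesD(4)[OF h]
      by (rule arg_cong[where f="(*) (2 ^ p)"], rule nn_integral_swap_cubes(2)) auto
    finally show ?thesis .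
  qed
  have "(\<integral>\<^sup>+x. ennreal (h x) * newton_potential h x \<partial>lebesgue)
     \<le> (\<integral>\<^sup>+x. 2 ^ p * (\<integral>\<^sup>+k. \<integral>\<^sup>+m. (\<Sum>d\<in>neighbours. ennreal (cube_weight p k) * ennreal (?X k (m + d)) *
         (ennreal (h x) * indicator (dyadic_cube k m) x)) \<partial>?cs \<partial>?cs) \<partial>lebesgue)"
  proof (rule nn_integral_mono)
    fix x
    have "ennreal (h x) * newton_potential h x \<le> ennreal (h x) * (2 ^ p * ?R x)"
      using pot by (intro mult_left_mono) auto
    also have "\<dots> = 2 ^ p * (\<integral>\<^sup>+k. \<integral>\<^sup>+m. ennreal (h x) * (\<Sum>d\<in>neighbours. ennreal (cube_weight p k) *
      indicator (dyadic_cube k m) x * ennreal (?X k (m + d))) \<partial>?cs \<partial>?cs)"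
      by (simp add: nn_integral_cmult mult.left_commute)
    finally show "ennreal (h x) * newton_potential h x \<le> 2 ^ p * (\<integral>\<^sup>+k. \<integral>\<^sup>+m. (\<Sum>d\<in>neighbours. ennreal (cube_weight p k) * ennreal (?X k (m + d)) *
         (ennreal (h x) * indicator (dyadic_cube k m) x)) \<partial>?cs \<partial>?cs)"
      by (simp add: sum_distrib_left ac_simps)
  qed
  also have "\<dots> = 2 ^ p * (\<integral>\<^sup>+x. (\<integral>\<^sup>+k. \<integral>\<^sup>+m. (\<Sum>d\<in>neighbours. ennreal (cube_weight p k) * ennreal (?X k (m + d)) *
         (ennreal (h x) * indicator (dyadic_cube k m) x)) \<partial>?cs \<partial>?cs) \<partial>lebesgue)"
    by (rule nn_integral_cmult, rule nn_integral_swap_cubes(1)) auto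
  also have "\<dots> = 2 ^ p * (\<integral>\<^sup>+k. \<integral>\<^sup>+m. (\<Sum>d\<in>neighbours. ennreal (cube_weight p k) * ennreal (?X k (m + d)) *
         (\<integral>\<^sup>+x\<in>dyadic_cube k m. ennreal (h x) \<partial>lebesgue)) \<partial>?cs \<partial>?cs)"
    by (rule arg_cong[where f="(*) (2 ^ p)"], rule nn_integral_swap_cubes(2)) auto
  also have "\<dots> = 2 ^ p * (\<integral>\<^sup>+k. \<integral>\<^sup>+m. (\<Sum>d\<in>neighbours. ennreal (cube_weight p k) * ennreal (?X k (m + d)) *
         ennreal (?X k m)) \<partial>?cs \<partial>?cs)"
    by (simp add: finite_on_cubesD(4)[OF h])
  also have "\<dots> \<le> 2 ^ p * (\<integral>\<^sup>+k. \<integral>\<^sup>+m. (\<Sum>d\<in>neighbours. ennreal (cube_weight p k * (?X k m)\<^sup>2) +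
         ennreal (cube_weight p k * (?X k (m + d))\<^sup>2)) \<partial>?cs \<partial>?cs)"
  proof (intro mult_left_mono nn_integral_mono sum_mono)
    fix k and m d :: "int^'n"
    have "?X k (m + d) * ?X k m \<le> (?X k m)\<^sup>2 + (?X k (m + d))\<^sup>2"
      using sum_squares_bound[of "?X k (m + d)" "?X k m"]
        mult_nonneg_nonneg[OF cube_mass_nonneg[of h k "m + d"] cube_mass_nonneg[of h k m]] by linarith
    then have "cube_weight p k * (?X k (m + d) * ?X k m) \<le> cube_weight p k * ((?X k m)\<^sup>2 + (?X k (m + d))\<^sup>2)"
      using cube_weight_pos[of p k] by (intro mult_left_mono) auto
    then show "ennreal (cube_weight p k) * ennreal (?X k (m + d)) * ennreal (?X k m)
       \<le> ennreal (cube_weight p k * (?X k m)\<^sup>2) + ennreal (cube_weight p k * (?X k (m + d))\<^sup>2)"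
      using cube_weight_pos[of p k] cube_mass_nonneg[of h k "m + d"] cube_mass_nonneg[of h k m]
      by (simp add: ennreal_mult[symmetric] ennreal_plus[symmetric] ennreal_leI algebra_simps del: ennreal_plus)
  qed simp
  also have "\<dots> = 2 ^ p * (\<integral>\<^sup>+k. (\<Sum>d\<in>(neighbours :: (int^'n) set). (\<integral>\<^sup>+m. ennreal (cube_weight p k * (?X k m)\<^sup>2) \<partial>?cs) +
         (\<integral>\<^sup>+m. ennreal (cube_weight p k * (?X k (m + d))\<^sup>2) \<partial>?cs)) \<partial>?cs)"
    by (simp add: nn_integral_sum nn_integral_add)
  also have "\<dots> = 2 ^ p * (\<integral>\<^sup>+k. (\<Sum>d\<in>(neighbours :: (int^'n) set). 2 * (\<integral>\<^sup>+m. ennreal (cube_weight p k * (?X k m)\<^sup>2) \<partial>?cs)) \<partial>?cs)"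
  proof -
    \<comment> \<open>Shifting the index by \<open>d\<close> permutes the cubes of level
      \<open>k\<close>, so the squares at the neighbours have the same sum. Hence the factor 2 per
      neighbour.\<close>
    have "(\<integral>\<^sup>+m. ennreal (cube_weight p k * (?X k (m + d))\<^sup>2) \<partial>?cs) = (\<integral>\<^sup>+m. ennreal (cube_weight p k * (?X k m)\<^sup>2) \<partial>?cs)" for k d
      by (rule nn_integral_bij_count_space[where g="\<lambda>m. m + d"])
         (auto intro!: bij_betwI[where g="\<lambda>m. m - d"])
    then show ?thesis by (simp add: mult_2)
  qed
  also have "\<dots> = 2 ^ p * (2 * of_nat (card (neighbours :: (int^'n) set))) * dyadic_energy p h"
    by (simp add: nn_integral_cmult dyadic_energy_def ac_simps)
  also have "2 ^ p * (2 * of_nat (card (neighbours :: (int^'n) set))) =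
      ennreal (2 ^ p * (2 * real (card (neighbours :: (int^'n) set))))"
    by (simp add: ennreal_mult ennreal_power[symmetric] ennreal_of_nat_eq_real_of_nat)
  finally show ?thesis by (simp add: p_def)
qed

subsection \<open>An approximate identity\<close>

text \<open>By \<open>integrable_induct\<close> the indicator functions are decisive: a closed and
  an open set approximate A from inside and outside, and Urysohn's lemma interpolates between them.
  Boundedness is recorded because the dominated convergence arguments for \<open>mollify\<close>
  rely on it.\<close>

lemma integrable_approx_bounded_continuous:
  fixes f :: "'a::euclidean_space \<Rightarrow> 'b::euclidean_space"
  assumes "integrable lebesgue f" "\<eta> > 0"
  shows "\<exists>g. continuous_on UNIV g \<and> bounded (range g) \<and> (\<integral>\<^sup>+x. norm (f x - g x) \<partial>lebesgue) < ennreal \<eta>"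
  using assms
proof (induction arbitrary: \<eta> rule: integrable_induct)
  case (base A c)
  \<comment> \<open>The error is at most |c| times the measure of a set, which is at most 2 e; the
    summand 4 in the denominator covers c = 0 and leaves room for a strict inequality.\<close>
  define e where "e = \<eta> / (4 * norm c + 4)"
  have e: "e > 0" using base(3) by (simp add: e_def add_nonneg_pos)
  obtain T where T: "open T" "A \<subseteq> T" "T - A \<in> lmeasurable" "emeasure lebesgue (T - A) < ennreal e"
    using sets_lebesgue_outer_open[OF base(1) e] by blast
  obtain C where C: "closed C" "C \<subseteq> A" "A - C \<in> lmeasurable" "emeasure lebesgue (A - C) < ennreal e"
    using sets_lebesgue_inner_closed[OF base(1) e] by blast
  have TC: "T - C = (T - A) \<union> (A - C)" using T(2) C(2) by auto
  have sets: "T - C \<in> sets lebesgue"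
    unfolding TC using T(3) C(3) by (intro sets.Un) (auto simp: fmeasurable_def)
  have "emeasure lebesgue (T - C) \<le> emeasure lebesgue (T - A) + emeasure lebesgue (A - C)"
    unfolding TC by (rule emeasure_subadditive) (use T(3) C(3) in \<open>auto simp: fmeasurable_def\<close>)
  also have "\<dots> \<le> ennreal e + ennreal e" using T(4) C(4) by (intro add_mono) auto
  also have "\<dots> = ennreal (2 * e)" using e by (simp add: ennreal_plus[symmetric] del: ennreal_plus)
  finally have small: "emeasure lebesgue (T - C) \<le> ennreal (2 * e)" .
  obtain g where g: "continuous_on UNIV g" "\<And>x. g x \<in> closed_segment c 0"
    "\<And>x. x \<in> C \<Longrightarrow> g x = c" "\<And>x. x \<in> - T \<Longrightarrow> g x = 0"
    using Urysohn[of C "- T" c 0] C(1,2) T(1,2) by (auto simp: closed_Compl)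
  have gn: "norm (g x) \<le> norm c" for x
    using segment_bound[OF g(2)[of x]] by simp
  have "(\<integral>\<^sup>+x. norm (indicator A x *\<^sub>R c - g x) \<partial>lebesgue)
     \<le> (\<integral>\<^sup>+x. ennreal (norm c) * indicator (T - C) x \<partial>lebesgue)"
  proof (rule nn_integral_mono)
    fix x
    have "norm (c - g x) \<le> norm c"
      using segment_bound(1)[OF g(2)[of x]] by (simp add: norm_minus_commute)
    then show "ennreal (norm (indicator A x *\<^sub>R c - g x)) \<le> ennreal (norm c) * indicator (T - C) x"
      using gn[of x] g(3,4)[of x] T(2) C(2) by (auto simp: indicator_def)
  qed
  also have "\<dots> = ennreal (norm c) * emeasure lebesgue (T - C)"
    using sets by (simp add: nn_integral_cmult_indicator)
  also have "\<dots> \<le> ennreal (norm c) * ennreal (2 * e)" using small by (rule mult_left_mono) simp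
  also have "\<dots> = ennreal (norm c * (2 * e))" using e by (simp add: ennreal_mult)
  also have "\<dots> < ennreal \<eta>"
  proof (rule ennreal_lessI[OF base(3)])
    have "4 * norm c + 4 > 0" by (simp add: add_nonneg_pos)
    then have "e * (4 * norm c + 4) = \<eta>" by (simp add: e_def)
    moreover have "e * norm c \<ge> 0" using e by simp
    moreover have "e * (4 * norm c + 4) = 4 * (e * norm c) + 4 * e" "norm c * (2 * e) = 2 * (e * norm c)"
      by (simp_all add: algebra_simps)
    ultimately show "norm c * (2 * e) < \<eta>" using e by linarith
  qed
  finally show ?case using g(1) gn by (intro exI[of _ g]) (auto simp: bounded_iff)
next
  case (add f g)
  obtain f' g' where f': "continuous_on UNIV f'" "bounded (range f')" "(\<integral>\<^sup>+x. norm (f x - f' x) \<partial>lebesgue) < ennreal (\<eta> / 2)"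
    and g': "continuous_on UNIV g'" "bounded (range g')" "(\<integral>\<^sup>+x. norm (g x - g' x) \<partial>lebesgue) < ennreal (\<eta> / 2)"
    using add.IH(1)[of "\<eta> / 2"] add.IH(2)[of "\<eta> / 2"] add.prems by auto
  have [measurable]: "f' \<in> borel_measurable lebesgue" "g' \<in> borel_measurable lebesgue"
    using f'(1) g'(1) by (auto intro!: measurable_completion borel_measurable_continuous_onI)
  note [measurable] = borel_measurable_integrable[OF add.hyps(1)] borel_measurable_integrable[OF add.hyps(2)]
  have "(\<integral>\<^sup>+x. norm (f x + g x - (f' x + g' x)) \<partial>lebesgue)
      \<le> (\<integral>\<^sup>+x. ennreal (norm (f x - f' x)) + ennreal (norm (g x - g' x)) \<partial>lebesgue)"
    by (intro nn_integral_mono)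
      (simp add: ennreal_plus[symmetric] ennreal_leI norm_diff_triangle_ineq del: ennreal_plus)
  also have "\<dots> = (\<integral>\<^sup>+x. norm (f x - f' x) \<partial>lebesgue) + (\<integral>\<^sup>+x. norm (g x - g' x) \<partial>lebesgue)"
    by (rule nn_integral_add) auto
  also have "\<dots> < ennreal (\<eta> / 2) + ennreal (\<eta> / 2)"
    using f'(3) g'(3) by (rule add_strict_mono)
  also have "\<dots> = ennreal \<eta>" using add.prems by (simp add: ennreal_plus[symmetric] del: ennreal_plus)
  finally show ?case
    using f'(1,2) g'(1,2) by (intro exI[of _ "\<lambda>x. f' x + g' x"])
      (auto intro: continuous_on_add bounded_plus_comp)
next
  case (lim f s)
  note [measurable] = borel_measurable_integrable[OF lim.hyps(1)] borel_measurable_integrable[OF lim.hyps(4)]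
  have "(\<lambda>i. \<integral>\<^sup>+x. norm (f x - s i x) \<partial>lebesgue) \<longlonglongrightarrow> 0"
  proof (rule nn_integral_dominated_convergence_norm[where w="\<lambda>x. 2 * norm (f x)"])
    show "(\<integral>\<^sup>+x. ennreal (2 * norm (f x)) \<partial>lebesgue) < \<infinity>"
    proof -
      have "integrable lebesgue (\<lambda>x. 2 * norm (f x))" using lim.hyps(4) by simp
      from integrableD(2)[OF this] show ?thesis by (simp add: less_top)
    qed
  qed (use lim.hyps(2,3) in auto)
  then have "eventually (\<lambda>i. (\<integral>\<^sup>+x. norm (f x - s i x) \<partial>lebesgue) < ennreal (\<eta> / 2)) sequentially"
    by (rule order_tendstoD) (use lim.prems in simp)
  then obtain i where i: "(\<integral>\<^sup>+x. norm (f x - s i x) \<partial>lebesgue) < ennreal (\<eta> / 2)"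
    by (auto simp: eventually_sequentially)
  obtain g where g: "continuous_on UNIV g" "bounded (range g)" "(\<integral>\<^sup>+x. norm (s i x - g x) \<partial>lebesgue) < ennreal (\<eta> / 2)"
    using lim.IH[of "\<eta> / 2" i] lim.prems by auto
  have [measurable]: "g \<in> borel_measurable lebesgue"
    using g(1) by (auto intro!: measurable_completion borel_measurable_continuous_onI)
  have "(\<integral>\<^sup>+x. norm (f x - g x) \<partial>lebesgue)
      \<le> (\<integral>\<^sup>+x. ennreal (norm (f x - s i x)) + ennreal (norm (s i x - g x)) \<partial>lebesgue)"
  proof (rule nn_integral_mono)
    fix x
    show "ennreal (norm (f x - g x)) \<le> ennreal (norm (f x - s i x)) + ennreal (norm (s i x - g x))"
      using norm_triangle_ineq[of "f x - s i x" "s i x - g x"]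
      by (simp add: ennreal_plus[symmetric] ennreal_leI del: ennreal_plus)
  qed
  also have "\<dots> = (\<integral>\<^sup>+x. norm (f x - s i x) \<partial>lebesgue) + (\<integral>\<^sup>+x. norm (s i x - g x) \<partial>lebesgue)"
    by (rule nn_integral_add) auto
  also have "\<dots> < ennreal (\<eta> / 2) + ennreal (\<eta> / 2)"
    using i g(3) by (rule add_strict_mono)
  also have "\<dots> = ennreal \<eta>" using lim.prems by (simp add: ennreal_plus[symmetric] del: ennreal_plus)
  finally show ?case using g(1,2) by blast
qed

section \<open>Scaling, positivity and finite mass of the mollifier\<close>

lemma newton_mollifier_scale:
  fixes x z :: "real^'n"
  assumes "\<epsilon> > 0"
  shows "newton_mollifier (\<epsilon>\<^sup>2) x (x + \<epsilon> *\<^sub>R z) * \<epsilon> ^ CARD('n) = newton_mollifier 1 0 z"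
proof -
  define n where "n = real CARD('n)"
  have "(\<epsilon>\<^sup>2 * (z \<bullet> z) + \<epsilon>\<^sup>2) powr (- 1 - n / 2) = (\<epsilon>\<^sup>2 * (z \<bullet> z + 1)) powr (- 1 - n / 2)"
    by (simp add: algebra_simps)
  also have "\<dots> = (\<epsilon>\<^sup>2) powr (- 1 - n / 2) * (z \<bullet> z + 1) powr (- 1 - n / 2)"
    by (rule powr_mult)
  also have "(\<epsilon>\<^sup>2) powr (- 1 - n / 2) = \<epsilon> powr (2 * (- 1 - n / 2))"
    using assms by (simp add: powr_powr flip: powr_numeral)
  finally have P: "(\<epsilon>\<^sup>2 * (z \<bullet> z) + \<epsilon>\<^sup>2) powr (- 1 - n / 2) = \<epsilon> powr (- 2 - n) * (z \<bullet> z + 1) powr (- 1 - n / 2)"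
    by simp
  \<comment> \<open>The powers of epsilon cancel: 2 from the factor e, -2 - n from the radial power,
    n from the volume element.\<close>
  have 1: "\<epsilon>\<^sup>2 * \<epsilon> powr (- 2 - n) * \<epsilon> ^ CARD('n) = 1"
    using assms by (simp add: n_def powr_diff powr_minus powr_realpow)
  have N: "newton_mollifier (\<epsilon>\<^sup>2) x (x + \<epsilon> *\<^sub>R z)
      = n * (n - 2) * \<epsilon>\<^sup>2 * (\<epsilon>\<^sup>2 * (z \<bullet> z) + \<epsilon>\<^sup>2) powr (- 1 - n / 2)"
    by (simp add: newton_mollifier_def n_def power2_eq_square mult.assoc)
  have "newton_mollifier (\<epsilon>\<^sup>2) x (x + \<epsilon> *\<^sub>R z) * \<epsilon> ^ CARD('n)
      = (\<epsilon>\<^sup>2 * \<epsilon> powr (- 2 - n) * \<epsilon> ^ CARD('n)) * (n * (n - 2) * (z \<bullet> z + 1) powr (- 1 - n / 2))"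
    unfolding N P by (simp only: mult_ac)
  also have "\<epsilon>\<^sup>2 * \<epsilon> powr (- 2 - n) * \<epsilon> ^ CARD('n) = 1" by (rule 1)
  finally show ?thesis by (simp add: newton_mollifier_def n_def)
qed

lemma newton_mollifier_nonneg:
  fixes x y :: "real^'n"
  assumes "CARD('n) \<ge> 2" "e \<ge> 0"
  shows "newton_mollifier e x y \<ge> 0"
  using assms by (auto simp: newton_mollifier_def intro!: mult_nonneg_nonneg)

lemma continuous_newton_mollifier:
  "e > 0 \<Longrightarrow> continuous_on UNIV (\<lambda>y. newton_mollifier e x y)"
  unfolding newton_mollifier_def
  by (intro continuous_intros) (metis add_nonneg_pos inner_ge_zero less_irrefl)

lemma newton_mollifier_commute: "newton_mollifier e x y = newton_mollifier e y x"
proof -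
  have "(y - x) \<bullet> (y - x) = (x - y) \<bullet> (x - y)"
    by (simp add: inner_diff_left inner_diff_right inner_commute)
  then show ?thesis by (simp add: newton_mollifier_def)
qed

text \<open>The constant kappa of the overview. It depends on the dimension only, hence the
  \<open>itself\<close> argument; \<open>nn_integral_newton_mollifier\<close> shows that every
  centre and scale gives the same value.\<close>

definition mollifier_mass :: "'n::finite itself \<Rightarrow> ennreal" where
  "mollifier_mass _ = (\<integral>\<^sup>+z. ennreal (newton_mollifier 1 0 (z :: real^'n)) \<partial>lborel)"

lemma mollifier_mass_pos:
  assumes "CARD('n::finite) \<ge> 3"
  shows "mollifier_mass TYPE('n) > 0"
proof (rule ccontr)
  assume "\<not> ?thesis"
  then have 0: "(\<integral>\<^sup>+z. ennreal (newton_mollifier 1 0 (z :: real^'n)) \<partial>lborel) = 0"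
    by (simp add: mollifier_mass_def)
  have [measurable]: "newton_mollifier 1 (0 :: real^'n) \<in> borel_measurable borel"
    using continuous_newton_mollifier[of 1 0] by (intro borel_measurable_continuous_onI) simp
  have "AE z in lborel. ennreal (newton_mollifier 1 0 (z :: real^'n)) = 0"
    using 0 by (subst (asm) nn_integral_0_iff_AE) auto
  moreover have "newton_mollifier 1 0 (z :: real^'n) > 0" for z
    using assms by (auto simp: newton_mollifier_def intro!: mult_pos_pos simp: add_nonneg_pos add_nonneg_eq_0_iff)
  ultimately have "AE z in lborel :: (real^'n) measure. False"
    by (simp add: ennreal_eq_0_iff not_le[symmetric])
  then have "emeasure lborel (UNIV :: (real^'n) set) = 0"
    by (simp add: AE_iff_measurable[OF _ refl])
  then show False by (simp add: emeasure_lborel_UNIV)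
qed

lemma member_le_suminf: "f j \<le> (\<Sum>j. f j)" for f :: "nat \<Rightarrow> ennreal"
  using sum_le_suminf[of f "{j}"] by simp

text \<open>The least j with |z| \<le> 2^(j + 1) satisfies 4^j \<le> |z|^2 + 1, so a single term of
  the series dominates the left-hand side. Balls in place of annuli are harmless for an upper bound
  and have a simple volume.\<close>

lemma powr_shell_bound:
  fixes z :: "'a::euclidean_space"
  assumes q: "q \<ge> 0"
  shows "ennreal ((z \<bullet> z + 1) powr - q) \<le> (\<Sum>j. ennreal (1 / (4 ^ j) powr q) * indicator (cball 0 (2 ^ Suc j)) z)"
proof -
  define P where "P j \<longleftrightarrow> norm z \<le> 2 ^ Suc j" for j
  obtain j0 where "norm z < 2 ^ j0" using real_arch_pow[of 2 "norm z"] by auto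
  then have "norm z \<le> 2 ^ Suc j0" by (rule order_trans[OF less_imp_le power_increasing]) auto
  then have P0: "P j0" by (simp add: P_def)
  define j where "j = (LEAST j. P j)"
  have j: "P j" unfolding j_def by (rule LeastI[of P, OF P0])
  have "4 ^ j \<le> z \<bullet> z + 1"
  proof (cases j)
    case (Suc i)
    then have "\<not> P i" using not_less_Least[of i P] j_def by simp
    then have "(2 ^ j)\<^sup>2 \<le> (norm z)\<^sup>2" by (intro power_mono) (auto simp: P_def Suc)
    moreover have "(2 ^ j)\<^sup>2 = (4 :: real) ^ j" by (simp add: power2_eq_square flip: power_mult_distrib)
    ultimately show ?thesis by (simp add: power2_norm_eq_inner)
  qed simp
  then have "(4 ^ j) powr q \<le> (z \<bullet> z + 1) powr q" by (intro powr_mono2 q) auto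
  then have "(z \<bullet> z + 1) powr - q \<le> 1 / (4 ^ j) powr q"
    unfolding powr_minus_divide by (intro divide_left_mono) (auto simp: add_nonneg_eq_0_iff)
  then have "ennreal ((z \<bullet> z + 1) powr - q) \<le> ennreal (1 / (4 ^ j) powr q) * indicator (cball 0 (2 ^ Suc j)) z"
    using j by (simp add: P_def ennreal_leI)
  also have "\<dots> \<le> (\<Sum>j. ennreal (1 / (4 ^ j) powr q) * indicator (cball 0 (2 ^ Suc j)) z)"
    by (rule member_le_suminf)
  finally show ?thesis .
qed

text \<open>The profile decays like |z|^(-n - 2), two powers better than the critical |z|^(-n): the
  ball of radius 2^(j + 1) contributes a constant times 4^(-j).\<close>

lemma mollifier_mass_finite: "mollifier_mass TYPE('n::finite) < \<infinity>"
proof -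
  define n where "n = CARD('n)"
  define q where "q = 1 + real n / 2"
  define V where "V = unit_ball_vol (real n)"
  have V: "V \<ge> 0" by (simp add: V_def)
  have pw: "(4 ^ j) powr q = 4 ^ j * (2 ^ j) ^ n" for j :: nat
  proof -
    have "(4 ^ j) powr q = 4 ^ j * (4 ^ j) powr (real n / 2)" by (simp add: q_def powr_add)
    also have "(4 ^ j) powr (real n / 2) = (2 powr real (2 * j)) powr (real n / 2)"
      unfolding powr_realpow[OF zero_less_numeral] by (simp add: power_mult)
    also have "\<dots> = 2 powr real (j * n)" by (simp add: powr_powr)
    also have "\<dots> = (2 ^ j) ^ n" unfolding powr_realpow[OF zero_less_numeral] by (simp add: power_mult)
    finally show ?thesis .
  qed
  define f :: "nat \<Rightarrow> real^'n \<Rightarrow> ennreal"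
    where "f j z = ennreal (1 / (4 ^ j) powr q) * indicator (cball 0 (2 ^ Suc j)) z" for j z
  have [measurable]: "f j \<in> borel_measurable lborel" for j
    unfolding f_def[abs_def] by (intro borel_measurable_times_ennreal borel_measurable_const borel_measurable_indicator) auto
  have "(\<integral>\<^sup>+z. ennreal (((z :: real^'n) \<bullet> z + 1) powr - q) \<partial>lborel) \<le> (\<integral>\<^sup>+z. (\<Sum>j. f j z) \<partial>lborel)"
    unfolding f_def by (intro nn_integral_mono powr_shell_bound) (simp add: q_def)
  also have "\<dots> = (\<Sum>j. \<integral>\<^sup>+z. f j z \<partial>lborel)"
    by (rule nn_integral_suminf) simp
  also have "\<dots> = (\<Sum>j. ennreal (V * 2 ^ n * (1 / 4) ^ j))"
  proof (rule suminf_cong)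
    fix j
    have "(\<integral>\<^sup>+z. f j z \<partial>lborel)
      = ennreal (1 / (4 ^ j) powr q) * ennreal (V * (2 ^ Suc j) ^ n)"
      unfolding f_def by (subst nn_integral_cmult_indicator) (simp_all add: emeasure_cball V_def n_def)
    also have "\<dots> = ennreal (1 / (4 ^ j) powr q * (V * (2 ^ Suc j) ^ n))"
      using V by (intro ennreal_mult[symmetric]) auto
    also have "1 / (4 ^ j) powr q * (V * (2 ^ Suc j) ^ n) = V * 2 ^ n * (1 / 4) ^ j"
    proof -
      have "(2 ^ Suc j) ^ n = 2 ^ n * (2 ^ j :: real) ^ n" by (simp add: power_mult_distrib)
      then show ?thesis unfolding pw by (simp add: power_one_over)
    qed
    finally show "(\<integral>\<^sup>+z. f j z \<partial>lborel)
      = ennreal (V * 2 ^ n * (1 / 4) ^ j)" .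
  qed
  also have "\<dots> < top"
    using V by (subst less_top[symmetric], intro ennreal_suminf_neq_top summable_mult summable_geometric) auto
  finally have fin: "(\<integral>\<^sup>+z. ennreal (((z :: real^'n) \<bullet> z + 1) powr - q) \<partial>lborel) < top" .
  have "mollifier_mass TYPE('n) = (\<integral>\<^sup>+z. ennreal (real n * (real n - 2)) * ennreal (((z :: real^'n) \<bullet> z + 1) powr - q) \<partial>lborel)"
    unfolding mollifier_mass_def newton_mollifier_def n_def[symmetric]
    by (intro nn_integral_cong, subst ennreal_mult''[symmetric]) (simp_all add: q_def)
  also have "\<dots> = ennreal (real n * (real n - 2)) * (\<integral>\<^sup>+z. ennreal (((z :: real^'n) \<bullet> z + 1) powr - q) \<partial>lborel)"
    by (rule nn_integral_cmult) simp
  also have "\<dots> < \<infinity>" using fin by (simp add: ennreal_mult_less_top)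
  finally show ?thesis .
qed

lemma nn_integral_lborel_affine:
  fixes f :: "'a::euclidean_space \<Rightarrow> ennreal"
  assumes [measurable]: "f \<in> borel_measurable borel" and c: "c \<noteq> 0"
  shows "(\<integral>\<^sup>+x. f x \<partial>lborel) = ennreal (\<bar>c\<bar> ^ DIM('a)) * (\<integral>\<^sup>+x. f (t + c *\<^sub>R x) \<partial>lborel)"
  by (subst lborel_affine[OF c, of t])
     (simp add: nn_integral_density nn_integral_distr nn_integral_cmult)

lemma lborel_integral_affine:
  fixes f :: "'a::euclidean_space \<Rightarrow> 'b::{banach, second_countable_topology}"
  assumes [measurable]: "f \<in> borel_measurable borel" and c: "c \<noteq> 0"
  shows "(\<integral>x. f x \<partial>lborel) = \<bar>c\<bar> ^ DIM('a) *\<^sub>R (\<integral>x. f (t + c *\<^sub>R x) \<partial>lborel)"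
  by (subst lborel_affine[OF c, of t]) (simp add: integral_density integral_distr)

lemma borel_measurable_newton_mollifier [measurable]:
  assumes "e > 0"
  shows "(\<lambda>y. newton_mollifier e x y) \<in> borel_measurable borel"
  using continuous_newton_mollifier[OF assms] by (intro borel_measurable_continuous_onI)

lemma nn_integral_newton_mollifier:
  fixes x :: "real^'n"
  assumes \<epsilon>: "\<epsilon> > 0" and n: "CARD('n) \<ge> 2"
  shows "(\<integral>\<^sup>+y. ennreal (newton_mollifier (\<epsilon>\<^sup>2) x y) \<partial>lborel) = mollifier_mass TYPE('n)"
proof -
  have e: "\<epsilon>\<^sup>2 > 0" using \<epsilon> by simp
  note [measurable] = borel_measurable_newton_mollifier[OF e]
  have "(\<integral>\<^sup>+y. ennreal (newton_mollifier (\<epsilon>\<^sup>2) x y) \<partial>lborel)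
    = ennreal (\<epsilon> ^ CARD('n)) * (\<integral>\<^sup>+z. ennreal (newton_mollifier (\<epsilon>\<^sup>2) x (x + \<epsilon> *\<^sub>R z)) \<partial>lborel)"
    by (subst nn_integral_lborel_affine[where c=\<epsilon> and t=x]) (use \<epsilon> in auto)
  also have "\<dots> = (\<integral>\<^sup>+z. ennreal (newton_mollifier 1 0 (z :: real^'n)) \<partial>lborel)"
  proof -
    have "(\<lambda>z. ennreal (newton_mollifier (\<epsilon>\<^sup>2) x (x + \<epsilon> *\<^sub>R z))) \<in> borel_measurable lborel"
      using measurable_compose[OF _ borel_measurable_newton_mollifier[OF e, of x], of "\<lambda>z. x + \<epsilon> *\<^sub>R z" borel]
      by simp
    moreover have "ennreal (\<epsilon> ^ CARD('n)) * ennreal (newton_mollifier (\<epsilon>\<^sup>2) x (x + \<epsilon> *\<^sub>R z))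
        = ennreal (newton_mollifier 1 0 z)" for z
      using \<epsilon> newton_mollifier_nonneg[OF n, of "\<epsilon>\<^sup>2" x] newton_mollifier_scale[OF \<epsilon>, of x z]
      by (subst ennreal_mult[symmetric]) (simp_all add: mult.commute)
    ultimately show ?thesis by (subst nn_integral_cmult[symmetric]) simp_all
  qed
  finally show ?thesis by (simp add: mollifier_mass_def)
qed

lemma nn_integral_lebesgue_newton_mollifier:
  fixes x :: "real^'n"
  assumes \<epsilon>: "\<epsilon> > 0" and n: "CARD('n) \<ge> 2"
  shows "(\<integral>\<^sup>+y. ennreal (newton_mollifier (\<epsilon>\<^sup>2) x y) \<partial>lebesgue) = mollifier_mass TYPE('n)"
  using nn_integral_newton_mollifier[OF assms] by (simp add: nn_integral_completion)

lemma measurable_newton_mollifier_pair [measurable]: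
  assumes "e > 0"
  shows "(\<lambda>(x :: real^'n, y). newton_mollifier e x y) \<in> borel_measurable (lebesgue \<Otimes>\<^sub>M lebesgue)"
  unfolding newton_mollifier_def split_def by measurable

section \<open>Mollification and its limit\<close>

definition mollify :: "real \<Rightarrow> (real^'n \<Rightarrow> complex) \<Rightarrow> real^'n \<Rightarrow> complex" where
  "mollify \<epsilon> w x = (LINT y|lebesgue. newton_mollifier (\<epsilon>\<^sup>2) x y *\<^sub>R w y)"

lemma newton_mollifier_bounded:
  fixes x y :: "real^'n"
  assumes e: "e > 0"
  shows "\<bar>newton_mollifier e x y\<bar> \<le> \<bar>real CARD('n) * (real CARD('n) - 2) * e * e powr (- 1 - CARD('n) / 2)\<bar>"
proof -
  have "((y - x) \<bullet> (y - x) + e) powr (- 1 - CARD('n) / 2) \<le> e powr (- 1 - CARD('n) / 2)"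
    by (rule powr_mono2') (use e in auto)
  then show ?thesis
    using e by (auto simp: newton_mollifier_def abs_mult mult_left_mono)
qed

lemma integrable_newton_mollifier_mult:
  fixes w :: "real^'n \<Rightarrow> complex"
  assumes e: "e > 0" and w: "integrable lebesgue w"
  shows "integrable lebesgue (\<lambda>y. newton_mollifier e x y *\<^sub>R w y)"
proof (rule Bochner_Integration.integrable_bound)
  define B where "B = real CARD('n) * (real CARD('n) - 2) * e * e powr (- 1 - CARD('n) / 2)"
  show "integrable lebesgue (\<lambda>y. B *\<^sub>R w y)" using w by simp
  have [measurable]: "newton_mollifier e x \<in> borel_measurable lebesgue"
    using borel_measurable_newton_mollifier[OF e] by (intro measurable_completion) simp
  note [measurable] = borel_measurable_integrable[OF w]
  show "(\<lambda>y. newton_mollifier e x y *\<^sub>R w y) \<in> borel_measurable lebesgue" by measurable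
  show "AE y in lebesgue. norm (newton_mollifier e x y *\<^sub>R w y) \<le> norm (B *\<^sub>R w y)"
    using newton_mollifier_bounded[OF e, of x]
    unfolding B_def[symmetric] by (intro AE_I2) (auto intro!: mult_right_mono)
qed

text \<open>The substitution y = x + epsilon z turns the kernel into a fixed integrable profile of
  mass kappa and moves epsilon into the argument of g. Continuity and the bound G then give the
  limit kappa g by dominated convergence.\<close>

lemma mollify_continuous_tendsto:
  fixes g :: "real^'n \<Rightarrow> complex"
  assumes n: "CARD('n) \<ge> 2" and g: "continuous_on UNIV g" and G: "\<And>x. norm (g x) \<le> G"
  defines "\<kappa> \<equiv> enn2real (mollifier_mass TYPE('n))"
  shows "\<epsilon> > 0 \<Longrightarrow> norm (mollify \<epsilon> g x) \<le> \<kappa> * G"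
    and "\<epsilon> > 0 \<Longrightarrow> integrable lebesgue (\<lambda>y. newton_mollifier (\<epsilon>\<^sup>2) x y *\<^sub>R g y)"
    and "\<epsilon> > 0 \<Longrightarrow> mollify \<epsilon> g \<in> borel_measurable lebesgue"
    and "(\<lambda>j. mollify (1 / Suc j) g x) \<longlonglongrightarrow> \<kappa> *\<^sub>R g x"
proof -
  let ?K = "\<lambda>z :: real^'n. newton_mollifier 1 0 z"
  have [measurable]: "g \<in> borel_measurable borel"
    using g by (rule borel_measurable_continuous_onI)
  have [measurable]: "?K \<in> borel_measurable borel"
    using borel_measurable_newton_mollifier[of 1 0] by simp
  have K0: "?K z \<ge> 0" for z by (rule newton_mollifier_nonneg[OF n]) simp
  have Kint: "integrable lborel ?K"
    using mollifier_mass_finite[where 'n='n] K0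
    by (intro integrableI_nonneg) (auto simp: mollifier_mass_def)
  have \<kappa>: "\<kappa> = (LINT z|lborel. ?K z)"
    unfolding \<kappa>_def mollifier_mass_def using Kint K0 by (subst integral_eq_nn_integral) auto
  have Kg: "integrable lborel (\<lambda>z. ?K z *\<^sub>R g (x + \<epsilon> *\<^sub>R z))" for x \<epsilon>
  proof (rule Bochner_Integration.integrable_bound)
    show "integrable lborel (\<lambda>z. ?K z * G)" using Kint by simp
    show "AE z in lborel. norm (?K z *\<^sub>R g (x + \<epsilon> *\<^sub>R z)) \<le> norm (?K z * G)"
      using K0 by (intro AE_I2) (auto simp: abs_mult intro!: mult_left_mono order_trans[OF G])
  qed simp
  have eq: "mollify \<epsilon> g x = (LINT z|lborel. ?K z *\<^sub>R g (x + \<epsilon> *\<^sub>R z))"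
    and int: "integrable lebesgue (\<lambda>y. newton_mollifier (\<epsilon>\<^sup>2) x y *\<^sub>R g y)" if \<epsilon>: "\<epsilon> > 0" for \<epsilon> x
  proof -
    have [measurable]: "(\<lambda>y. newton_mollifier (\<epsilon>\<^sup>2) x y) \<in> borel_measurable borel"
      by (rule borel_measurable_newton_mollifier) (use \<epsilon> in simp)
    have "mollify \<epsilon> g x = (LINT y|lborel. newton_mollifier (\<epsilon>\<^sup>2) x y *\<^sub>R g y)"
      unfolding mollify_def by (rule integral_completion) simp
    also have "\<dots> = \<bar>\<epsilon>\<bar> ^ CARD('n) *\<^sub>R (LINT z|lborel. newton_mollifier (\<epsilon>\<^sup>2) x (x + \<epsilon> *\<^sub>R z) *\<^sub>R g (x + \<epsilon> *\<^sub>R z))"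
      by (subst lborel_integral_affine[where c=\<epsilon> and t=x]) (use \<epsilon> in auto)
    also have "\<dots> = (LINT z|lborel. (newton_mollifier (\<epsilon>\<^sup>2) x (x + \<epsilon> *\<^sub>R z) * \<epsilon> ^ CARD('n)) *\<^sub>R g (x + \<epsilon> *\<^sub>R z))"
      using \<epsilon> by (subst integral_scaleR_right[symmetric]) (simp add: mult.commute)
    finally show "mollify \<epsilon> g x = (LINT z|lborel. ?K z *\<^sub>R g (x + \<epsilon> *\<^sub>R z))"
      by (simp add: newton_mollifier_scale[OF \<epsilon>])
    have "integrable lborel (\<lambda>y. newton_mollifier (\<epsilon>\<^sup>2) x y *\<^sub>R g y)"
    proof (rule Bochner_Integration.integrable_bound)
      have "integrable lborel (\<lambda>y. newton_mollifier (\<epsilon>\<^sup>2) x y)"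
        using mollifier_mass_finite[where 'n='n] nn_integral_newton_mollifier[OF \<epsilon> n, of x]
          newton_mollifier_nonneg[OF n, of "\<epsilon>\<^sup>2" x]
        by (intro integrableI_nonneg) auto
      then show "integrable lborel (\<lambda>y. newton_mollifier (\<epsilon>\<^sup>2) x y * G)" by simp
      show "AE y in lborel. norm (newton_mollifier (\<epsilon>\<^sup>2) x y *\<^sub>R g y) \<le> norm (newton_mollifier (\<epsilon>\<^sup>2) x y * G)"
        by (intro AE_I2) (auto simp: abs_mult intro!: mult_left_mono order_trans[OF G])
    qed simp
    then show "integrable lebesgue (\<lambda>y. newton_mollifier (\<epsilon>\<^sup>2) x y *\<^sub>R g y)"
      by (subst integrable_completion) auto
  qed
  show "integrable lebesgue (\<lambda>y. newton_mollifier (\<epsilon>\<^sup>2) x y *\<^sub>R g y)" if "\<epsilon> > 0" by (rule int[OF that])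
  show "norm (mollify \<epsilon> g x) \<le> \<kappa> * G" if "\<epsilon> > 0"
  proof -
    have "norm (mollify \<epsilon> g x) \<le> (LINT z|lborel. norm (?K z *\<^sub>R g (x + \<epsilon> *\<^sub>R z)))"
      unfolding eq[OF that] by (rule integral_norm_bound)
    also have "\<dots> \<le> (LINT z|lborel. ?K z * G)"
      using K0 Kint integrable_norm[OF Kg] by (intro integral_mono) (auto intro!: mult_left_mono G)
    finally show ?thesis by (simp add: \<kappa>)
  qed
  show "mollify \<epsilon> g \<in> borel_measurable lebesgue" if "\<epsilon> > 0"
  proof -
    have "(\<lambda>x. LINT z|lborel. ?K z *\<^sub>R g (x + \<epsilon> *\<^sub>R z)) \<in> borel_measurable lborel"
      by (rule lborel.borel_measurable_lebesgue_integral) simp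
    then show ?thesis unfolding eq[OF that, abs_def] by (rule measurable_completion)
  qed
  have "(\<lambda>j. LINT z|lborel. ?K z *\<^sub>R g (x + (1 / Suc j) *\<^sub>R z)) \<longlonglongrightarrow> (LINT z|lborel. ?K z *\<^sub>R g x)"
  proof (rule integral_dominated_convergence)
    show "integrable lborel (\<lambda>z. ?K z * G)" using Kint by simp
    show "AE z in lborel. norm (?K z *\<^sub>R g (x + (1 / Suc j) *\<^sub>R z)) \<le> ?K z * G" for j
      using K0 by (intro AE_I2) (auto intro!: mult_left_mono G)
    show "AE z in lborel. (\<lambda>j. ?K z *\<^sub>R g (x + (1 / Suc j) *\<^sub>R z)) \<longlonglongrightarrow> ?K z *\<^sub>R g x"
    proof (intro AE_I2 tendsto_scaleR tendsto_const)
      fix z :: "real^'n"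
      have "(\<lambda>j. x + (1 / Suc j) *\<^sub>R z) \<longlonglongrightarrow> x + 0 *\<^sub>R z"
        by (intro tendsto_intros LIMSEQ_Suc lim_1_over_n)
      then show "(\<lambda>j. g (x + (1 / Suc j) *\<^sub>R z)) \<longlonglongrightarrow> g x"
        using continuous_on_tendsto_compose[OF g] by simp
    qed
  qed auto
  also have "(LINT z|lborel. ?K z *\<^sub>R g x) = \<kappa> *\<^sub>R g x"
    unfolding \<kappa> by (rule integral_scaleR_left) (rule Kint)
  finally show "(\<lambda>j. mollify (1 / Suc j) g x) \<longlonglongrightarrow> \<kappa> *\<^sub>R g x"
    by (simp add: eq)
qed

lemma ennreal_minus_le_of_le_add: "a \<noteq> top \<Longrightarrow> a \<le> b + c \<Longrightarrow> a - c \<le> (b :: ennreal)"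
  by (simp add: ennreal_minus_le_iff add.commute)

text \<open>For bounded continuous g the mollifications converge to kappa g. Replacing w by such a g
  at L^1 distance below eta costs kappa eta in the limit and, by Tonelli, kappa eta in the
  mollification, uniformly in epsilon. The excess of kappa |w| over J thus has integral at most 2
  kappa eta on each ball, for every eta. Balls provide the finite measure needed for dominated
  convergence.\<close>

lemma AE_le_of_mollify_le:
  fixes w :: "real^'n \<Rightarrow> complex" and J :: "real^'n \<Rightarrow> ennreal"
  assumes n: "CARD('n) \<ge> 2" and w: "integrable lebesgue w" and J[measurable]: "J \<in> borel_measurable lebesgue"
    and le: "\<And>\<epsilon> x. \<epsilon> > 0 \<Longrightarrow> ennreal (norm (mollify \<epsilon> w x)) \<le> J x"
  shows "AE x in lebesgue. mollifier_mass TYPE('n) * ennreal (norm (w x)) \<le> J x"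
proof -
  define \<kappa> where "\<kappa> = enn2real (mollifier_mass TYPE('n))"
  have \<kappa>: "mollifier_mass TYPE('n) = ennreal \<kappa>" "\<kappa> \<ge> 0"
    using mollifier_mass_finite[where 'n='n] by (auto simp: \<kappa>_def)
  note [measurable] = borel_measurable_integrable[OF w]
  have "AE x in lebesgue. x \<in> ball 0 (real R) \<longrightarrow> ennreal \<kappa> * ennreal (norm (w x)) \<le> J x" for R :: nat
  proof -
    define B where "B = ball (0 :: real^'n) (real R)"
    have [measurable]: "B \<in> sets lebesgue" by (simp add: B_def)
    have Bfin: "emeasure lebesgue B < \<infinity>" unfolding B_def using emeasure_bounded_finite[OF bounded_ball] by simp
    \<comment> \<open>Truncated subtraction: D is the excess over J and is 0 wherever the inequality
      holds, also at points with J infinite.\<close>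
    define D where "D x = ennreal \<kappa> * ennreal (norm (w x)) - J x" for x
    have [measurable]: "D \<in> borel_measurable lebesgue" unfolding D_def[abs_def] by measurable
    have small: "(\<integral>\<^sup>+x\<in>B. D x \<partial>lebesgue) \<le> ennreal (2 * \<kappa> * \<eta>)" if \<eta>: "\<eta> > 0" for \<eta>
    proof -
      obtain g G where g: "continuous_on UNIV g" "\<And>x. norm (g x) \<le> G"
        and wg: "(\<integral>\<^sup>+x. norm (w x - g x) \<partial>lebesgue) < ennreal \<eta>"
        using integrable_approx_bounded_continuous[OF w \<eta>] by (auto simp: bounded_iff)
      have [measurable]: "g \<in> borel_measurable lebesgue"
        using g(1) by (auto intro!: measurable_completion borel_measurable_continuous_onI)
      define E where "E j x = norm (\<kappa> *\<^sub>R g x - mollify (1 / Suc j) g x)" for j x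
      define H where "H \<epsilon> x = (\<integral>\<^sup>+y. ennreal (newton_mollifier (\<epsilon>\<^sup>2) x y) * ennreal (norm (w y - g y)) \<partial>lebesgue)" for \<epsilon> x
      have [measurable]: "mollify (1 / Suc j) g \<in> borel_measurable lebesgue" for j
        by (rule mollify_continuous_tendsto(3)[OF n g]) simp
      have Emeas [measurable]: "(\<lambda>x. E j x) \<in> borel_measurable lebesgue" for j
        unfolding E_def by measurable
      have HP: "(\<lambda>p. ennreal (newton_mollifier (\<epsilon>\<^sup>2) (fst p) (snd p)) * ennreal (norm (w (snd p) - g (snd p))))
          \<in> borel_measurable (lebesgue \<Otimes>\<^sub>M lebesgue)" if "\<epsilon> > 0" for \<epsilon>
      proof -
        have "(\<lambda>y. ennreal (norm (w y - g y))) \<in> borel_measurable lebesgue" by simp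
        from measurable_compose[OF measurable_snd this]
        have "(\<lambda>p. ennreal (norm (w (snd p) - g (snd p)))) \<in> borel_measurable (lebesgue \<Otimes>\<^sub>M lebesgue)" .
        moreover have "(\<lambda>p. ennreal (newton_mollifier (\<epsilon>\<^sup>2) (fst p :: real^'n) (snd p))) \<in> borel_measurable (lebesgue \<Otimes>\<^sub>M lebesgue)"
          using measurable_newton_mollifier_pair[of "\<epsilon>\<^sup>2"] that
          by (intro measurable_compose[OF _ measurable_ennreal]) (simp add: split_def)
        ultimately show ?thesis by (intro borel_measurable_times_ennreal)
      qed
      have Hmeas [measurable]: "H \<epsilon> \<in> borel_measurable lebesgue" if "\<epsilon> > 0" for \<epsilon>
        unfolding H_def[abs_def] using HP[OF that]
        by (intro lebesgue.borel_measurable_nn_integral) (simp add: split_def)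
      have H: "(\<integral>\<^sup>+x. H \<epsilon> x \<partial>lebesgue) \<le> ennreal (\<kappa> * \<eta>)" if \<epsilon>: "\<epsilon> > 0" for \<epsilon>
      proof -
        have e: "\<epsilon>\<^sup>2 > 0" using \<epsilon> by simp
        have [measurable]: "newton_mollifier (\<epsilon>\<^sup>2) y \<in> borel_measurable lebesgue" for y :: "real^'n"
          using borel_measurable_newton_mollifier[OF e, of y] by (intro measurable_completion) simp
        have "(\<integral>\<^sup>+x. H \<epsilon> x \<partial>lebesgue)
          = (\<integral>\<^sup>+y. \<integral>\<^sup>+x. ennreal (newton_mollifier (\<epsilon>\<^sup>2) x y) * ennreal (norm (w y - g y)) \<partial>lebesgue \<partial>lebesgue)"
          unfolding H_def by (rule lebesgue_pair.Fubini'[symmetric]) (use HP[OF \<epsilon>] in \<open>simp add: split_def\<close>)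
        \<comment> \<open>After Tonelli the kernel is integrated in its first argument; by symmetry
          this gives the same mass.\<close>
        also have "\<dots> = (\<integral>\<^sup>+y. mollifier_mass TYPE('n) * ennreal (norm (w y - g y)) \<partial>lebesgue)"
          by (intro nn_integral_cong)
            (simp add: nn_integral_multc newton_mollifier_commute[of _ _ "_ :: real^'n"]
              nn_integral_lebesgue_newton_mollifier[OF \<epsilon> n] flip: newton_mollifier_commute)
        also have "\<dots> = ennreal \<kappa> * (\<integral>\<^sup>+y. ennreal (norm (w y - g y)) \<partial>lebesgue)"
          unfolding \<kappa>(1) by (rule nn_integral_cmult) simp
        also have "\<dots> \<le> ennreal \<kappa> * ennreal \<eta>" using wg by (intro mult_left_mono) auto
        finally show ?thesis using \<kappa>(2) \<eta> by (simp add: ennreal_mult)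
      qed
      have D: "D x \<le> ennreal \<kappa> * ennreal (norm (w x - g x)) + (ennreal (E j x) + H (1 / Suc j) x)" for x j
      proof -
        define \<epsilon> where "\<epsilon> = 1 / real (Suc j)"
        have \<epsilon>: "\<epsilon> > 0" and e: "\<epsilon>\<^sup>2 > 0" by (auto simp: \<epsilon>_def)
        have int_w: "integrable lebesgue (\<lambda>y. newton_mollifier (\<epsilon>\<^sup>2) x y *\<^sub>R w y)"
          by (rule integrable_newton_mollifier_mult[OF e w])
        have int_g: "integrable lebesgue (\<lambda>y. newton_mollifier (\<epsilon>\<^sup>2) x y *\<^sub>R g y)"
          by (rule mollify_continuous_tendsto(2)[OF n g \<epsilon>])
        have "ennreal (norm (mollify \<epsilon> g x - mollify \<epsilon> w x)) \<le> H \<epsilon> x"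
        proof -
          have "mollify \<epsilon> g x - mollify \<epsilon> w x = (LINT y|lebesgue. newton_mollifier (\<epsilon>\<^sup>2) x y *\<^sub>R g y - newton_mollifier (\<epsilon>\<^sup>2) x y *\<^sub>R w y)"
            unfolding mollify_def by (rule Bochner_Integration.integral_diff[OF int_g int_w, symmetric])
          then have "ennreal (norm (mollify \<epsilon> g x - mollify \<epsilon> w x))
            \<le> (\<integral>\<^sup>+y. ennreal (norm (newton_mollifier (\<epsilon>\<^sup>2) x y *\<^sub>R g y - newton_mollifier (\<epsilon>\<^sup>2) x y *\<^sub>R w y)) \<partial>lebesgue)"
            using integral_norm_bound_ennreal[OF Bochner_Integration.integrable_diff[OF int_g int_w]] by simp
          also have "\<dots> = H \<epsilon> x"
            unfolding H_def using newton_mollifier_nonneg[OF n, of "\<epsilon>\<^sup>2" x]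
            by (intro nn_integral_cong)
              (simp add: scaleR_diff_right[symmetric] norm_minus_commute ennreal_mult)
          finally show ?thesis .
        qed
        moreover have "ennreal (norm (mollify \<epsilon> w x)) \<le> J x" by (rule le[OF \<epsilon>])
        moreover have "\<kappa> * norm (w x) \<le> \<kappa> * norm (w x - g x) + (E j x + norm (mollify \<epsilon> g x - mollify \<epsilon> w x)) + norm (mollify \<epsilon> w x)"
        proof -
          have "\<kappa> *\<^sub>R w x = \<kappa> *\<^sub>R (w x - g x) + (\<kappa> *\<^sub>R g x - mollify \<epsilon> g x) + (mollify \<epsilon> g x - mollify \<epsilon> w x) + mollify \<epsilon> w x"
            by (simp add: scaleR_diff_right)
          also have "norm \<dots> \<le> norm (\<kappa> *\<^sub>R (w x - g x)) + norm (\<kappa> *\<^sub>R g x - mollify \<epsilon> g x) + norm (mollify \<epsilon> g x - mollify \<epsilon> w x) + norm (mollify \<epsilon> w x)"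
            by (intro norm_triangle_mono order_refl)
          finally show ?thesis using \<kappa>(2) by (simp add: E_def \<epsilon>_def)
        qed
        then have "ennreal \<kappa> * ennreal (norm (w x)) \<le> ennreal \<kappa> * ennreal (norm (w x - g x)) +
          (ennreal (E j x) + ennreal (norm (mollify \<epsilon> g x - mollify \<epsilon> w x))) + ennreal (norm (mollify \<epsilon> w x))"
          using \<kappa>(2) by (simp add: E_def ennreal_mult[symmetric] ennreal_plus[symmetric] ennreal_leI del: ennreal_plus)
        ultimately have "ennreal \<kappa> * ennreal (norm (w x)) \<le> (ennreal \<kappa> * ennreal (norm (w x - g x)) +
          (ennreal (E j x) + H \<epsilon> x)) + J x"
          by (meson add_mono order_refl order_trans)
        then show ?thesis unfolding D_def \<epsilon>_def[symmetric] by (rule ennreal_minus_le_of_le_add[rotated]) (simp add: ennreal_mult_eq_top_iff)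
      qed
      have bound: "(\<integral>\<^sup>+x\<in>B. D x \<partial>lebesgue) \<le> ennreal (2 * \<kappa> * \<eta>) + (\<integral>\<^sup>+x. ennreal (E j x) * indicator B x \<partial>lebesgue)" for j
      proof -
        have "(\<integral>\<^sup>+x\<in>B. D x \<partial>lebesgue) \<le> (\<integral>\<^sup>+x. ennreal \<kappa> * ennreal (norm (w x - g x)) +
            (ennreal (E j x) * indicator B x + H (1 / Suc j) x) \<partial>lebesgue)"
          using D[of _ j] by (intro nn_integral_mono) (auto simp: indicator_def)
        also have "\<dots> = ennreal \<kappa> * (\<integral>\<^sup>+x. ennreal (norm (w x - g x)) \<partial>lebesgue) +
            ((\<integral>\<^sup>+x. ennreal (E j x) * indicator B x \<partial>lebesgue) + (\<integral>\<^sup>+x. H (1 / Suc j) x \<partial>lebesgue))"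
          using Hmeas[of "1 / Suc j"] by (simp add: nn_integral_add nn_integral_cmult)
        also have "\<dots> \<le> ennreal \<kappa> * ennreal \<eta> + ((\<integral>\<^sup>+x. ennreal (E j x) * indicator B x \<partial>lebesgue) + ennreal (\<kappa> * \<eta>))"
          using wg H[of "1 / Suc j"] by (intro add_mono mult_left_mono) auto
        also have "\<dots> = ennreal (2 * \<kappa> * \<eta>) + (\<integral>\<^sup>+x. ennreal (E j x) * indicator B x \<partial>lebesgue)"
          using \<kappa>(2) \<eta> by (simp add: ennreal_mult[symmetric] ennreal_plus[symmetric] add.left_commute add.commute del: ennreal_plus)
        finally show ?thesis .
      qed
      have lim: "(\<lambda>j. \<integral>\<^sup>+x. ennreal (E j x) * indicator B x \<partial>lebesgue) \<longlonglongrightarrow> (\<integral>\<^sup>+x. 0 \<partial>(lebesgue :: (real^'n) measure))"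
      proof (rule nn_integral_dominated_convergence[where w="\<lambda>x. ennreal (2 * \<kappa> * G) * indicator B x"])
        have E_le: "E j x \<le> \<kappa> * G + \<kappa> * G" for j x
          unfolding E_def
          using \<kappa>(2) mollify_continuous_tendsto(1)[OF n g, of "1 / Suc j" x]
          by (intro norm_triangle_le_diff add_mono) (auto intro!: mult_left_mono g(2) simp: \<kappa>_def)
        have "E j x \<le> 2 * \<kappa> * G" for j x using E_le[of j x] by (simp add: mult.commute mult.left_commute)
        then show "AE x in lebesgue. ennreal (E j x) * indicator B x \<le> ennreal (2 * \<kappa> * G) * indicator B x" for j
          by (intro AE_I2 mult_right_mono ennreal_leI) auto
        show "(\<integral>\<^sup>+x. ennreal (2 * \<kappa> * G) * indicator B x \<partial>lebesgue) < \<infinity>"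
          using Bfin by (subst nn_integral_cmult_indicator) (auto simp: ennreal_mult_less_top)
        show "AE x in lebesgue. (\<lambda>j. ennreal (E j x) * indicator B x) \<longlonglongrightarrow> 0"
        proof (rule AE_I2)
          fix x
          have "(\<lambda>j. E j x) \<longlonglongrightarrow> norm (\<kappa> *\<^sub>R g x - \<kappa> *\<^sub>R g x)"
            unfolding E_def \<kappa>_def by (intro tendsto_intros mollify_continuous_tendsto(4)[OF n g])
          then have "(\<lambda>j. ennreal (E j x)) \<longlonglongrightarrow> ennreal 0" by (intro tendsto_ennrealI) simp
          then show "(\<lambda>j. ennreal (E j x) * indicator B x) \<longlonglongrightarrow> 0"
            by (cases "x \<in> B") simp_all
        qed
      qed auto
      have "(\<lambda>j. ennreal (2 * \<kappa> * \<eta>) + (\<integral>\<^sup>+x. ennreal (E j x) * indicator B x \<partial>lebesgue)) \<longlonglongrightarrow> ennreal (2 * \<kappa> * \<eta>) + (\<integral>\<^sup>+x. 0 \<partial>(lebesgue :: (real^'n) measure))"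
        by (intro tendsto_add tendsto_const lim)
      then have "(\<integral>\<^sup>+x\<in>B. D x \<partial>lebesgue) \<le> ennreal (2 * \<kappa> * \<eta>) + (\<integral>\<^sup>+x. 0 \<partial>(lebesgue :: (real^'n) measure))"
        by (rule LIMSEQ_le_const) (use bound in auto)
      then show ?thesis by simp
    qed
    have "(\<integral>\<^sup>+x\<in>B. D x \<partial>lebesgue) \<le> 0"
    proof (rule ennreal_le_epsilon)
      \<comment> \<open>The choice eta = e / (2 kappa + 1) gives 2 kappa eta \<le> e and stays
        meaningful for kappa = 0.\<close>
      fix e :: real assume "e > 0"
      have "(\<integral>\<^sup>+x\<in>B. D x \<partial>lebesgue) \<le> ennreal (2 * \<kappa> * (e / (2 * \<kappa> + 1)))"
        using \<open>e > 0\<close> \<kappa>(2) by (intro small) (simp add: add_nonneg_pos)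
      also have "\<dots> \<le> ennreal e"
        using \<open>e > 0\<close> \<kappa>(2) by (intro ennreal_leI) (simp add: field_simps add_nonneg_pos)
      finally show "(\<integral>\<^sup>+x\<in>B. D x \<partial>lebesgue) \<le> 0 + ennreal e" by simp
    qed
    then have "AE x in lebesgue. D x * indicator B x = 0"
      by (subst (asm) le_zero_eq, subst (asm) nn_integral_0_iff_AE) auto
    then show ?thesis
      by eventually_elim (auto simp: D_def B_def[symmetric] diff_eq_0_iff_ennreal ennreal_mult_eq_top_iff)
  qed
  then have "AE x in lebesgue. \<forall>R :: nat. x \<in> ball 0 (real R) \<longrightarrow> ennreal \<kappa> * ennreal (norm (w x)) \<le> J x"
    by (intro AE_all_countable[THEN iffD2] allI)
  then show ?thesis
  proof eventually_elim
    case (elim x)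
    obtain R :: nat where "norm x < real R" using reals_Archimedean2 by blast
    then show ?case using elim by (auto simp: \<kappa>(1))
  qed
qed

subsection \<open>Weak derivatives\<close>

lemma integrable_mult_continuous_compact:
  fixes f \<phi> :: "real^'n \<Rightarrow> complex"
  assumes f: "locally_integrable f" and \<phi>: "continuous_on UNIV \<phi>"
    and K: "compact K" "\<And>x. x \<notin> K \<Longrightarrow> \<phi> x = 0"
  shows "integrable lebesgue (\<lambda>x. f x * \<phi> x)"
proof -
  have fK: "integrable lebesgue (\<lambda>x. indicator K x *\<^sub>R f x)"
    using f K(1) by (auto simp: locally_integrable_def set_integrable_def)
  note [measurable] = borel_measurable_integrable[OF fK]
  have [measurable]: "\<phi> \<in> borel_measurable lebesgue"
    using \<phi> by (auto intro!: measurable_completion borel_measurable_continuous_onI)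
  have "bounded (\<phi> ` K)"
    by (intro compact_imp_bounded compact_continuous_image continuous_on_subset[OF \<phi>] K) auto
  then obtain M where M: "\<And>x. x \<in> K \<Longrightarrow> norm (\<phi> x) \<le> M" by (auto simp: bounded_iff)
  have "integrable lebesgue (\<lambda>x. (indicator K x *\<^sub>R f x) * \<phi> x)"
  proof (rule Bochner_Integration.integrable_bound)
    show "integrable lebesgue (\<lambda>x. M *\<^sub>R (indicator K x *\<^sub>R f x))"
      by (rule integrable_scaleR_right) (rule fK)
    show "AE x in lebesgue. norm ((indicator K x *\<^sub>R f x) * \<phi> x) \<le> norm (M *\<^sub>R (indicator K x *\<^sub>R f x))"
    proof (rule AE_I2)
      fix x
      show "norm ((indicator K x *\<^sub>R f x) * \<phi> x) \<le> norm (M *\<^sub>R (indicator K x *\<^sub>R f x))"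
        using M[of x] norm_ge_zero[of "\<phi> x"]
        by (cases "x \<in> K") (auto simp: norm_mult mult.commute intro!: mult_right_mono)
    qed
  qed measurable
  also have "(\<lambda>x. (indicator K x *\<^sub>R f x) * \<phi> x) = (\<lambda>x. f x * \<phi> x)"
    using K(2) by (auto simp: indicator_def fun_eq_iff)
  finally show ?thesis .
qed

lemma partial_derivs_zero: "partial_derivs is (\<lambda>_ :: real^'n. 0) = (\<lambda>_. 0)"
proof (induction "is")
  case (Cons i "is")
  have "partial_deriv i (\<lambda>_ :: real^'n. 0) = (\<lambda>_. 0)"
    by (rule ext, subst partial_deriv_eqI[OF has_derivative_const]) simp
  then show ?case using Cons by (simp add: partial_derivs_def)
qed (simp add: partial_derivs_def)

context
  fixes b :: "real^'n" and R :: real and \<psi> \<phi> :: "real^'n \<Rightarrow> complex"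
  assumes R: "R > 0" and \<psi>: "\<psi> \<in> elementary"
  defines "\<phi> \<equiv> \<lambda>y. complex_of_real (cutoff b R y) * \<psi> y"
begin

lemma partial_derivs_cutoff_outside:
  assumes "y \<notin> cball b (sqrt (2 * R))"
  shows "partial_derivs is \<phi> y = 0"
proof -
  have "partial_derivs is \<phi> y = partial_derivs is (\<lambda>_. 0) y"
  proof (rule partial_derivs_cong_open[where U="- cball b (sqrt (2 * R))"])
    fix z assume "z \<in> - cball b (sqrt (2 * R))"
    then have "sqrt (2 * R) < sqrt ((z - b) \<bullet> (z - b))"
      by (simp add: dist_norm norm_eq_sqrt_inner[symmetric] norm_minus_commute)
    then show "\<phi> z = 0" using cutoff_eq_0[of R z b] by (simp add: \<phi>_def)
  qed (use assms in \<open>auto simp: open_Compl\<close>)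
  then show ?thesis by (simp add: partial_derivs_zero)
qed

lemma integrable_partial_derivs_cutoff:
  assumes "locally_integrable f"
  shows "integrable lebesgue (\<lambda>y. f y * partial_derivs is \<phi> y)"
proof (rule integrable_mult_continuous_compact[OF assms _ compact_cball partial_derivs_cutoff_outside])
  show "continuous_on UNIV (partial_derivs is \<phi>)"
    unfolding \<phi>_def by (intro continuous_elementary elementary_partial_derivs elementary.mult cutoff_elementary R \<psi>)
qed

lemma integrable_cutoff:
  assumes "locally_integrable f"
  shows "integrable lebesgue (\<lambda>y. f y * \<phi> y)"
  using integrable_partial_derivs_cutoff[OF assms, of "[]"] by (simp add: partial_derivs_def)

lemma partial_derivs_cutoff_inside:
  assumes "dist b y < r" "r\<^sup>2 \<le> R"
  shows "partial_derivs is \<phi> y = partial_derivs is \<psi> y"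
proof (rule partial_derivs_cong_open[where U="ball b r"])
  fix z assume "z \<in> ball b r"
  then have "(norm (z - b))\<^sup>2 \<le> r\<^sup>2"
    by (intro power_mono) (auto simp: dist_norm norm_minus_commute)
  then have "(z - b) \<bullet> (z - b) \<le> R" using assms(2) by (simp add: power2_norm_eq_inner)
  then show "\<phi> z = \<psi> z" using cutoff_eq_1[OF R, of z b] by (simp add: \<phi>_def)
qed (use assms in auto)

lemma test_function_cutoff: "test_function \<phi>"
  unfolding \<phi>_def by (rule test_function_cutoff_mult[OF R \<psi>])

end

lemma has_weak_derivD:
  assumes "has_weak_deriv u is g" "test_function \<phi>"
  shows "(LINT x|lebesgue. u x * partial_derivs is \<phi> x) = (-1) ^ length is * (LINT x|lebesgue. g x * \<phi> x)"
  using assms by (simp add: has_weak_deriv_def)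

text \<open>\<open>weak_deriv\<close> picks an arbitrary representative, while
  \<open>sobolev\<close> provides square integrability of some representative; uniqueness carries it
  over. Testing both candidates with a cut-off times \<open>newton_mollifier\<close> shows that
  every mollification of the truncated difference is 0; \<open>AE_le_of_mollify_le\<close> with the
  bound 0 and kappa > 0 finish the proof.\<close>

lemma weak_deriv_unique:
  fixes u g1 g2 :: "real^'n \<Rightarrow> complex"
  assumes n: "CARD('n) \<ge> 3" and g: "has_weak_deriv u is g1" "has_weak_deriv u is g2"
  shows "AE x in lebesgue. g1 x = g2 x"
proof -
  have loc: "locally_integrable g1" "locally_integrable g2" using g by (auto simp: has_weak_deriv_def)
  have "AE x in lebesgue. dist 0 x < real N \<longrightarrow> g1 x = g2 x" for N
  proof -
    \<comment> \<open>R is a squared radius, so the cut-off is 1 on the ball of radius N; the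
      summand 1 keeps R positive for N = 0.\<close>
    define R where "R = (real N)\<^sup>2 + 1"
    have R: "R > 0" by (simp add: R_def add_nonneg_pos)
    define w where "w y = (g1 y - g2 y) * complex_of_real (cutoff 0 R y)" for y
    have int: "integrable lebesgue (\<lambda>y. g1 y * (complex_of_real (cutoff 0 R y) * \<psi> y))"
      "integrable lebesgue (\<lambda>y. g2 y * (complex_of_real (cutoff 0 R y) * \<psi> y))"
      if "\<psi> \<in> elementary" for \<psi>
      using integrable_cutoff[OF R that] loc by auto
    have w: "integrable lebesgue w"
      using Bochner_Integration.integrable_diff[OF int(1)[OF elementary.const[of 1]] int(2)[OF elementary.const[of 1]]]
      by (simp add: w_def[abs_def] left_diff_distrib)
    have moll: "mollify \<epsilon> w x = 0" if "\<epsilon> > 0" for \<epsilon> x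
    proof -
      define \<psi> where "\<psi> y = complex_of_real (newton_mollifier (\<epsilon>\<^sup>2) x y)" for y
      have \<psi>: "\<psi> \<in> elementary" unfolding \<psi>_def[abs_def] by (rule elementary_newton_mollifier) (use that in simp)
      have "mollify \<epsilon> w x = (LINT y|lebesgue. g1 y * (complex_of_real (cutoff 0 R y) * \<psi> y) - g2 y * (complex_of_real (cutoff 0 R y) * \<psi> y))"
        unfolding mollify_def w_def \<psi>_def
        by (rule Bochner_Integration.integral_cong) (simp_all add: scaleR_conv_of_real algebra_simps)
      also have "\<dots> = (LINT y|lebesgue. g1 y * (complex_of_real (cutoff 0 R y) * \<psi> y)) - (LINT y|lebesgue. g2 y * (complex_of_real (cutoff 0 R y) * \<psi> y))"
        by (rule Bochner_Integration.integral_diff[OF int[OF \<psi>]])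
      also have "\<dots> = 0"
      proof -
        note test = test_function_cutoff[OF R \<psi>, of 0]
        have "(-1) ^ length is * (LINT y|lebesgue. g1 y * (complex_of_real (cutoff 0 R y) * \<psi> y))
           = (-1) ^ length is * (LINT y|lebesgue. g2 y * (complex_of_real (cutoff 0 R y) * \<psi> y))"
          using has_weak_derivD[OF g(1) test] has_weak_derivD[OF g(2) test] by (simp only:)
        then show ?thesis by simp
      qed
      finally show ?thesis .
    qed
    have "AE x in lebesgue. mollifier_mass TYPE('n) * ennreal (norm (w x)) \<le> 0"
      by (rule AE_le_of_mollify_le[OF _ w]) (use n moll in auto)
    then show ?thesis
    proof eventually_elim
      case (elim x)
      then have w0: "w x = 0" using mollifier_mass_pos[OF n] by (auto simp: ennreal_eq_0_iff)
      show ?case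
      proof
        assume "dist 0 x < real N"
        then have "(norm x)\<^sup>2 \<le> (real N)\<^sup>2" by (intro power_mono) auto
        then have "cutoff 0 R x = 1" by (intro cutoff_eq_1 R) (simp add: R_def power2_norm_eq_inner)
        then show "g1 x = g2 x" using w0 by (simp add: w_def)
      qed
    qed
  qed
  then have "AE x in lebesgue. \<forall>N. dist 0 x < real N \<longrightarrow> g1 x = g2 x"
    by (intro AE_all_countable[THEN iffD2] allI)
  then show ?thesis
  proof eventually_elim
    case (elim x)
    obtain N :: nat where "dist 0 x < real N" using reals_Archimedean2 by blast
    then show ?case using elim by blast
  qed
qed

section \<open>Bounding mollifications by the Newtonian potential\<close>

lemma mollified_newton_le:
  fixes x y :: "real^'n"
  assumes n: "CARD('n) \<ge> 2" and e: "e > 0" and xy: "x \<noteq> y"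
  shows "0 \<le> mollified_newton e x y" "mollified_newton e x y \<le> 1 / norm (x - y) ^ (CARD('n) - 2)"
proof -
  show "0 \<le> mollified_newton e x y" by (simp add: mollified_newton_def)
  have pos: "norm (x - y) > 0" using xy by simp
  have "mollified_newton e x y \<le> ((y - x) \<bullet> (y - x)) powr (1 - CARD('n) / 2)"
    unfolding mollified_newton_def by (rule powr_mono2') (use n e xy in auto)
  also have "(y - x) \<bullet> (y - x) = norm (x - y) powr 2"
    using pos by (simp add: power2_norm_eq_inner[symmetric] norm_minus_commute powr_numeral)
  also have "(norm (x - y) powr 2) powr (1 - CARD('n) / 2) = norm (x - y) powr (- real (CARD('n) - 2))"
    unfolding powr_powr using n by (simp add: of_nat_diff)
  also have "\<dots> = 1 / norm (x - y) ^ (CARD('n) - 2)"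
    using pos by (simp add: powr_minus_divide powr_realpow)
  finally show "mollified_newton e x y \<le> 1 / norm (x - y) ^ (CARD('n) - 2)" .
qed

text \<open>The cut-off is 1 on B(a, r), where u lives, so none of its derivatives meets u, and one
  side of the weak formulation is exactly minus the mollification. On the other side the test
  function is dominated by the unregularised kernel, whatever epsilon is.\<close>

lemma mollify_le_newton_potential:
  fixes u :: "real^'n \<Rightarrow> complex"
  assumes n: "CARD('n) \<ge> 3" and r: "r > 0"
    and wd: "\<And>i. has_weak_deriv u [i, i] (weak_deriv [i, i] u)"
    and u0: "AE y in lebesgue. y \<notin> ball a r \<longrightarrow> u y = 0"
    and \<epsilon>: "\<epsilon> > 0"
  shows "ennreal (norm (mollify \<epsilon> u x)) \<le> newton_potential (\<lambda>y. norm (laplacian u y)) x"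
proof -
  define R where "R = r\<^sup>2"
  have R: "R > 0" using r by (simp add: R_def)
  have e: "\<epsilon>\<^sup>2 > 0" using \<epsilon> by simp
  define \<psi> where "\<psi> y = complex_of_real (mollified_newton (\<epsilon>\<^sup>2) x y)" for y
  have \<psi>: "\<psi> \<in> elementary" unfolding \<psi>_def[abs_def] by (rule elementary_mollified_newton[OF e])
  define \<phi> where "\<phi> y = complex_of_real (cutoff a R y) * \<psi> y" for y
  note \<phi> = \<phi>_def[abs_def]
  have test: "test_function \<phi>" unfolding \<phi> by (rule test_function_cutoff[OF R \<psi>])
  have loc: "locally_integrable u" "locally_integrable (weak_deriv [i, i] u)" for i
    using wd by (auto simp: has_weak_deriv_def)
  have int_u: "integrable lebesgue (\<lambda>y. u y * partial_derivs is \<phi> y)" for "is"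
    unfolding \<phi> by (rule integrable_partial_derivs_cutoff[OF R \<psi> loc(1)])
  have int_w: "integrable lebesgue (\<lambda>y. weak_deriv [i, i] u y * \<phi> y)" for i
    unfolding \<phi> by (rule integrable_cutoff[OF R \<psi> loc(2)])
  have int_L: "integrable lebesgue (\<lambda>y. laplacian u y * \<phi> y)"
    unfolding laplacian_def sum_distrib_right by (intro Bochner_Integration.integrable_sum int_w)
  have parts: "(LINT y|lebesgue. (\<Sum>i\<in>UNIV. u y * partial_derivs [i, i] \<phi> y)) = (LINT y|lebesgue. laplacian u y * \<phi> y)"
  proof -
    have "(LINT y|lebesgue. (\<Sum>i\<in>UNIV. u y * partial_derivs [i, i] \<phi> y)) = (\<Sum>i\<in>UNIV. LINT y|lebesgue. u y * partial_derivs [i, i] \<phi> y)"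
      by (rule Bochner_Integration.integral_sum) (rule int_u)
    also have "\<dots> = (\<Sum>i\<in>UNIV. LINT y|lebesgue. weak_deriv [i, i] u y * \<phi> y)"
      using wd test by (intro sum.cong refl) (auto simp: has_weak_deriv_def)
    also have "\<dots> = (LINT y|lebesgue. (\<Sum>i\<in>UNIV. weak_deriv [i, i] u y * \<phi> y))"
      by (rule Bochner_Integration.integral_sum[symmetric]) (rule int_w)
    finally show ?thesis by (simp add: laplacian_def sum_distrib_right)
  qed
  have ae: "AE y in lebesgue. (\<Sum>i\<in>UNIV. u y * partial_derivs [i, i] \<phi> y) = - (newton_mollifier (\<epsilon>\<^sup>2) x y *\<^sub>R u y)"
    using u0
  proof eventually_elim
    case (elim y)
    show ?case
    proof (cases "y \<in> ball a r")
      case True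
      have "(\<Sum>i\<in>UNIV. u y * partial_derivs [i, i] \<phi> y) = u y * (\<Sum>i\<in>UNIV. partial_derivs [i, i] \<phi> y)"
        by (simp add: sum_distrib_left)
      also have "(\<Sum>i\<in>UNIV. partial_derivs [i, i] \<phi> y) = (\<Sum>i\<in>UNIV. partial_derivs [i, i] \<psi> y)"
        unfolding \<phi> using True by (intro sum.cong refl partial_derivs_cutoff_inside[OF R \<psi>, of _ _ r]) (auto simp: R_def)
      also have "\<dots> = - of_real (newton_mollifier (\<epsilon>\<^sup>2) x y)"
        unfolding \<psi>_def[abs_def] by (rule laplacian_mollified_newton[OF e])
      finally show ?thesis by (simp add: scaleR_conv_of_real)
    qed (use elim in simp)
  qed
  have "(LINT y|lebesgue. (\<Sum>i\<in>UNIV. u y * partial_derivs [i, i] \<phi> y)) = (LINT y|lebesgue. - (newton_mollifier (\<epsilon>\<^sup>2) x y *\<^sub>R u y))"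
  proof (rule integral_cong_AE[OF _ _ ae])
    show m: "(\<lambda>y. \<Sum>i\<in>UNIV. u y * partial_derivs [i, i] \<phi> y) \<in> borel_measurable lebesgue"
      by (intro borel_measurable_sum borel_measurable_integrable int_u)
    \<comment> \<open>Measurability passes across the almost everywhere equality because Lebesgue
      measure is complete.\<close>
    show "(\<lambda>y. - (newton_mollifier (\<epsilon>\<^sup>2) x y *\<^sub>R u y)) \<in> borel_measurable lebesgue"
      by (rule borel_measurable_AE[OF m ae])
  qed
  also have "\<dots> = - mollify \<epsilon> u x"
    by (simp add: mollify_def)
  finally have "mollify \<epsilon> u x = - (LINT y|lebesgue. laplacian u y * \<phi> y)"
    using parts by simp
  then have "ennreal (norm (mollify \<epsilon> u x)) \<le> (\<integral>\<^sup>+y. ennreal (norm (laplacian u y * \<phi> y)) \<partial>lebesgue)"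
    using integral_norm_bound_ennreal[OF int_L] by simp
  also have "\<dots> \<le> newton_potential (\<lambda>y. norm (laplacian u y)) x"
    unfolding newton_potential_def
  proof (rule nn_integral_mono_AE, use AE_lebesgue_neq[of x] in eventually_elim)
    fix y assume y: "y \<noteq> x"
    have "norm (\<phi> y) = cutoff a R y * mollified_newton (\<epsilon>\<^sup>2) x y"
      using cutoff_bounds(1)[of a R y] mollified_newton_le(1)[OF _ e, of x y] n y by (simp add: \<phi>_def \<psi>_def norm_mult)
    also have "\<dots> \<le> 1 * (1 / norm (x - y) ^ (CARD('n) - 2))"
      using cutoff_bounds[of a R y] mollified_newton_le[OF _ e, of x y] n y by (intro mult_mono) auto
    finally have "norm (laplacian u y) * norm (\<phi> y) \<le> norm (laplacian u y) * (1 / norm (x - y) ^ (CARD('n) - 2))"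
      by (intro mult_left_mono) auto
    then show "ennreal (norm (laplacian u y * \<phi> y)) \<le> ennreal (norm (laplacian u y) / norm (x - y) ^ (CARD('n) - 2))"
      by (simp add: norm_mult ennreal_leI)
  qed
  finally show ?thesis .
qed

subsection \<open>Vanishing of solutions with small support\<close>

text \<open>The complement of \<open>ess_support\<close> is a union of possibly uncountably many
  open sets. By the Lindelof property countably many suffice, and their exceptional null sets can be
  united.\<close>

lemma AE_zero_outside_ess_support:
  fixes u :: "real^'n \<Rightarrow> complex"
  shows "AE x in lebesgue. x \<notin> ess_support u \<longrightarrow> u x = 0"
proof -
  define F where "F = {U. open U \<and> (AE x in lebesgue. x \<in> U \<longrightarrow> u x = 0)}"
  obtain F' where F': "F' \<subseteq> F" "countable F'" "\<Union>F' = \<Union>F"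
    using Lindelof[of F] by (auto simp: F_def)
  have "AE x in lebesgue. \<forall>U\<in>F'. x \<in> U \<longrightarrow> u x = 0"
    using F'(1) by (subst AE_ball_countable[OF F'(2)]) (auto simp: F_def)
  then show ?thesis
  proof eventually_elim
    case (elim x)
    then show ?case using F'(3) by (auto simp: ess_support_def F_def[symmetric])
  qed
qed

lemma locally_integrable_finite_on_cubes:
  fixes f :: "real^'n \<Rightarrow> complex"
  assumes f: "locally_integrable f"
  shows "finite_on_cubes (\<lambda>x. norm (f x))"
  unfolding finite_on_cubes_def
proof (intro conjI allI)
  \<comment> \<open>\<open>locally_integrable\<close> speaks of compact sets only, so global
    measurability is recovered from truncations to growing balls.\<close>
  have "(\<lambda>x. indicator (cball 0 (real N)) x *\<^sub>R f x) \<in> borel_measurable lebesgue" for N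
    using f by (intro borel_measurable_integrable) (auto simp: locally_integrable_def set_integrable_def)
  then have "f \<in> borel_measurable lebesgue"
  proof (rule borel_measurable_LIMSEQ_metric)
    fix x :: "real^'n"
    obtain N0 :: nat where N0: "norm x \<le> real N0" using real_arch_simple by blast
    have "eventually (\<lambda>N. indicator (cball 0 (real N)) x *\<^sub>R f x = f x) sequentially"
      using eventually_ge_at_top[of N0] by eventually_elim (use N0 in \<open>auto simp: indicator_def\<close>)
    then show "(\<lambda>N. indicator (cball 0 (real N)) x *\<^sub>R f x) \<longlonglongrightarrow> f x"
      by (rule tendsto_eventually)
  qed
  then show meas: "(\<lambda>x. norm (f x)) \<in> borel_measurable lebesgue" by simp
  fix k :: int and m :: "int^'n"
  have "bounded (dyadic_cube k m)"
  proof (cases "dyadic_cube k m = {}")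
    case False
    then obtain c where c: "c \<in> dyadic_cube k m" by auto
    have "dyadic_cube k m \<subseteq> cball c (real CARD('n) * 2 powi k)"
      using norm_diff_le_dyadic_cube[OF c] by (auto simp: dist_norm)
    then show ?thesis using bounded_cball bounded_subset by blast
  qed simp
  then obtain r where r: "dyadic_cube k m \<subseteq> cball 0 r" by (auto simp: bounded_iff subset_eq)
  have "integrable lebesgue (\<lambda>x. indicator (cball 0 r) x *\<^sub>R f x)"
    using f by (auto simp: locally_integrable_def set_integrable_def)
  then have "(\<integral>\<^sup>+x. ennreal (norm (indicator (cball 0 r) x *\<^sub>R f x)) \<partial>lebesgue) < \<infinity>"
    unfolding integrable_iff_bounded by blast
  moreover have "(\<integral>\<^sup>+x\<in>dyadic_cube k m. ennreal (norm (f x)) \<partial>lebesgue)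
      \<le> (\<integral>\<^sup>+x. ennreal (norm (indicator (cball 0 r) x *\<^sub>R f x)) \<partial>lebesgue)"
    using r by (intro nn_integral_mono) (auto simp: indicator_def)
  ultimately show "(\<integral>\<^sup>+x\<in>dyadic_cube k m. ennreal (norm (f x)) \<partial>lebesgue) < \<infinity>"
    by (rule le_less_trans[rotated])
qed simp

lemma Lp_space_2_nn_integral:
  assumes "f \<in> Lp_space 2"
  shows "f \<in> borel_measurable lebesgue" "(\<integral>\<^sup>+x. ennreal ((norm (f x))\<^sup>2) \<partial>lebesgue) < \<infinity>"
proof -
  show "f \<in> borel_measurable lebesgue" using assms by (simp add: Lp_space_def)
  have "(\<integral>\<^sup>+x. ennreal (norm (norm (f x) powr 2)) \<partial>lebesgue) < \<infinity>"
    using integrableD(2)[of lebesgue "\<lambda>x. norm (f x) powr 2"] assms by (simp add: Lp_space_def less_top)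
  then show "(\<integral>\<^sup>+x. ennreal ((norm (f x))\<^sup>2) \<partial>lebesgue) < \<infinity>" by simp
qed

text \<open>The denominator of the quotient in the supremum is cleared for cubes of positive mass.
  On a cube of zero mass W vanishes almost everywhere, hence so does the outer integrand of the
  energy.\<close>

lemma pair_energy_le_of_kerman_sawyer:
  fixes V :: "real^'n \<Rightarrow> complex"
  assumes V: "finite_on_cubes (\<lambda>x. norm (V x))" and b: "b \<ge> 0"
    and KS: "kerman_sawyer_norm V \<le> ennreal b"
  shows "pair_energy (CARD('n) - 2) (\<lambda>x. norm (V x)) (dyadic_cube k m) (dyadic_cube k m)
    \<le> ennreal (b * cube_mass (\<lambda>x. norm (V x)) k m)"
proof -
  let ?Q = "dyadic_cube k m"
  define W where "W x = norm (V x)" for x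
  note [measurable] = finite_on_cubesD(1)[OF V, folded W_def]
  let ?E = "pair_energy (CARD('n) - 2) W ?Q ?Q"
  have mass: "ennreal (cube_mass W k m) = (\<integral>\<^sup>+x\<in>?Q. ennreal (W x) \<partial>lebesgue)"
    using finite_on_cubesD(4)[OF V] by (simp add: W_def[abs_def])
  have "?Q \<in> dyadic_cubes" by (auto simp: dyadic_cubes_def)
  then have "(\<integral>\<^sup>+x\<in>?Q. (\<integral>\<^sup>+y\<in>?Q. ennreal (norm (V x * V y) / norm (x - y) ^ (CARD('n) - 2)) \<partial>lebesgue) \<partial>lebesgue)
        / (\<integral>\<^sup>+x\<in>?Q. ennreal (norm (V x)) \<partial>lebesgue) \<le> kerman_sawyer_norm V"
    unfolding kerman_sawyer_norm_def by (rule SUP_upper)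
  then have quot: "?E / ennreal (cube_mass W k m) \<le> ennreal b"
    using KS unfolding mass pair_energy_def by (simp add: W_def norm_mult)
  show ?thesis
  proof (cases "cube_mass W k m = 0")
    case True
    then have "(\<integral>\<^sup>+x\<in>?Q. ennreal (W x) \<partial>lebesgue) = 0" using mass by simp
    then have ae: "AE x in lebesgue. ennreal (W x) * indicator ?Q x = 0"
      by (subst (asm) nn_integral_0_iff_AE) auto
    have "?E = (\<integral>\<^sup>+x. 0 \<partial>(lebesgue :: (real^'n) measure))"
      unfolding pair_energy_def
    proof (rule nn_integral_cong_AE, use ae in eventually_elim)
      fix x assume "ennreal (W x) * indicator ?Q x = 0"
      then show "(\<integral>\<^sup>+y\<in>?Q. ennreal (W x * W y / norm (x - y) ^ (CARD('n) - 2)) \<partial>lebesgue) * indicator ?Q x = 0"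
        by (cases "x \<in> ?Q") (auto simp: W_def)
    qed
    then show ?thesis by (simp add: W_def[abs_def])
  next
    case False
    then have pos: "cube_mass W k m > 0" using cube_mass_nonneg[of W k m] by simp
    have "?E = ?E / ennreal (cube_mass W k m) * ennreal (cube_mass W k m)"
      using pos by (simp add: ennreal_divide_times mult_divide_eq_ennreal)
    also have "\<dots> \<le> ennreal b * ennreal (cube_mass W k m)"
      by (rule mult_right_mono[OF quot]) simp
    also have "\<dots> = ennreal (b * cube_mass W k m)" using b pos by (simp add: ennreal_mult)
    finally show ?thesis by (simp add: W_def[abs_def])
  qed
qed

text \<open>Multiplying h \<le> W v by h gives h^2 \<le> W (h v), and Cauchy-Schwarz on a cube
  yields the hypothesis X^2 \<le> M F of \<open>carleson_embedding\<close> for the masses of h, W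
  and h v. The 8 is 4 from the embedding times 2 from \<open>tree_sum_cube_mass_le\<close>.\<close>

lemma dyadic_energy_le:
  fixes W h v :: "real^'n \<Rightarrow> real"
  assumes W: "finite_on_cubes W" and h: "finite_on_cubes h" and v[measurable]: "v \<in> borel_measurable lebesgue"
    and v0: "\<And>x. v x \<ge> 0" and le: "AE x in lebesgue. h x \<le> W x * v x"
    and fin: "(\<integral>\<^sup>+x. ennreal (h x * v x) \<partial>lebesgue) < \<infinity>" and p: "p \<ge> 1" and b: "b > 0"
    and E: "\<And>k m. pair_energy p W (dyadic_cube k m) (dyadic_cube k m) \<le> ennreal (b * cube_mass W k m)"
  shows "dyadic_energy p h \<le> ennreal (8 * real CARD('n) ^ p * b) * (\<integral>\<^sup>+x. ennreal (h x * v x) \<partial>lebesgue)"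
proof -
  define A where "A = 2 * real CARD('n) ^ p * b"
  have A: "A > 0" using b by (simp add: A_def)
  note [measurable] = finite_on_cubesD(1)[OF W] finite_on_cubesD(1)[OF h]
  note nonneg = finite_on_cubesD(2)[OF W] finite_on_cubesD(2)[OF h] v0
  have F: "finite_on_cubes (\<lambda>x. h x * v x)"
    unfolding finite_on_cubes_def
  proof (intro conjI allI)
    fix k m
    have "(\<integral>\<^sup>+x\<in>dyadic_cube k m. ennreal (h x * v x) \<partial>lebesgue) \<le> (\<integral>\<^sup>+x. ennreal (h x * v x) \<partial>lebesgue)"
      by (intro nn_integral_mono) (auto simp: indicator_def)
    then show "(\<integral>\<^sup>+x\<in>dyadic_cube k m. ennreal (h x * v x) \<partial>lebesgue) < \<infinity>" using fin by (rule le_less_trans)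
  qed (use nonneg in auto)
  have CS: "(cube_mass h k m)\<^sup>2 \<le> cube_mass W k m * cube_mass (\<lambda>x. h x * v x) k m" for k m
  proof -
    let ?Q = "dyadic_cube k m"
    have "(\<integral>\<^sup>+x\<in>?Q. ennreal (h x) \<partial>lebesgue)
       \<le> (\<integral>\<^sup>+x. (ennreal (sqrt (W x)) * indicator ?Q x) * (ennreal (sqrt (h x * v x)) * indicator ?Q x) \<partial>lebesgue)"
    proof (rule nn_integral_mono_AE, use le in eventually_elim)
      fix x assume hx: "h x \<le> W x * v x"
      have "(h x)\<^sup>2 \<le> W x * (h x * v x)"
        using mult_right_mono[OF hx nonneg(2)[of x]] by (simp add: power2_eq_square ac_simps)
      then have "h x \<le> sqrt (W x * (h x * v x))" by (rule real_le_rsqrt)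
      then show "ennreal (h x) * indicator ?Q x \<le> (ennreal (sqrt (W x)) * indicator ?Q x) * (ennreal (sqrt (h x * v x)) * indicator ?Q x)"
        using nonneg by (cases "x \<in> ?Q") (simp_all add: real_sqrt_mult ennreal_mult[symmetric] ennreal_leI)
    qed
    then have "(ennreal (cube_mass h k m))\<^sup>2 \<le> (\<integral>\<^sup>+x. (ennreal (sqrt (W x)) * indicator ?Q x) * (ennreal (sqrt (h x * v x)) * indicator ?Q x) \<partial>lebesgue)\<^sup>2"
      unfolding finite_on_cubesD(4)[OF h] by (rule power_mono) simp
    also have "\<dots> \<le> (\<integral>\<^sup>+x. (ennreal (sqrt (W x)) * indicator ?Q x)\<^sup>2 \<partial>lebesgue) * (\<integral>\<^sup>+x. (ennreal (sqrt (h x * v x)) * indicator ?Q x)\<^sup>2 \<partial>lebesgue)"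
      by (rule Cauchy_Schwarz_nn_integral) auto
    also have "(\<integral>\<^sup>+x. (ennreal (sqrt (W x)) * indicator ?Q x)\<^sup>2 \<partial>lebesgue) = ennreal (cube_mass W k m)"
      unfolding finite_on_cubesD(4)[OF W] using nonneg
      by (intro nn_integral_cong) (auto simp: indicator_def ennreal_power)
    also have "(\<integral>\<^sup>+x. (ennreal (sqrt (h x * v x)) * indicator ?Q x)\<^sup>2 \<partial>lebesgue) = ennreal (cube_mass (\<lambda>x. h x * v x) k m)"
      unfolding finite_on_cubesD(4)[OF F] using nonneg
      by (intro nn_integral_cong) (auto simp: indicator_def ennreal_power)
    finally have "ennreal ((cube_mass h k m)\<^sup>2) \<le> ennreal (cube_mass W k m * cube_mass (\<lambda>x. h x * v x) k m)"
      by (simp add: ennreal_power cube_mass_nonneg ennreal_mult)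
    then show ?thesis by (subst (asm) ennreal_le_iff) (auto simp: cube_mass_nonneg)
  qed
  have S: "tree_sum (cube_weight p) (cube_mass W) N k m \<le> A * cube_mass W k m" for N k m
    unfolding A_def using b by (intro tree_sum_cube_mass_le W p E) auto
  have w: "0 \<le> cube_weight p k" for k using cube_weight_pos[of p k] by simp
  have T: "tree_sum (cube_weight p) (cube_mass h) N k m \<le> 4 * A * cube_mass (\<lambda>x. h x * v x) k m" for N k m
    by (rule carleson_embedding[OF w tree_additive_cube_mass[OF h] tree_additive_cube_mass[OF W]
          tree_additive_cube_mass[OF F] CS A S])
  have "dyadic_energy p h \<le> ennreal (4 * A) * (\<integral>\<^sup>+x. ennreal (h x * v x) \<partial>lebesgue)"
    unfolding dyadic_energy_def
    by (rule tree_energy_le[OF w _ T]) (use A nn_integral_cube_mass[OF F] in auto)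
  then show ?thesis by (simp add: A_def mult.assoc)
qed

text \<open>The cubes of a single level cover the space, so vanishing masses at level 0 already give
  a vanishing integral.\<close>

lemma dyadic_energy_eq_0:
  fixes h :: "real^'n \<Rightarrow> real"
  assumes h: "finite_on_cubes h" and 0: "dyadic_energy p h = 0"
  shows "AE x in lebesgue. h x = 0"
proof -
  note [measurable] = finite_on_cubesD(1)[OF h]
  have "cube_mass h 0 m = 0" for m
  proof -
    have "ennreal (cube_weight p 0 * (cube_mass h 0 m)\<^sup>2)
      \<le> (\<integral>\<^sup>+m. ennreal (cube_weight p 0 * (cube_mass h 0 m)\<^sup>2) \<partial>count_space UNIV)"
      by (rule nn_integral_ge_point) simp
    also have "\<dots> \<le> dyadic_energy p h"
      unfolding dyadic_energy_def
      by (rule nn_integral_ge_point[where p="\<lambda>k. \<integral>\<^sup>+m. ennreal (cube_weight p k * (cube_mass h k m)\<^sup>2) \<partial>count_space UNIV"]) simp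
    finally have "cube_weight p 0 * (cube_mass h 0 m)\<^sup>2 \<le> 0" using 0 by (simp add: ennreal_eq_0_iff)
    then show ?thesis using cube_weight_pos[of p 0] by (simp add: mult_le_0_iff)
  qed
  then have "(\<integral>\<^sup>+x. ennreal (h x) \<partial>lebesgue) = 0"
    using nn_integral_cube_mass[OF h, of 0] by simp
  then have "AE x in lebesgue. ennreal (h x) = 0"
    by (subst (asm) nn_integral_0_iff_AE) auto
  then show ?thesis
    by eventually_elim (use finite_on_cubesD(2)[OF h] in \<open>auto simp: ennreal_eq_0_iff intro: antisym\<close>)
qed

text \<open>The quantity to be absorbed is I = \<integral> h |u|: kappa I \<le> C D \<le> C B I,
  with C from the kernel decomposition and B from the Carleson embedding. Assumption
  \<open>small\<close> says C B < kappa.\<close>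

lemma vanishing_of_small_support:
  fixes u V :: "real^'n \<Rightarrow> complex"
  defines "p \<equiv> CARD('n) - 2"
  assumes n: "CARD('n) \<ge> 3"
    and u: "u \<in> sobolev 2 2" and r: "r > 0" and u0: "AE x in lebesgue. x \<notin> ball a r \<longrightarrow> u x = 0"
    and V: "finite_on_cubes (\<lambda>x. norm (V x))" and KS: "kerman_sawyer_norm V \<le> ennreal b" and b: "b > 0"
    and small: "2 ^ p * (2 * real (card (neighbours :: (int^'n) set))) * (8 * real CARD('n) ^ p * b)
       < enn2real (mollifier_mass TYPE('n))"
    and le: "AE x in lebesgue. norm (laplacian u x) \<le> norm (V x * u x)"
  shows "AE x in lebesgue. u x = 0"
proof -
  define h where "h x = norm (laplacian u x)" for x
  define v where "v x = norm (u x)" for x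
  have uL: "u \<in> Lp_space 2" and ex: "\<And>is. length is \<le> 2 \<Longrightarrow> \<exists>g\<in>Lp_space 2. has_weak_deriv u is g"
    using u by (auto simp: sobolev_def)
  obtain g where g: "\<And>i. g i \<in> Lp_space 2" "\<And>i. has_weak_deriv u [i, i] (g i)"
    using ex[of "[i, i]" for i] by (auto simp: Bex_def) metis
  have wd: "has_weak_deriv u [i, i] (weak_deriv [i, i] u)" for i
    unfolding weak_deriv_def by (rule someI[of _ "g i"]) (rule g)
  have aeg: "AE x in lebesgue. weak_deriv [i, i] u x = g i x" for i
    by (rule weak_deriv_unique[OF n wd g(2)])
  have u_meas [measurable]: "u \<in> borel_measurable lebesgue" by (rule Lp_space_2_nn_integral[OF uL])
  have [measurable]: "g i \<in> borel_measurable lebesgue" for i by (rule Lp_space_2_nn_integral[OF g(1)])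
  have loc_u: "locally_integrable u" using g(2) by (auto simp: has_weak_deriv_def)
  have "locally_integrable (laplacian u)"
    unfolding locally_integrable_def laplacian_def[abs_def]
    using wd by (auto intro!: absolutely_integrable_sum simp: has_weak_deriv_def locally_integrable_def)
  then have h: "finite_on_cubes h"
    unfolding h_def[abs_def] by (rule locally_integrable_finite_on_cubes)
  note [measurable] = finite_on_cubesD(1)[OF h]
  have [measurable]: "v \<in> borel_measurable lebesgue" by (simp add: v_def[abs_def])
  \<comment> \<open>The bound runs through the representatives \<open>g i\<close>, since these are
    the ones known to be square integrable.\<close>
  have fin: "(\<integral>\<^sup>+x. ennreal (h x * v x) \<partial>lebesgue) < \<infinity>"
  proof -
    have "(\<integral>\<^sup>+x. ennreal (h x * v x) \<partial>lebesgue)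
      \<le> (\<integral>\<^sup>+x. (\<Sum>i\<in>UNIV. ennreal ((norm (g i x))\<^sup>2) + ennreal ((norm (u x))\<^sup>2)) \<partial>lebesgue)"
    proof (rule nn_integral_mono_AE)
      have "AE x in lebesgue. \<forall>i. weak_deriv [i, i] u x = g i x"
        by (rule eventually_all_finite) (rule aeg)
      then show "AE x in lebesgue. ennreal (h x * v x) \<le> (\<Sum>i\<in>UNIV. ennreal ((norm (g i x))\<^sup>2) + ennreal ((norm (u x))\<^sup>2))"
      proof eventually_elim
        case (elim x)
        have "h x * v x \<le> (\<Sum>i\<in>UNIV. norm (g i x)) * v x"
          using elim by (intro mult_right_mono) (auto simp: h_def v_def laplacian_def norm_sum)
        also have "\<dots> \<le> (\<Sum>i\<in>UNIV. (norm (g i x))\<^sup>2 + (norm (u x))\<^sup>2)"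
          unfolding sum_distrib_right
        proof (rule sum_mono)
          fix i
          show "norm (g i x) * v x \<le> (norm (g i x))\<^sup>2 + (norm (u x))\<^sup>2"
            using sum_squares_bound[of "norm (g i x)" "norm (u x)"]
              mult_nonneg_nonneg[OF norm_ge_zero[of "g i x"] norm_ge_zero[of "u x"]]
            unfolding v_def by linarith
        qed
        finally show ?case by (simp add: ennreal_leI sum_ennreal flip: ennreal_plus)
      qed
    qed
    also have "\<dots> = (\<Sum>i\<in>UNIV. (\<integral>\<^sup>+x. ennreal ((norm (g i x))\<^sup>2) \<partial>lebesgue) + (\<integral>\<^sup>+x. ennreal ((norm (u x))\<^sup>2) \<partial>lebesgue))"
      by (simp add: nn_integral_sum nn_integral_add)
    also have "\<dots> < \<infinity>"
      using Lp_space_2_nn_integral(2)[OF g(1)] Lp_space_2_nn_integral(2)[OF uL] by simp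
    finally show ?thesis .
  qed
  have hle: "AE x in lebesgue. h x \<le> norm (V x) * v x"
    using le by (simp add: h_def v_def norm_mult)
  define I where "I = (\<integral>\<^sup>+x. ennreal (h x * v x) \<partial>lebesgue)"
  define D where "D = dyadic_energy p h"
  define \<kappa> where "\<kappa> = enn2real (mollifier_mass TYPE('n))"
  have \<kappa>: "mollifier_mass TYPE('n) = ennreal \<kappa>" "\<kappa> > 0"
    using mollifier_mass_finite[where 'n='n] mollifier_mass_pos[OF n] by (auto simp: \<kappa>_def enn2real_positive_iff)
  define C where "C = 2 ^ p * (2 * real (card (neighbours :: (int^'n) set)))"
  define B where "B = 8 * real CARD('n) ^ p * b"
  have CB: "C \<ge> 0" "B \<ge> 0" using b by (auto simp: C_def B_def)
  have DI: "D \<le> ennreal B * I"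
    unfolding D_def B_def I_def
    by (rule dyadic_energy_le[OF V h _ _ hle fin _ b])
       (use n b KS pair_energy_le_of_kerman_sawyer[OF V _ KS] in \<open>auto simp: v_def[abs_def] p_def\<close>)
  have rep: "AE x in lebesgue. ennreal \<kappa> * ennreal (v x) \<le> newton_potential h x"
  proof -
    \<comment> \<open>Membership in L^2 alone does not give this; u is locally integrable and
      vanishes outside a ball.\<close>
    have u_int: "integrable lebesgue u"
    proof -
      have c: "integrable lebesgue (\<lambda>x. indicator (cball a r) x *\<^sub>R u x)"
        using loc_u by (auto simp: locally_integrable_def set_integrable_def)
      have "AE x in lebesgue. indicator (cball a r) x *\<^sub>R u x = u x"
        using u0 by eventually_elim (auto simp: indicator_def)
      then show ?thesis by (rule integrable_cong_AE_imp[OF c u_meas])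
    qed
    show ?thesis
      unfolding \<kappa>(1)[symmetric] v_def
    proof (rule AE_le_of_mollify_le[OF _ u_int])
      show "newton_potential h \<in> borel_measurable lebesgue" by measurable
      show "ennreal (norm (mollify \<epsilon> u x)) \<le> newton_potential h x" if "\<epsilon> > 0" for \<epsilon> x
        unfolding h_def[abs_def] by (rule mollify_le_newton_potential[OF n r wd u0 that])
    qed (use n in auto)
  qed
  have "ennreal \<kappa> * I \<le> (\<integral>\<^sup>+x. ennreal (h x) * newton_potential h x \<partial>lebesgue)"
  proof -
    have "ennreal \<kappa> * I = (\<integral>\<^sup>+x. ennreal \<kappa> * ennreal (h x * v x) \<partial>lebesgue)"
      unfolding I_def by (rule nn_integral_cmult[symmetric]) simp
    also have "\<dots> \<le> (\<integral>\<^sup>+x. ennreal (h x) * newton_potential h x \<partial>lebesgue)"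
    proof (rule nn_integral_mono_AE, use rep in eventually_elim)
      fix x assume x: "ennreal \<kappa> * ennreal (v x) \<le> newton_potential h x"
      have "ennreal \<kappa> * ennreal (h x * v x) = ennreal (h x) * (ennreal \<kappa> * ennreal (v x))"
        by (simp add: h_def v_def ennreal_mult ac_simps)
      also have "\<dots> \<le> ennreal (h x) * newton_potential h x" using x by (rule mult_left_mono) simp
      finally show "ennreal \<kappa> * ennreal (h x * v x) \<le> ennreal (h x) * newton_potential h x" .
    qed
    finally show ?thesis .
  qed
  also have "\<dots> \<le> ennreal C * D"
    unfolding C_def D_def p_def by (rule energy_le_dyadic_energy[OF h])
  also have "\<dots> \<le> ennreal C * (ennreal B * I)" using DI by (rule mult_left_mono) simp
  finally have ineq: "ennreal \<kappa> * I \<le> ennreal C * (ennreal B * I)" .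
  obtain i where i: "I = ennreal i" "i \<ge> 0" using fin by (cases I) (auto simp: I_def)
  have "\<kappa> * i \<le> C * B * i"
    using ineq i CB \<kappa>(2) by (simp add: ennreal_mult[symmetric] mult.assoc)
  moreover have "C * B < \<kappa>" using small by (simp add: C_def B_def \<kappa>_def)
  ultimately have "i = 0" using i(2) by (metis mult_le_cancel_right not_less order_antisym_conv)
  then have "D = 0" using DI i(1) by simp
  then have h0: "AE x in lebesgue. h x = 0" unfolding D_def by (rule dyadic_energy_eq_0[OF h])
  \<comment> \<open>The bound \<open>rep\<close> is used a second time: a vanishing potential forces
    u = 0.\<close>
  have pot0: "newton_potential h x = 0" for x
  proof -
    have "newton_potential h x = (\<integral>\<^sup>+y. 0 \<partial>(lebesgue :: (real^'n) measure))"
      unfolding newton_potential_def by (rule nn_integral_cong_AE, use h0 in eventually_elim) simp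
    then show ?thesis by simp
  qed
  show ?thesis
    using rep
  proof eventually_elim
    case (elim x)
    then show ?case using pot0[of x] \<kappa>(2) by (auto simp: v_def ennreal_mult[symmetric] ennreal_eq_0_iff mult_le_0_iff)
  qed
qed

theorem corollary1p2:
  assumes "CARD('n::finite) \<ge> 3"
  shows "\<exists>\<epsilon>>0. \<forall>V :: real^'n \<Rightarrow> complex.
     V \<in> kerman_sawyer_class \<longrightarrow>
     (\<forall>z. Limsup (at_right 0)
        (\<lambda>r. kerman_sawyer_norm (\<lambda>x. indicator (ball z r) x * V x)) \<le> ennreal \<epsilon>) \<longrightarrow>
     (\<forall>a. \<exists>\<delta>>0. \<forall>u r.
        r > 0 \<longrightarrow>
        u \<in> sobolev 2 2 \<longrightarrow>
        \<not> (AE x in lebesgue. u x = 0) \<longrightarrow>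
        (AE x in lebesgue. norm (laplacian u x) \<le> norm (V x * u x)) \<longrightarrow>
        ess_support u \<subseteq> ball a r \<longrightarrow>
        measure lebesgue (ball a r) \<ge> \<delta>)"
proof -
  define p where "p = CARD('n) - 2"
  define \<kappa> where "\<kappa> = enn2real (mollifier_mass TYPE('n))"
  have \<kappa>: "\<kappa> > 0"
    using mollifier_mass_finite[where 'n='n] mollifier_mass_pos[OF assms] by (auto simp: \<kappa>_def enn2real_positive_iff)
  define c where "c = 2 ^ p * (2 * real (card (neighbours :: (int^'n) set))) * (8 * real CARD('n) ^ p)"
  have c: "c \<ge> 0" by (simp add: c_def)
  \<comment> \<open>\<open>c\<close> collects the constants of the two energy estimates. The norm of
    the localised potential will be below 2 epsilon, so 2 c epsilon < kappa is the goal; c + 1 keeps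
    the denominator positive.\<close>
  define \<epsilon> where "\<epsilon> = \<kappa> / (4 * (c + 1))"
  have \<epsilon>: "\<epsilon> > 0" using \<kappa> c by (simp add: \<epsilon>_def)
  have c\<epsilon>: "c * (2 * \<epsilon>) < \<kappa>"
  proof -
    have "\<epsilon> * (4 * (c + 1)) = \<kappa>" using c by (simp add: \<epsilon>_def)
    then have "4 * (c * \<epsilon>) + 4 * \<epsilon> = \<kappa>" by (simp add: algebra_simps)
    moreover have "c * \<epsilon> \<ge> 0" using c \<epsilon> by simp
    moreover have "c * (2 * \<epsilon>) = 2 * (c * \<epsilon>)" by simp
    ultimately show ?thesis using \<epsilon> by linarith
  qed
  show ?thesis
  proof (rule exI[of _ \<epsilon>], intro conjI \<epsilon> allI impI)
    fix V :: "real^'n \<Rightarrow> complex" and a :: "real^'n"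
    assume V: "V \<in> kerman_sawyer_class"
      and lim: "\<forall>z. Limsup (at_right 0) (\<lambda>r. kerman_sawyer_norm (\<lambda>x. indicator (ball z r) x * V x)) \<le> ennreal \<epsilon>"
    \<comment> \<open>Relaxing the bound epsilon to a strict bound 2 epsilon allows an actual radius
      to be picked from the upper limit.\<close>
    have "Limsup (at_right 0) (\<lambda>r. kerman_sawyer_norm (\<lambda>x. indicator (ball a r) x * V x)) < ennreal (2 * \<epsilon>)"
      using lim \<epsilon> by (intro le_less_trans[OF _ ennreal_lessI[of "2 * \<epsilon>" \<epsilon>]]) auto
    then have "eventually (\<lambda>r. kerman_sawyer_norm (\<lambda>x. indicator (ball a r) x * V x) < ennreal (2 * \<epsilon>)) (at_right 0)"
      by (rule Limsup_lessD)
    then have "eventually (\<lambda>r. r > 0 \<and> kerman_sawyer_norm (\<lambda>x. indicator (ball a r) x * V x) < ennreal (2 * \<epsilon>)) (at_right (0::real))"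
      using eventually_at_right_less by (rule eventually_conj[rotated])
    then obtain r0 where r0: "r0 > 0" "kerman_sawyer_norm (\<lambda>x. indicator (ball a r0) x * V x) < ennreal (2 * \<epsilon>)"
      using eventually_happens'[OF trivial_limit_at_right_real] by blast
    define V0 where "V0 x = indicator (ball a r0) x * V x" for x
    have KS: "kerman_sawyer_norm V0 \<le> ennreal (2 * \<epsilon>)" using r0(2) by (simp add: V0_def[abs_def])
    have V0: "finite_on_cubes (\<lambda>x. norm (V0 x))"
    proof -
      have Vf: "finite_on_cubes (\<lambda>x. norm (V x))"
        using V by (intro locally_integrable_finite_on_cubes) (simp add: kerman_sawyer_class_def)
      note [measurable] = finite_on_cubesD(1)[OF Vf]
      have eq: "norm (V0 x) = indicator (ball a r0) x * norm (V x)" for x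
        by (simp add: V0_def norm_mult indicator_def)
      show ?thesis
        unfolding finite_on_cubes_def
      proof (intro conjI allI)
        show "(\<lambda>x. norm (V0 x)) \<in> borel_measurable lebesgue"
          unfolding eq by (intro borel_measurable_times borel_measurable_indicator) auto
        fix k m
        have "(\<integral>\<^sup>+x\<in>dyadic_cube k m. ennreal (norm (V0 x)) \<partial>lebesgue) \<le> (\<integral>\<^sup>+x\<in>dyadic_cube k m. ennreal (norm (V x)) \<partial>lebesgue)"
          unfolding eq by (intro nn_integral_mono) (auto simp: indicator_def)
        then show "(\<integral>\<^sup>+x\<in>dyadic_cube k m. ennreal (norm (V0 x)) \<partial>lebesgue) < \<infinity>"
          using finite_on_cubesD(3)[OF Vf] by (rule le_less_trans)
      qed simp
    qed
    show "\<exists>\<delta>>0. \<forall>u r. r > 0 \<longrightarrow> u \<in> sobolev 2 2 \<longrightarrow> \<not> (AE x in lebesgue. u x = 0) \<longrightarrow>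
        (AE x in lebesgue. norm (laplacian u x) \<le> norm (V x * u x)) \<longrightarrow>
        ess_support u \<subseteq> ball a r \<longrightarrow> measure lebesgue (ball a r) \<ge> \<delta>"
    \<comment> \<open>The radius \<open>r0\<close> was fixed before \<open>u\<close>, and a solution
      supported in B(a, r) with r < r0 will turn out to be trivial.\<close>
    proof (intro exI[of _ "measure lebesgue (ball a r0)"] conjI allI impI)
      show "measure lebesgue (ball a r0) > 0"
        using content_ball_pos[OF r0(1), of a] by simp
      fix u :: "real^'n \<Rightarrow> complex" and r :: real
      assume r: "r > 0" and u: "u \<in> sobolev 2 2" and nz: "\<not> (AE x in lebesgue. u x = 0)"
        and le: "AE x in lebesgue. norm (laplacian u x) \<le> norm (V x * u x)"
        and supp: "ess_support u \<subseteq> ball a r"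
      have "\<not> r < r0"
      proof
        assume rr: "r < r0"
        have u0: "AE x in lebesgue. x \<notin> ball a r \<longrightarrow> u x = 0"
          using AE_zero_outside_ess_support[of u] by eventually_elim (use supp in auto)
        \<comment> \<open>Inside B(a, r) the functions V0 and V agree; outside, u = 0 makes both
          right-hand sides 0.\<close>
        have le0: "AE x in lebesgue. norm (laplacian u x) \<le> norm (V0 x * u x)"
          using le u0
        proof eventually_elim
          case (elim x)
          then show ?case using rr by (cases "x \<in> ball a r") (auto simp: V0_def indicator_def)
        qed
        have "AE x in lebesgue. u x = 0"
          by (rule vanishing_of_small_support[OF assms u r u0 V0 KS _ _ le0])
            (use \<epsilon> c\<epsilon> in \<open>auto simp: c_def p_def \<kappa>_def mult.assoc\<close>)
        then show False using nz by simp
      qed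
      then have "ball a r0 \<subseteq> ball a r" by auto
      then show "measure lebesgue (ball a r0) \<le> measure lebesgue (ball a r)"
        by (intro measure_mono_fmeasurable) auto
    qed
  qed
qed

end
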